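(* Let $f:(\mathbb{C}^n,0)\to(\mathbb{C},0)$ be a weakly semiquasihomogeneous function of type $(1;l_1,\ldots,l_n)$. Define the multisets $L:=[l_1,\ldots,l_n]$ and $L^-:=\left[1-a: a\in L\wedge a>\tfrac12\right]$, and the set $L^0:=(L\setminus L^-)\cup\{\tfrac12\}$, where $L\setminus L^-$ is the difference of multisets. Put $l_{\min}:=\min L^0$. Then $$\mathcal{L}_0(f)=\frac{1}{l_{\min}}-1.$$
   Context: All functions are germs of holomorphic functions $(\mathbb{C}^n,0)\to(\mathbb{C},0)$. Such a germ $f$ is an (isolated) singularity if it has an isolated critical point at $0$. For real weights $l=(l_1,\ldots,l_n)$ the weighted degree of a monomial $z^a=z_1^{a_1}\cdots z_n^{a_n}$ is $\deg_l(z^a):=a_1l_1+\cdots+a_nl_n$. A germ $f$ is weakly quasihomogeneous of type $(d;l_1,\ldots,l_n)$, where $d\in\mathbb{R}_{>0}$ and $l\in\mathbb{R}^n$ (weights may be zero or negative), if every monomial appearing in its expansion with non-zero coefficient has weighted degree $d$. A germ $f$ is weakly semiquasihomogeneous of type $(d;l_1,\ldots,l_n)$ if $f=f_0+f'$, where $f_0$ (the principal part of $f$) is a weakly quasihomogeneous isolated singularity of type $(d;l_1,\ldots,l_n)$, $\operatorname{ord} f'>1$ (usual order at $0$, with $\operatorname{ord} 0=\infty$), and every monomial appearing in the expansion of $f'$ with non-zero coefficient has weighted degree greater than $d$. For a holomorphic map-germ $F:(\mathbb{C}^n,0)\to(\mathbb{C}^m,0)$ the Łojasiewicz exponent is $$l_0(F):=\inf\{q\in\mathbb{Q}_{>0}: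 C_1\|z\|^q\leqslant\|F(z)\|\text{ for some }C_1>0\text{ and all }z\text{ with }\|z\|\text{ sufficiently small}\},$$ and $\mathcal{L}_0(f):=l_0\left(\frac{\partial f}{\partial z_1},\ldots,\frac{\partial f}{\partial z_n}\right)$. Multisets are written with square brackets and counted with multiplicity; in $L\setminus L^-$ the multiplicity of an element is the multiplicity in $L$ minus that in $L^-$ (or $0$ if this is negative). *)

theory Defs
  imports "HOL-Analysis.Analysis" "HOL-Library.Multiset" "HOL-Library.Extended_Nat"
    "HOL-Library.Extended_Real"
begin

(* Germs at 0 are represented by functions defined on the whole space; every notion
   below depends only on the values of the function near 0. *)

definition monomial :: "('n::finite \<Rightarrow> nat) \<Rightarrow> complex ^ 'n \<Rightarrow> complex" where
  "monomial a z = (\<Prod>i\<in>UNIV. (z $ i) ^ a i)"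

(* The family c of coefficients is uniquely determined by the germ of f at 0, so
   quantifying existentially over c, as done below, amounts to speaking about "the"
   expansion of f. *)
definition has_expansion ::
    "(complex ^ 'n \<Rightarrow> complex) \<Rightarrow> (('n::finite \<Rightarrow> nat) \<Rightarrow> complex) \<Rightarrow> bool" where
  "has_expansion f c \<longleftrightarrow> (\<forall>\<^sub>F z in nhds 0. ((\<lambda>a. c a * monomial a z) has_sum f z) UNIV)"

(* Holomorphic germs (C^n,0) -> (C,0): sums of convergent power series. *)
definition holomorphic_germ :: "(complex ^ 'n::finite \<Rightarrow> complex) \<Rightarrow> bool" where
  "holomorphic_germ f \<longleftrightarrow> (\<exists>c. has_expansion f c) \<and> f 0 = 0"

(* The order of the zero series is Inf {} = \<infinity>. *)
definition series_order :: "(('n::finite \<Rightarrow> nat) \<Rightarrow> complex) \<Rightarrow> enat" where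
  "series_order c = (INF a\<in>{a. c a \<noteq> 0}. enat (\<Sum>i\<in>UNIV. a i))"

definition weighted_degree :: "real ^ 'n \<Rightarrow> ('n::finite \<Rightarrow> nat) \<Rightarrow> real" where
  "weighted_degree l a = (\<Sum>i\<in>UNIV. real (a i) * l $ i)"

definition gradient :: "(complex ^ 'n::finite \<Rightarrow> complex) \<Rightarrow> complex ^ 'n \<Rightarrow> complex ^ 'n" where
  "gradient f z = (\<chi> i. deriv (\<lambda>t. f (z + axis i t)) 0)"

definition isolated_singularity :: "(complex ^ 'n::finite \<Rightarrow> complex) \<Rightarrow> bool" where
  "isolated_singularity f \<longleftrightarrow>
     holomorphic_germ f \<and> gradient f 0 = 0 \<and> (\<forall>\<^sub>F z in at 0. gradient f z \<noteq> 0)"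

definition weakly_quasihomogeneous ::
    "(complex ^ 'n::finite \<Rightarrow> complex) \<Rightarrow> real \<Rightarrow> real ^ 'n \<Rightarrow> bool" where
  "weakly_quasihomogeneous f d l \<longleftrightarrow>
     holomorphic_germ f \<and> 0 < d \<and>
     (\<exists>c. has_expansion f c \<and> (\<forall>a. c a \<noteq> 0 \<longrightarrow> weighted_degree l a = d))"

definition weakly_semiquasihomogeneous ::
    "(complex ^ 'n::finite \<Rightarrow> complex) \<Rightarrow> real \<Rightarrow> real ^ 'n \<Rightarrow> bool" where
  "weakly_semiquasihomogeneous f d l \<longleftrightarrow>
     holomorphic_germ f \<and>
     (\<exists>f0 f'.
        (\<forall>\<^sub>F z in nhds 0. f z = f0 z + f' z) \<and>
        weakly_quasihomogeneous f0 d l \<and> isolated_singularity f0 \<and>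
        holomorphic_germ f' \<and>
        (\<exists>c. has_expansion f' c \<and> series_order c > 1 \<and>
             (\<forall>a. c a \<noteq> 0 \<longrightarrow> weighted_degree l a > d)))"

(* Taken in the extended reals: the exponent is \<infinity> if no admissible q exists. *)
definition lojasiewicz_exponent :: "(complex ^ 'n::finite \<Rightarrow> complex ^ 'm::finite) \<Rightarrow> ereal" where
  "lojasiewicz_exponent F =
     Inf {ereal q | q. q \<in> \<rat> \<and> 0 < q \<and>
            (\<exists>C>0. \<forall>\<^sub>F z in nhds 0. C * norm z powr q \<le> norm (F z))}"

definition gradient_lojasiewicz_exponent :: "(complex ^ 'n::finite \<Rightarrow> complex) \<Rightarrow> ereal" where
  "gradient_lojasiewicz_exponent f = lojasiewicz_exponent (gradient f)"

definition weights :: "real ^ 'n::finite \<Rightarrow> real multiset" where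
  "weights l = {# l $ i. i \<in># mset_set UNIV #}"

definition reflected_weights :: "real multiset \<Rightarrow> real multiset" where
  "reflected_weights L = {# 1 - a. a \<in># filter_mset (\<lambda>a. a > 1/2) L #}"

definition reduced_weights :: "real ^ 'n::finite \<Rightarrow> real set" where
  "reduced_weights l = set_mset (weights l - reflected_weights (weights l)) \<union> {1/2}"

definition l_min :: "real ^ 'n::finite \<Rightarrow> real" where
  "l_min l = Min (reduced_weights l)"

end

theory Submission
  imports Defs "HOL-Complex_Analysis.Cauchy_Integral_Formula"
begin

text \<open>
  Analytic sets are avoided throughout by one second-order test: if \<open>\<Sum>k. w k * |h k|\<^sup>2\<close>, with the \<open>h k\<close>
  holomorphic and the \<open>w k\<close> real, has a local maximum at \<open>z\<close>, then \<open>\<Sum>k. w k * |dh k \<xi>|\<^sup>2 \<le> 0\<close> for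
  every direction \<open>\<xi>\<close>. Taking \<open>\<xi>\<close> in the kernel of the differentials of fewer than \<open>n\<close> functions, which
  enter with large negative \<open>w k\<close>, one gets a maximum principle on their common fibres, singular or not.

  Positive weights. By homogeneity some \<open>\<partial>\<^sub>i f\<close> has size at least \<open>\<rho>\<close> to the power \<open>1 - l\<^sub>i\<close>, where \<open>\<rho>\<close>
  is the weighted norm. The variables of weight greater than 1/2 pair with variables of the reflected
  weights through an invertible minor of the Hessian; solving for all of these by Newton's method leaves
  only weights at least \<open>l_min\<close>, whence the upper bound. For the lower bound let \<open>l\<^sub>k = l_min < 1/2\<close>. It
  suffices to find a zero of all \<open>\<partial>\<^sub>j f\<close>, \<open>j \<noteq> k\<close>, with \<open>z\<^sub>k = 1\<close> after rescaling. One deforms the equation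
  \<open>\<nabla>' f = s a\<close> from \<open>s = 1\<close> to \<open>s = 0\<close>; by Euler's relation the Legendre transform \<open>p\<close> of \<open>f\<close> controls the
  weighted norm, while \<open>|dp/ds|\<close> is at most a multiple of \<open>1 + |p|\<close>, so solutions cannot escape to infinity.

  Arbitrary weights. Counting variables against non-vanishing partial derivatives on coordinate subspaces
  shows that the weights \<open>a \<ge> 1\<close> and \<open>1 - a \<le> 0\<close> are equinumerous and paired by an invertible Hessian block.
  Replacing them by \<open>1 - \<epsilon>\<close> and \<open>\<epsilon>\<close> keeps \<open>f\<close> semiquasihomogeneous and does not change \<open>l_min\<close>.
\<close>

section \<open>Power series in several variables\<close>

text \<open>Write m for \<open>l_min\<close>. If all partial derivatives but the k-th vanish at the
  dilate y by t of a bounded point z with z_k = 1, then |y| is at least t^m and the gradient at y is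
  O(t^(1-m)), which gives the exponent (1-m)/m. The danger is that for z_k = 1 all solutions of that
  system lie at infinity. The solutions of G = s a need not form smooth paths in s, so no path is
  followed: one function of all variables and of s is maximised, and the second-order test places
  its maximum near s = 0. The control is dp = - (sum of w_i a_i) ds on solutions. For |p| to grow
  like rho^(1-m) and to dominate the terms w_i a_i, of size rho^(l_i), the vector a is made to
  vanish wherever l_i >= 1-m. It is the gradient at a point supported on the weight m and
  annihilated by the Hessian rows of weight 1-m; such a point with k-th coordinate 1 exists because
  k is left unmatched. For arbitrary weights the delicate point is that the new principal part is
  again isolated: a Newton correction in the variables of weight at least 1 turns any further zero
  of its gradient into a critical point of the old f0.\<close>

definition expands :: "real \<Rightarrow> (complex ^ 'n::finite \<Rightarrow> complex) \<Rightarrow> (('n \<Rightarrow> nat) \<Rightarrow> complex) \<Rightarrow> bool" where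
  "expands r h c \<longleftrightarrow> 0 < r \<and>
     (\<forall>z. (\<forall>i. norm (z $ i) \<le> r) \<longrightarrow> ((\<lambda>a. c a * monomial a z) has_sum h z) UNIV)"

lemma norm_le_sum_nth: "norm (z :: complex ^ 'n::finite) \<le> (\<Sum>i\<in>UNIV. norm (z $ i))"
  unfolding norm_vec_def by (rule L2_set_le_sum) auto

lemma norm_le_card_nth:
  assumes "\<And>i. norm ((z :: complex ^ 'n::finite) $ i) \<le> b"
  shows "norm z \<le> of_nat CARD('n) * b"
  using norm_le_sum_nth[of z] sum_bounded_above[of UNIV "\<lambda>i. norm (z $ i)" b] assms by auto

lemma norm_nth_le_norm: "norm ((z :: complex ^ 'n::finite) $ i) \<le> norm z"
  by (rule Finite_Cartesian_Product.norm_nth_le)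

lemma expandsD:
  "expands r h c \<Longrightarrow> (\<And>i. norm (z $ i) \<le> r) \<Longrightarrow> ((\<lambda>a. c a * monomial a z) has_sum h z) UNIV"
  unfolding expands_def by blast

lemma expands_pos: "expands r h c \<Longrightarrow> 0 < r"
  unfolding expands_def by blast

lemma has_expansion_expands:
  assumes "has_expansion (f :: complex ^ 'n::finite \<Rightarrow> complex) c"
  obtains r where "expands r f c"
proof -
  obtain d where d: "d > 0" "\<And>z. dist z 0 < d \<Longrightarrow> ((\<lambda>a. c a * monomial a z) has_sum f z) UNIV"
    using assms unfolding has_expansion_def eventually_nhds_metric by blast
  define r where "r = d / (2 * CARD('n))"
  have "r > 0" using d by (simp add: r_def)
  moreover have "dist z 0 < d" if "\<And>i. norm (z $ i) \<le> r" for z :: "complex ^ 'n"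
  proof -
    have "norm z \<le> CARD('n) * r" using norm_le_card_nth[OF that] by simp
    also have "\<dots> = d / 2" by (simp add: r_def)
    also have "\<dots> < d" using d by simp
    finally show ?thesis by simp
  qed
  ultimately have "expands r f c" unfolding expands_def using d(2) by blast
  then show thesis by (rule that)
qed

lemma norm_monomial_le:
  assumes "\<And>i. norm (z $ i) \<le> r"
  shows "norm (monomial a z) \<le> r ^ (\<Sum>i\<in>UNIV. a i)"
proof -
  have "norm (monomial a z) = (\<Prod>i\<in>UNIV. norm (z $ i) ^ a i)"
    by (simp add: monomial_def prod_norm[symmetric] norm_power)
  also have "\<dots> \<le> (\<Prod>i\<in>UNIV. r ^ a i)"
    by (intro prod_mono) (auto intro: power_mono assms)
  also have "\<dots> = r ^ (\<Sum>i\<in>UNIV. a i)" by (simp add: power_sum)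
  finally show ?thesis .
qed

text \<open>The series converges at the corner (r, ..., r), and for complex numbers unconditional
  summability is absolute. This is the majorant of every Weierstrass test below.\<close>

lemma expands_summable:
  assumes "expands r h c"
  shows "(\<lambda>a. norm (c a) * r ^ (\<Sum>i\<in>UNIV. a i)) summable_on UNIV"
proof -
  have r: "r > 0" using assms by (rule expands_pos)
  define z :: "complex ^ 'a" where "z = (\<chi> i. of_real r)"
  have "((\<lambda>a. c a * monomial a z) has_sum h z) UNIV"
    by (rule expandsD[OF assms]) (use r in \<open>simp add: z_def\<close>)
  then have "(\<lambda>a. c a * monomial a z) summable_on UNIV" by (rule has_sum_imp_summable)
  then have "(\<lambda>a. norm (c a * monomial a z)) summable_on UNIV"
    by (simp add: summable_on_iff_abs_summable_on_complex)
  moreover have "norm (c a * monomial a z) = norm (c a) * r ^ (\<Sum>i\<in>UNIV. a i)" for a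
    using r by (simp add: z_def monomial_def norm_mult power_sum prod_norm[symmetric] norm_power)
  ultimately show ?thesis by simp
qed

text \<open>The j-th partial derivative of \<open>monomial a\<close>. For \<open>a j = 0\<close> the
  truncated subtraction is neutralised by the factor \<open>of_nat (a j)\<close>.\<close>

definition dmonomial :: "'n \<Rightarrow> ('n::finite \<Rightarrow> nat) \<Rightarrow> complex ^ 'n \<Rightarrow> complex" where
  "dmonomial j a z = of_nat (a j) * monomial (a(j := a j - 1)) z"

lemma monomial_line_derivative:
  "((\<lambda>\<tau>. monomial a (z + \<tau> *s \<xi>)) has_field_derivative
     (\<Sum>j\<in>UNIV. \<xi> $ j * dmonomial j a (z + \<tau> *s \<xi>))) (at \<tau>)"
proof -
  have 1: "((\<lambda>\<tau>. \<Prod>i\<in>UNIV. (z $ i + \<tau> * \<xi> $ i) ^ a i) has_field_derivative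
      (\<Sum>j\<in>UNIV. (of_nat (a j) * (z $ j + \<tau> * \<xi> $ j) ^ (a j - 1) * \<xi> $ j) *
        (\<Prod>i\<in>UNIV - {j}. (z $ i + \<tau> * \<xi> $ i) ^ a i))) (at \<tau>)"
    by (rule has_field_derivative_prod) (auto intro!: derivative_eq_intros)
  have 2: "dmonomial j a (z + \<tau> *s \<xi>) = of_nat (a j) * (z $ j + \<tau> * \<xi> $ j) ^ (a j - 1) *
        (\<Prod>i\<in>UNIV - {j}. (z $ i + \<tau> * \<xi> $ i) ^ a i)" for j
    unfolding dmonomial_def monomial_def by (subst prod.remove[of UNIV j]) auto
  show ?thesis
    unfolding 2 using 1 by (simp add: monomial_def mult_ac)
qed

text \<open>Halving the radius pays for the factor \<open>a j\<close>: it is at most 2^|a|, and the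
  powers of r/2 supply the inverse of this up to 2/r.\<close>

lemma norm_dmonomial_le:
  assumes "\<And>i. norm (z $ i) \<le> r / 2" and "0 < r"
  shows "norm (dmonomial j a z) \<le> (2 / r) * r ^ (\<Sum>i\<in>UNIV. a i)"
proof (cases "a j = 0")
  case True
  then show ?thesis using assms by (simp add: dmonomial_def)
next
  case False
  have s: "(\<Sum>i\<in>UNIV. (a(j := a j - 1)) i) + 1 = (\<Sum>i\<in>UNIV. a i)"
    using False by (simp add: sum.remove[of UNIV j])
  define N where "N = (\<Sum>i\<in>UNIV. (a(j := a j - 1)) i)"
  have aN: "a j \<le> N + 1" using s by (metis N_def UNIV_I finite_code member_le_sum zero_le)
  have "norm (dmonomial j a z) \<le> real (a j) * (r/2) ^ N"
    unfolding dmonomial_def N_def norm_mult norm_of_nat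
    by (intro mult_left_mono norm_monomial_le assms) auto
  also have "\<dots> \<le> 2 ^ (N+1) * (r/2) ^ N"
  proof (intro mult_right_mono)
    have "a j < 2 ^ (N+1)" using aN less_exp[of "N+1"] by linarith
    then show "real (a j) \<le> 2 ^ (N+1)" by (metis less_imp_le of_nat_le_iff of_nat_numeral of_nat_power)
  qed (use assms in auto)
  also have "\<dots> = (2/r) * r ^ (N+1)" using assms by (simp add: power_divide)
  also have "N + 1 = (\<Sum>i\<in>UNIV. a i)" using s by (simp add: N_def)
  finally show ?thesis .
qed

definition diff_coeff :: "'n \<Rightarrow> (('n \<Rightarrow> nat) \<Rightarrow> complex) \<Rightarrow> ('n \<Rightarrow> nat) \<Rightarrow> complex" where
  "diff_coeff j c a = of_nat (Suc (a j)) * c (a(j := Suc (a j)))"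

text \<open>Raising the j-th exponent by one is an injective reindexing, and the exponents that it
  misses have \<open>a j = 0\<close>, where \<open>dmonomial\<close> vanishes.\<close>

lemma has_sum_diff_coeff_iff:
  "((\<lambda>a. c a * dmonomial j a z) has_sum s) UNIV \<longleftrightarrow> ((\<lambda>a. diff_coeff j c a * monomial a z) has_sum s) UNIV"
proof -
  let ?u = "\<lambda>a. a(j := Suc (a j))"
  have inj: "inj ?u"
  proof (rule injI)
    fix a b :: "'a \<Rightarrow> nat" assume e: "?u a = ?u b"
    show "a = b"
    proof
      fix i show "a i = b i" using fun_cong[OF e, of i] by (auto split: if_splits)
    qed
  qed
  have "((\<lambda>a. c a * dmonomial j a z) has_sum s) UNIV \<longleftrightarrow> ((\<lambda>a. c a * dmonomial j a z) has_sum s) (range ?u)"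
  proof (rule has_sum_cong_neutral)
    fix a assume "a \<in> UNIV - range ?u"
    then have "a j = 0"
      by (metis (no_types, lifting) Diff_iff fun_upd_triv fun_upd_upd not0_implies_Suc rangeI fun_upd_same)
    then show "c a * dmonomial j a z = 0" by (simp add: dmonomial_def)
  qed auto
  also have "\<dots> \<longleftrightarrow> (((\<lambda>a. c a * dmonomial j a z) \<circ> ?u) has_sum s) UNIV"
    by (rule has_sum_reindex[OF inj])
  also have "(\<lambda>a. c a * dmonomial j a z) \<circ> ?u = (\<lambda>a. diff_coeff j c a * monomial a z)"
    by (auto simp: dmonomial_def diff_coeff_def)
  finally show ?thesis .
qed

lemma expands_diff_coeff_summable:
  assumes h: "expands r h c" and z: "\<And>i. norm (z $ i) \<le> r / 2"
  shows "(\<lambda>a. c a * dmonomial j a z) summable_on UNIV"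
proof -
  have "(\<lambda>a. norm (c a * dmonomial j a z)) summable_on UNIV"
  proof (rule summable_on_comparison_test)
    show "(\<lambda>a. (2/r) * (norm (c a) * r ^ (\<Sum>i\<in>UNIV. a i))) summable_on UNIV"
      by (intro summable_on_cmult_right expands_summable[OF h])
    show "norm (c a * dmonomial j a z) \<le> (2/r) * (norm (c a) * r ^ (\<Sum>i\<in>UNIV. a i))" for a
      using mult_left_mono[OF norm_dmonomial_le[OF z expands_pos[OF h], of j a], of "norm (c a)"]
      by (simp add: norm_mult mult_ac)
  qed auto
  then show ?thesis by (rule abs_summable_summable)
qed

text \<open>Along a complex line the one-variable theorem on uniform limits of holomorphic functions
  differentiates the series term by term. All later differentiation is along such lines.\<close>

lemma expands_line_derivative:
  assumes h: "expands r h c" and z: "\<And>i. norm (z $ i) < r / 2"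
  shows "((\<lambda>\<tau>. h (z + \<tau> *s \<xi>)) has_field_derivative
          (\<Sum>j\<in>UNIV. \<xi> $ j * (\<Sum>\<^sub>\<infinity>a. c a * dmonomial j a z))) (at 0)"
proof -
  have r: "r > 0" using h by (rule expands_pos)
  \<comment> \<open>With this radius the displacement is at most r/2, so the line stays in the
    polydisc of radius r.\<close>
  define e where "e = r / (2 * (1 + norm \<xi>))"
  have e: "e > 0" using r by (auto simp: e_def intro!: divide_pos_pos add_pos_nonneg)
  have zb: "norm ((z + \<tau> *s \<xi>) $ i) \<le> r" if "norm \<tau> \<le> e" for \<tau> i
  proof -
    have "norm ((z + \<tau> *s \<xi>) $ i) \<le> norm (z $ i) + norm \<tau> * norm (\<xi> $ i)"
      using norm_triangle_ineq[of "z $ i" "\<tau> * \<xi> $ i"] by (simp add: norm_mult)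
    also have "\<dots> \<le> r/2 + e * norm \<xi>"
      using z[of i] that e by (intro add_mono mult_mono norm_nth_le_norm) auto
    also have "e * norm \<xi> = (r/2) * (norm \<xi> / (1 + norm \<xi>))" by (simp add: e_def)
    also have "\<dots> \<le> (r/2) * 1" using r by (intro mult_left_mono) (auto simp: divide_le_eq add_pos_nonneg)
    finally show ?thesis by simp
  qed
  have ul: "uniform_limit (cball 0 e) (\<lambda>A \<tau>. \<Sum>a\<in>A. c a * monomial a (z + \<tau> *s \<xi>))
      (\<lambda>\<tau>. h (z + \<tau> *s \<xi>)) (finite_subsets_at_top UNIV)"
  proof (rule Weierstrass_m_test_general')
    show "norm (c a * monomial a (z + \<tau> *s \<xi>)) \<le> norm (c a) * r ^ (\<Sum>i\<in>UNIV. a i)"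
      if "\<tau> \<in> cball 0 e" for a \<tau>
      unfolding norm_mult by (intro mult_left_mono norm_monomial_le zb) (use that in auto)
    show "((\<lambda>a. c a * monomial a (z + \<tau> *s \<xi>)) has_sum h (z + \<tau> *s \<xi>)) UNIV" if "\<tau> \<in> cball 0 e" for \<tau>
      by (rule expandsD[OF h]) (use that zb in auto)
  qed (rule expands_summable[OF h])
  let ?d = "\<lambda>A \<tau>. \<Sum>a\<in>A. c a * (\<Sum>j\<in>UNIV. \<xi> $ j * dmonomial j a (z + \<tau> *s \<xi>))"
  have der: "((\<lambda>\<tau>. \<Sum>a\<in>A. c a * monomial a (z + \<tau> *s \<xi>)) has_field_derivative ?d A \<tau>) (at \<tau>)" for A \<tau>
    by (intro DERIV_sum DERIV_cmult monomial_line_derivative)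
  have ev: "\<forall>\<^sub>F A in finite_subsets_at_top UNIV. continuous_on (cball 0 e) (\<lambda>\<tau>. \<Sum>a\<in>A. c a * monomial a (z + \<tau> *s \<xi>)) \<and>
     (\<forall>\<tau>\<in>ball 0 e. ((\<lambda>\<tau>. \<Sum>a\<in>A. c a * monomial a (z + \<tau> *s \<xi>)) has_field_derivative ?d A \<tau>) (at \<tau>))"
    using der by (auto intro!: always_eventually DERIV_continuous_on intro: has_field_derivative_at_within)
  obtain g' where g': "\<And>w. w \<in> ball 0 e \<Longrightarrow> ((\<lambda>\<tau>. h (z + \<tau> *s \<xi>)) has_field_derivative g' w) (at w) \<and>
       ((\<lambda>A. ?d A w) \<longlongrightarrow> g' w) (finite_subsets_at_top UNIV)"
    using has_complex_derivative_uniform_limit[OF ev ul _ e] by auto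
  have sums: "((\<lambda>a. c a * dmonomial j a z) has_sum (\<Sum>\<^sub>\<infinity>a. c a * dmonomial j a z)) UNIV" for j
    by (rule has_sum_infsum expands_diff_coeff_summable[OF h])+ (use z less_imp_le in blast)
  have "((\<lambda>A. \<Sum>j\<in>UNIV. \<xi> $ j * (\<Sum>a\<in>A. c a * dmonomial j a z)) \<longlongrightarrow>
       (\<Sum>j\<in>UNIV. \<xi> $ j * (\<Sum>\<^sub>\<infinity>a. c a * dmonomial j a z))) (finite_subsets_at_top UNIV)"
    by (intro tendsto_sum tendsto_mult tendsto_const sums[unfolded has_sum_def])
  moreover have "(\<Sum>j\<in>UNIV. \<xi> $ j * (\<Sum>a\<in>A. c a * dmonomial j a z)) = ?d A 0" for A
    by (simp add: sum_distrib_left mult_ac sum.swap[of _ A])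
  ultimately have "((\<lambda>A. ?d A 0) \<longlongrightarrow> (\<Sum>j\<in>UNIV. \<xi> $ j * (\<Sum>\<^sub>\<infinity>a. c a * dmonomial j a z))) (finite_subsets_at_top UNIV)"
    by simp
  then have "g' 0 = (\<Sum>j\<in>UNIV. \<xi> $ j * (\<Sum>\<^sub>\<infinity>a. c a * dmonomial j a z))"
    using g'[of 0] e tendsto_unique[OF finite_subsets_at_top_neq_bot] by auto
  with g'[of 0] e show ?thesis by auto
qed

lemma expands_gradient_eq:
  assumes h: "expands r h c" and z: "\<And>i. norm (z $ i) < r / 2"
  shows "gradient h z $ j = (\<Sum>\<^sub>\<infinity>a. c a * dmonomial j a z)"
proof -
  have e: "\<tau> *s axis j (1::complex) = axis j \<tau>" for \<tau> :: complex
    by (simp add: vec_eq_iff axis_def)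
  have "(\<Sum>i\<in>UNIV. axis j 1 $ i * (\<Sum>\<^sub>\<infinity>a. c a * dmonomial i a z)) = (\<Sum>\<^sub>\<infinity>a. c a * dmonomial j a z)"
    by (simp add: axis_def if_distrib[of "\<lambda>x. x * _"] cong: if_cong)
  then have "((\<lambda>\<tau>. h (z + axis j \<tau>)) has_field_derivative (\<Sum>\<^sub>\<infinity>a. c a * dmonomial j a z)) (at 0)"
    using expands_line_derivative[OF h z, of "axis j 1"] by (simp add: e)
  then show ?thesis by (simp add: gradient_def DERIV_imp_deriv)
qed

lemma expands_gradient:
  assumes h: "expands r h c"
  shows "expands (r / 3) (\<lambda>z. gradient h z $ j) (diff_coeff j c)"
  unfolding expands_def
proof (intro conjI allI impI)
  show "0 < r / 3" using expands_pos[OF h] by simp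
  fix z :: "complex ^ 'a" assume z: "\<forall>i. norm (z $ i) \<le> r / 3"
  have r: "r > 0" using h by (rule expands_pos)
  \<comment> \<open>The radius is r/3 and not r/2 because \<open>expands\<close> speaks of a closed
    polydisc, while the derivative formula needs a strict inequality.\<close>
  have z2: "norm (z $ i) < r / 2" for i using z[rule_format, of i] r by simp
  have "(\<lambda>a. c a * dmonomial j a z) summable_on UNIV"
    by (rule expands_diff_coeff_summable[OF h]) (use z2 less_imp_le in blast)
  then have "((\<lambda>a. c a * dmonomial j a z) has_sum gradient h z $ j) UNIV"
    unfolding expands_gradient_eq[OF h z2] by (rule has_sum_infsum)
  then show "((\<lambda>a. diff_coeff j c a * monomial a z) has_sum gradient h z $ j) UNIV"
    by (simp add: has_sum_diff_coeff_iff)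
qed

lemma expands_has_line_derivative:
  assumes h: "expands r h c" and z: "\<And>i. norm (z $ i) < r / 2"
  shows "((\<lambda>\<tau>. h (z + \<tau> *s \<xi>)) has_field_derivative (\<Sum>j\<in>UNIV. \<xi> $ j * gradient h z $ j)) (at 0)"
  using expands_line_derivative[OF h z] by (simp add: expands_gradient_eq[OF h z])

lemma expands_continuous:
  assumes h: "expands r h c"
  shows "continuous_on {z. \<forall>i. norm (z $ i) \<le> r} h"
proof (rule uniform_limit_theorem)
  show "uniform_limit {z. \<forall>i. norm (z $ i) \<le> r} (\<lambda>A z. \<Sum>a\<in>A. c a * monomial a z) h (finite_subsets_at_top UNIV)"
  proof (rule Weierstrass_m_test_general')
    show "norm (c a * monomial a z) \<le> norm (c a) * r ^ (\<Sum>i\<in>UNIV. a i)"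
      if "z \<in> {z. \<forall>i. norm (z $ i) \<le> r}" for a z
      unfolding norm_mult by (intro mult_left_mono norm_monomial_le) (use that in auto)
    show "((\<lambda>a. c a * monomial a z) has_sum h z) UNIV" if "z \<in> {z. \<forall>i. norm (z $ i) \<le> r}" for z
      by (rule expandsD[OF h]) (use that in auto)
  qed (rule expands_summable[OF h])
  show "\<forall>\<^sub>F A in finite_subsets_at_top UNIV. continuous_on {z. \<forall>i. norm (z $ i) \<le> r} (\<lambda>z. \<Sum>a\<in>A. c a * monomial a z)"
    by (auto intro!: always_eventually continuous_intros simp: monomial_def)
qed auto

lemma monomial_0: "monomial a 0 = (if a = (\<lambda>_. 0) then 1 else 0)"
proof (cases "a = (\<lambda>_. 0)")
  case False
  then obtain i where "a i \<noteq> 0" by auto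
  then have "(\<Prod>i\<in>UNIV. ((0::complex ^ 'a) $ i) ^ a i) = 0" by (intro prod_zero) (auto intro!: bexI[of _ i])
  with False show ?thesis by (simp add: monomial_def)
qed (simp add: monomial_def)

lemma has_sum_finite_support:
  assumes s: "((f :: 'a \<Rightarrow> complex) has_sum s) UNIV" and S: "finite S" and "\<And>a. a \<notin> S \<Longrightarrow> f a = 0"
  shows "s = sum f S"
proof -
  have "(f has_sum s) UNIV \<longleftrightarrow> (f has_sum s) S"
    by (rule has_sum_cong_neutral) (use assms in auto)
  with s have "(f has_sum s) S" by simp
  moreover have "(f has_sum sum f S) S" using S by (rule has_sum_finite)
  ultimately show ?thesis by (rule has_sum_unique)
qed

lemma expands_at_0:
  assumes h: "expands r h c" shows "h 0 = c (\<lambda>_. 0)"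
proof -
  have "((\<lambda>a. c a * monomial a 0) has_sum h 0) UNIV"
    by (rule expandsD[OF h]) (use expands_pos[OF h] in auto)
  from has_sum_finite_support[OF this, of "{\<lambda>_. 0}"] show ?thesis by (auto simp: monomial_0)
qed

section \<open>A second-order test in place of the maximum principle\<close>

lemma norm_add_square: "(norm (a + b :: complex))\<^sup>2 = (norm a)\<^sup>2 + 2 * Re (cnj a * b) + (norm b)\<^sup>2"
  unfolding cmod_power2 by (simp add: power2_eq_square algebra_simps)

lemma abs_Re_cnj_mult_le: "\<bar>Re (cnj a * b)\<bar> \<le> norm a * norm b"
  by (metis abs_Re_le_cmod complex_mod_cnj norm_mult)

text \<open>Up to O(|t|^3) only |a1|^2 |t|^2 fails to be harmonic: the other terms are the constant
  and real parts of multiples of t and t^2. This is all the subharmonicity that the second-order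
  test needs.\<close>

lemma square_jet_error:
  fixes a0 a1 a2 t z :: complex
  assumes t: "norm t \<le> 1" and z: "norm z \<le> B * norm t ^ 3" and B: "0 \<le> B"
  shows "\<bar>(norm (a0 + (a1 * t + a2 * t\<^sup>2 + z)))\<^sup>2 - (norm a0)\<^sup>2 - Re (2 * cnj a0 * a1 * t)
           - Re (2 * cnj a0 * a2 * t\<^sup>2) - (norm a1)\<^sup>2 * (norm t)\<^sup>2\<bar>
       \<le> (2 * norm a0 * B + 2 * norm a1 * (norm a2 + B) + (norm a2 + B)\<^sup>2) * norm t ^ 3"
proof -
  have t3: "norm t ^ 3 \<le> norm t ^ 2" "norm t ^ 4 \<le> norm t ^ 3"
    using t by (auto intro!: power_decreasing)
  define v where "v = a2 * t\<^sup>2 + z"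
  have v: "norm v \<le> (norm a2 + B) * norm t ^ 2"
  proof -
    have "norm v \<le> norm a2 * norm t ^ 2 + B * norm t ^ 3"
      unfolding v_def using norm_triangle_ineq[of "a2 * t\<^sup>2" z] z by (simp add: norm_mult norm_power)
    also have "\<dots> \<le> norm a2 * norm t ^ 2 + B * norm t ^ 2" using t3 B by (simp add: mult_left_mono)
    finally show ?thesis by (simp add: algebra_simps)
  qed
  have "(norm (a0 + (a1 * t + a2 * t\<^sup>2 + z)))\<^sup>2 = (norm a0)\<^sup>2 + 2 * Re (cnj a0 * (a1 * t + a2 * t\<^sup>2 + z))
      + (norm (a1 * t + v))\<^sup>2"
    unfolding norm_add_square[of a0] v_def by (simp add: add.assoc)
  also have "(norm (a1 * t + v))\<^sup>2 = (norm (a1 * t))\<^sup>2 + 2 * Re (cnj (a1 * t) * v) + (norm v)\<^sup>2"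
    by (rule norm_add_square)
  finally have eq: "(norm (a0 + (a1 * t + a2 * t\<^sup>2 + z)))\<^sup>2 - (norm a0)\<^sup>2 - Re (2 * cnj a0 * a1 * t)
           - Re (2 * cnj a0 * a2 * t\<^sup>2) - (norm a1)\<^sup>2 * (norm t)\<^sup>2
      = 2 * Re (cnj a0 * z) + 2 * Re (cnj (a1 * t) * v) + (norm v)\<^sup>2"
    by (simp add: norm_mult power_mult_distrib algebra_simps)
  have p: "\<bar>2 * Re (cnj a0 * z)\<bar> \<le> 2 * norm a0 * B * norm t ^ 3"
    using abs_Re_cnj_mult_le[of a0 z] mult_left_mono[OF z, of "norm a0"] by (simp add: mult_ac)
  have q: "\<bar>2 * Re (cnj (a1 * t) * v)\<bar> \<le> 2 * norm a1 * (norm a2 + B) * norm t ^ 3"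
  proof -
    have "\<bar>Re (cnj (a1 * t) * v)\<bar> \<le> norm (a1 * t) * norm v" by (rule abs_Re_cnj_mult_le)
    also have "\<dots> \<le> norm (a1 * t) * ((norm a2 + B) * norm t ^ 2)" using v by (intro mult_left_mono) auto
    also have "\<dots> = norm a1 * (norm a2 + B) * norm t ^ 3" by (simp add: norm_mult power2_eq_square power3_eq_cube)
    finally show ?thesis by simp
  qed
  have r: "\<bar>(norm v)\<^sup>2\<bar> \<le> (norm a2 + B)\<^sup>2 * norm t ^ 3"
  proof -
    have "(norm v)\<^sup>2 \<le> ((norm a2 + B) * norm t ^ 2)\<^sup>2" using v by (intro power_mono) auto
    also have "\<dots> = (norm a2 + B)\<^sup>2 * norm t ^ 4" by (simp add: power_mult_distrib)
    also have "\<dots> \<le> (norm a2 + B)\<^sup>2 * norm t ^ 3" using t3 by (intro mult_left_mono) auto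
    finally show ?thesis by simp
  qed
  show ?thesis unfolding eq distrib_right using p q r by linarith
qed

lemma holomorphic_square_jet:
  assumes g: "g holomorphic_on ball 0 e" and e: "0 < e"
  shows "\<exists>\<gamma> C d. 0 < d \<and> (\<forall>t. norm t < d \<longrightarrow>
     \<bar>(norm (g t))\<^sup>2 - (norm (g 0))\<^sup>2 - Re (2 * cnj (g 0) * deriv g 0 * t) - Re (\<gamma> * t\<^sup>2)
       - (norm (deriv g 0))\<^sup>2 * (norm t)\<^sup>2\<bar> \<le> C * norm t ^ 3)"
proof -
  \<comment> \<open>Radius at most 1, as \<open>square_jet_error\<close> requires, and compactly
    inside the domain, so that the third derivative is bounded.\<close>
  define S where "S = cball (0::complex) (min 1 (e/2))"
  have SS: "S \<subseteq> ball 0 e" using e by (auto simp: S_def)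
  have h: "(deriv ^^ i) g holomorphic_on ball 0 e" for i
    by (rule holomorphic_higher_deriv[OF g]) auto
  have d: "((deriv ^^ i) g has_field_derivative (deriv ^^ Suc i) g x) (at x within S)" if "x \<in> S" for i x
    using holomorphic_derivI[OF h open_ball, of x i] that SS by (auto intro: has_field_derivative_at_within)
  have "compact ((deriv ^^ 3) g ` S)"
    by (intro compact_continuous_image continuous_on_subset[OF holomorphic_on_imp_continuous_on[OF h] SS]) (simp add: S_def)
  then obtain B where B: "\<And>x. x \<in> S \<Longrightarrow> norm ((deriv ^^ 3) g x) \<le> B" and "B > 0"
    using compact_imp_bounded bounded_pos by (metis image_eqI)
  let ?a2 = "(deriv ^^ 2) g 0 / 2"
  have T: "norm (g t - (g 0 + deriv g 0 * t + ?a2 * t\<^sup>2)) \<le> B * norm t ^ 3" if "t \<in> S" for t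
  proof -
    have "cmod ((deriv ^^ 0) g t - (\<Sum>i\<le>2. (deriv ^^ i) g 0 * (t-0) ^ i / (fact i))) \<le> B * cmod(t - 0)^(Suc 2) / fact 2"
      by (rule complex_Taylor[where S=S]) (use B d that e in \<open>auto simp: S_def numeral_3_eq_3\<close>)
    then have 1: "cmod (g t - (g 0 + deriv g 0 * t + ?a2 * t\<^sup>2)) \<le> B * norm t ^ 3 / 2"
      by (simp add: numeral_2_eq_2 numeral_3_eq_3 algebra_simps)
    have "B * norm t ^ 3 / 2 \<le> B * norm t ^ 3" using \<open>B > 0\<close> by simp
    with 1 show ?thesis by linarith
  qed
  let ?C = "2 * norm (g 0) * B + 2 * norm (deriv g 0) * (norm ?a2 + B) + (norm ?a2 + B)\<^sup>2"
  have "\<bar>(norm (g t))\<^sup>2 - (norm (g 0))\<^sup>2 - Re (2 * cnj (g 0) * deriv g 0 * t) - Re ((2 * cnj (g 0) * ?a2) * t\<^sup>2)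
       - (norm (deriv g 0))\<^sup>2 * (norm t)\<^sup>2\<bar> \<le> ?C * norm t ^ 3" if "norm t < min 1 (e/2)" for t
  proof -
    define z where "z = g t - (g 0 + deriv g 0 * t + ?a2 * t\<^sup>2)"
    have z: "norm z \<le> B * norm t ^ 3" unfolding z_def by (rule T) (use that in \<open>auto simp: S_def\<close>)
    have gt: "g t = g 0 + (deriv g 0 * t + ?a2 * t\<^sup>2 + z)" by (simp add: z_def)
    show ?thesis
      using square_jet_error[OF _ z, of "g 0" "deriv g 0" ?a2] that \<open>B > 0\<close> unfolding gt[symmetric] by simp
  qed
  moreover have "min 1 (e/2) > 0" using e by simp
  ultimately show ?thesis by blast
qed

text \<open>Summing over t = r, -r, i r, -i r cancels both harmonic terms and leaves 4 \<kappa> r^2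
  <= 4 C r^3. For \<beta>, the argument of t is turned so that \<beta> t = r |\<beta>|; as r tends
  to 0 the linear term outweighs all others.\<close>

lemma jet_max:
  fixes \<beta> \<gamma> :: complex and \<kappa> C d :: real
  assumes d: "0 < d" and m: "\<And>t. norm t < d \<Longrightarrow> Re (\<beta> * t) + Re (\<gamma> * t\<^sup>2) + \<kappa> * (norm t)\<^sup>2 \<le> C * norm t ^ 3"
  shows "\<beta> = 0" "\<kappa> \<le> 0"
proof -
  have k: "\<kappa> \<le> C * r" if "0 < r" "r < d" for r
  proof -
    have "4 * (\<kappa> * r\<^sup>2) \<le> 4 * (C * r ^ 3)"
      using m[of "of_real r"] m[of "- of_real r"] m[of "\<i> * of_real r"] m[of "- (\<i> * of_real r)"] that
      by (simp add: norm_mult power_mult_distrib)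
    then have "\<kappa> * r\<^sup>2 \<le> (C * r) * r\<^sup>2" by (simp add: power3_eq_cube power2_eq_square)
    then show ?thesis using that by (simp add: mult_le_cancel_right)
  qed
  have "((\<lambda>r. C * r) \<longlongrightarrow> C * 0) (at_right 0)" by (intro tendsto_intros)
  moreover have "\<forall>\<^sub>F r in at_right 0. \<kappa> \<le> C * r"
    using eventually_at_right_real[OF d] by eventually_elim (use k in auto)
  ultimately have "\<kappa> \<le> C * 0" by (rule tendsto_lowerbound) simp
  then show "\<kappa> \<le> 0" by simp
  show "\<beta> = 0"
  proof (rule ccontr)
    assume b: "\<beta> \<noteq> 0"
    have k: "norm \<beta> \<le> (norm \<gamma> + \<bar>\<kappa>\<bar>) * r + C * r\<^sup>2" if "0 < r" "r < d" for r
    proof -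
      define t where "t = of_real (r / norm \<beta>) * cnj \<beta>"
      have nt: "norm t = r" using b that by (simp add: t_def norm_mult norm_divide)
      have bt: "Re (\<beta> * t) = r * norm \<beta>"
      proof -
        have "\<beta> * t = of_real (r / norm \<beta>) * of_real ((norm \<beta>)\<^sup>2)"
          unfolding t_def using complex_norm_square[of \<beta>] by (simp add: mult_ac)
        then show ?thesis using b by (simp add: power2_eq_square)
      qed
      have "Re (\<gamma> * t\<^sup>2) \<ge> - (norm \<gamma> * r\<^sup>2)"
        using abs_Re_le_cmod[of "\<gamma> * t\<^sup>2"] by (simp add: norm_mult norm_power nt)
      moreover have "\<kappa> * r\<^sup>2 \<ge> - (\<bar>\<kappa>\<bar> * r\<^sup>2)" using abs_ge_minus_self[of \<kappa>] mult_right_mono[of "-\<kappa>" "\<bar>\<kappa>\<bar>" "r\<^sup>2"] by simp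
      moreover have "norm t < d" using nt that by simp
      from m[OF this, unfolded nt bt] have "r * norm \<beta> + Re (\<gamma> * t\<^sup>2) + \<kappa> * r\<^sup>2 \<le> C * r ^ 3" .
      ultimately have "r * norm \<beta> \<le> norm \<gamma> * r\<^sup>2 + \<bar>\<kappa>\<bar> * r\<^sup>2 + C * r ^ 3" by linarith
      also have "\<dots> = r * ((norm \<gamma> + \<bar>\<kappa>\<bar>) * r + C * r\<^sup>2)" by (simp add: power2_eq_square power3_eq_cube algebra_simps)
      finally show ?thesis using that by simp
    qed
    have "((\<lambda>r. (norm \<gamma> + \<bar>\<kappa>\<bar>) * r + C * r\<^sup>2) \<longlongrightarrow> (norm \<gamma> + \<bar>\<kappa>\<bar>) * 0 + C * 0\<^sup>2) (at_right 0)" by (intro tendsto_intros)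
    moreover have "\<forall>\<^sub>F r in at_right 0. norm \<beta> \<le> (norm \<gamma> + \<bar>\<kappa>\<bar>) * r + C * r\<^sup>2"
      using eventually_at_right_real[OF d] by eventually_elim (use k in auto)
    ultimately have "norm \<beta> \<le> (norm \<gamma> + \<bar>\<kappa>\<bar>) * 0 + C * 0\<^sup>2"
      by (rule tendsto_lowerbound) simp
    with b show False by simp
  qed
qed

text \<open>The jets of the summands are simply added, so weights of either sign are allowed. The
  first conclusion is stationarity, the second says that the Levi form is not positive in the given
  direction.\<close>

lemma local_max_sum_norm_squares:
  fixes g :: "'k \<Rightarrow> complex \<Rightarrow> complex" and w :: "'k \<Rightarrow> real"
  assumes e: "0 < e" and S: "finite S" and hol: "\<And>k. k \<in> S \<Longrightarrow> g k holomorphic_on ball 0 e"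
    and mx: "\<And>t. norm t < e \<Longrightarrow> (\<Sum>k\<in>S. w k * (norm (g k t))\<^sup>2) \<le> (\<Sum>k\<in>S. w k * (norm (g k 0))\<^sup>2)"
  shows "(\<Sum>k\<in>S. of_real (w k) * (cnj (g k 0) * deriv (g k) 0)) = 0"
    and "(\<Sum>k\<in>S. w k * (norm (deriv (g k) 0))\<^sup>2) \<le> 0"
proof -
  have "\<forall>k\<in>S. \<exists>\<gamma> C d. 0 < d \<and> (\<forall>t. norm t < d \<longrightarrow>
     \<bar>(norm (g k t))\<^sup>2 - (norm (g k 0))\<^sup>2 - Re (2 * cnj (g k 0) * deriv (g k) 0 * t) - Re (\<gamma> * t\<^sup>2)
       - (norm (deriv (g k) 0))\<^sup>2 * (norm t)\<^sup>2\<bar> \<le> C * norm t ^ 3)"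
    using holomorphic_square_jet[OF hol e] by blast
  then obtain \<gamma> C d where jet: "\<And>k. k \<in> S \<Longrightarrow> 0 < d k"
     "\<And>k t. k \<in> S \<Longrightarrow> norm t < d k \<Longrightarrow> \<bar>(norm (g k t))\<^sup>2 - (norm (g k 0))\<^sup>2 - Re (2 * cnj (g k 0) * deriv (g k) 0 * t) - Re (\<gamma> k * t\<^sup>2)
       - (norm (deriv (g k) 0))\<^sup>2 * (norm t)\<^sup>2\<bar> \<le> C k * norm t ^ 3"
    by metis
  define D where "D = Min (insert e (d ` S))"
  have D: "0 < D" "D \<le> e" "\<And>k. k \<in> S \<Longrightarrow> D \<le> d k" using S e jet(1) by (auto simp: D_def)
  let ?b = "\<Sum>k\<in>S. of_real (w k) * (2 * cnj (g k 0) * deriv (g k) 0)"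
  let ?c = "\<Sum>k\<in>S. of_real (w k) * \<gamma> k"
  let ?k = "\<Sum>k\<in>S. w k * (norm (deriv (g k) 0))\<^sup>2"
  let ?C = "\<Sum>k\<in>S. \<bar>w k\<bar> * C k"
  have m: "Re (?b * t) + Re (?c * t\<^sup>2) + ?k * (norm t)\<^sup>2 \<le> ?C * norm t ^ 3" if t: "norm t < D" for t
  proof -
    have "w k * Re (2 * cnj (g k 0) * deriv (g k) 0 * t) + w k * Re (\<gamma> k * t\<^sup>2) + w k * ((norm (deriv (g k) 0))\<^sup>2 * (norm t)\<^sup>2)
       \<le> w k * (norm (g k t))\<^sup>2 - w k * (norm (g k 0))\<^sup>2 + \<bar>w k\<bar> * C k * norm t ^ 3" if k: "k \<in> S" for k
    proof -
      have "norm t < d k" using t D(3)[OF k] by linarith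
      define x where "x = (norm (g k t))\<^sup>2 - (norm (g k 0))\<^sup>2 - Re (2 * cnj (g k 0) * deriv (g k) 0 * t) - Re (\<gamma> k * t\<^sup>2)
       - (norm (deriv (g k) 0))\<^sup>2 * (norm t)\<^sup>2"
      have "\<bar>w k * x\<bar> \<le> \<bar>w k\<bar> * (C k * norm t ^ 3)"
        using jet(2)[OF k \<open>norm t < d k\<close>] unfolding x_def[symmetric] abs_mult by (intro mult_left_mono) auto
      then have "- (w k * x) \<le> \<bar>w k\<bar> * (C k * norm t ^ 3)" by linarith
      then show ?thesis unfolding x_def by (simp add: right_diff_distrib mult.assoc)
    qed
    then have "(\<Sum>k\<in>S. w k * Re (2 * cnj (g k 0) * deriv (g k) 0 * t) + w k * Re (\<gamma> k * t\<^sup>2) + w k * ((norm (deriv (g k) 0))\<^sup>2 * (norm t)\<^sup>2))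
       \<le> (\<Sum>k\<in>S. w k * (norm (g k t))\<^sup>2 - w k * (norm (g k 0))\<^sup>2 + \<bar>w k\<bar> * C k * norm t ^ 3)"
      by (rule sum_mono)
    also have "\<dots> \<le> ?C * norm t ^ 3"
      using mx[of t] t D(2) by (simp add: sum.distrib sum_subtractf sum_distrib_right)
    also have "(\<Sum>k\<in>S. w k * Re (2 * cnj (g k 0) * deriv (g k) 0 * t) + w k * Re (\<gamma> k * t\<^sup>2) + w k * ((norm (deriv (g k) 0))\<^sup>2 * (norm t)\<^sup>2))
       = Re (\<Sum>k\<in>S. of_real (w k) * (2 * cnj (g k 0) * deriv (g k) 0 * t)) + Re (\<Sum>k\<in>S. of_real (w k) * (\<gamma> k * t\<^sup>2)) + ?k * (norm t)\<^sup>2"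
      by (simp add: sum.distrib sum_distrib_right mult.assoc)
    finally show ?thesis by (simp add: sum_distrib_right mult.assoc)
  qed
  from jet_max[OF D(1) m] have "?b = 0" and k: "?k \<le> 0" by blast+
  moreover have "?b = 2 * (\<Sum>k\<in>S. of_real (w k) * (cnj (g k 0) * deriv (g k) 0))"
    by (simp add: sum_distrib_left mult_ac)
  ultimately show "(\<Sum>k\<in>S. of_real (w k) * (cnj (g k 0) * deriv (g k) 0)) = 0" by simp
  show "?k \<le> 0" by (rule k)
qed

text \<open>Padded by zero rows, the forms make a square matrix that maps X into a coordinate
  subspace of dimension \<open>card N\<close>, hence not injectively.\<close>

lemma kernel_in_subspace:
  fixes X :: "(complex ^ 'n::finite) set" and L :: "'n \<Rightarrow> 'n \<Rightarrow> complex"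
  assumes X: "vec.subspace X" and N: "card N < vec.dim X"
  obtains \<xi> where "\<xi> \<in> X" "\<xi> \<noteq> 0" "\<And>j. j \<in> N \<Longrightarrow> (\<Sum>i\<in>UNIV. \<xi> $ i * L j i) = 0"
proof -
  define A :: "complex ^ 'n ^ 'n" where "A = (\<chi> j i. if j \<in> N then L j i else 0)"
  have A: "(A *v x) $ j = (if j \<in> N then \<Sum>i\<in>UNIV. x $ i * L j i else 0)" for x j
    by (simp add: A_def matrix_vector_mult_def mult.commute)
  have "\<not> inj_on ((*v) A) X"
  proof
    assume inj: "inj_on ((*v) A) X"
    have "vec.dim ((*v) A ` X) = vec.dim X"
      by (rule vec.dim_image_eq[OF matrix_vector_mul_linear_gen]) (use inj X in \<open>simp add: vec.span_eq_iff[THEN iffD2]\<close>)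
    moreover have "(*v) A ` X \<subseteq> {x. \<forall>i. i \<notin> N \<longrightarrow> x $ i = 0}" by (auto simp: A)
    then have "vec.dim ((*v) A ` X) \<le> vec.dim {x :: complex ^ 'n. \<forall>i. i \<notin> N \<longrightarrow> x $ i = 0}"
      by (rule vec.dim_subset)
    then have "vec.dim ((*v) A ` X) \<le> card N"
      by (simp only: dim_substandard_cart)
    ultimately show False using N by simp
  qed
  then obtain x y where xy: "x \<in> X" "y \<in> X" "x \<noteq> y" "A *v x = A *v y" by (auto simp: inj_on_def)
  show thesis
  proof (rule that[of "x - y"])
    show "x - y \<in> X" using xy X by (simp add: vec.subspace_diff)
    show "x - y \<noteq> 0" using xy by simp
    fix j assume j: "j \<in> N"
    have "A *v (x - y) = 0" using xy by (simp add: vec.diff)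
    then show "(\<Sum>i\<in>UNIV. (x - y) $ i * L j i) = 0" using A[of "x - y" j] j by simp
  qed
qed

lemma norm_vec_square: "(norm (z :: complex ^ 'n::finite))\<^sup>2 = (\<Sum>i\<in>UNIV. (norm (z $ i))\<^sup>2)"
  by (simp add: norm_vec_def L2_set_def sum_nonneg)

lemma norm_vector_scalar_mult: "norm (c *s (z :: complex ^ 'n::finite)) = norm c * norm z"
proof (rule power2_eq_imp_eq)
  show "(norm (c *s z))\<^sup>2 = (norm c * norm z)\<^sup>2"
    by (simp add: norm_vec_square norm_mult power_mult_distrib sum_distrib_left)
qed auto

text \<open>Translating the base point along the line turns derivatives at parameter 0 into
  derivatives at every parameter.\<close>

lemma line_holomorphic:
  assumes d: "\<And>z. z \<in> U \<Longrightarrow> ((\<lambda>\<tau>. h (z + \<tau> *s \<xi>)) has_field_derivative D z) (at 0)"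
    and U: "\<And>t. norm t < e \<Longrightarrow> z + t *s \<xi> \<in> U" and e: "0 < e"
  shows "(\<lambda>t. h (z + t *s \<xi>)) holomorphic_on ball 0 e" "deriv (\<lambda>t. h (z + t *s \<xi>)) 0 = D z"
proof -
  have "((\<lambda>t. h (z + t *s \<xi>)) has_field_derivative D (z + s *s \<xi>)) (at s)" if "norm s < e" for s
  proof -
    have "((\<lambda>\<tau>. h ((z + s *s \<xi>) + \<tau> *s \<xi>)) has_field_derivative D (z + s *s \<xi>)) (at (s - s))"
      using d[OF U[OF that]] by simp
    then have "((\<lambda>t. h ((z + s *s \<xi>) + (t - s) *s \<xi>)) has_field_derivative D (z + s *s \<xi>)) (at s)"
      using DERIV_at_within_shift[of "\<lambda>\<tau>. h ((z + s *s \<xi>) + \<tau> *s \<xi>)" _ "-s" s UNIV] by (simp add: add.commute)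
    moreover have "(z + s *s \<xi>) + (t - s) *s \<xi> = z + t *s \<xi>" for t
      by (simp add: vec_eq_iff algebra_simps)
    ultimately show ?thesis by simp
  qed
  then show "(\<lambda>t. h (z + t *s \<xi>)) holomorphic_on ball 0 e"
    unfolding holomorphic_on_def field_differentiable_def
    by (metis mem_ball_0 has_field_derivative_at_within)
  show "deriv (\<lambda>t. h (z + t *s \<xi>)) 0 = D z"
    using d[OF U[of 0]] e by (auto simp: DERIV_imp_deriv)
qed

lemma closed_vec_subspace:
  assumes "vec.subspace (X :: (complex ^ 'n::finite) set)" shows "closed X"
proof (rule closed_subspace)
  have "r *\<^sub>R x = of_real r *s x" for r and x :: "complex ^ 'n"
    unfolding vec_eq_iff vector_scaleR_component vector_smult_component by (simp add: scaleR_conv_of_real)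
  then show "subspace X"
    using assms by (simp add: vec.subspace_def real_vector.subspace_def)
qed

text \<open>Maximise \<open>|z|\<^sup>2 - K * (\<Sum>j\<in>N. |F j z|\<^sup>2)\<close> on a ball in \<open>X\<close>: for large \<open>K\<close> the maximum is interior,
  and \<open>N\<close> is too small for the differentials to have no common kernel in \<open>X\<close>.\<close>

lemma common_zero_of_dim:
  fixes F :: "'n::finite \<Rightarrow> complex ^ 'n \<Rightarrow> complex"
  assumes ex: "\<And>j. expands r (F j) (c j)" and F0: "\<And>j. F j 0 = 0" and X: "vec.subspace X"
    and N: "card N < vec.dim X" and s: "0 < s"
    and van: "\<And>z j. z \<in> X \<Longrightarrow> (\<And>i. norm (z $ i) \<le> r) \<Longrightarrow> j \<notin> N \<Longrightarrow> F j z = 0"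
  shows "\<exists>z\<in>X. z \<noteq> 0 \<and> norm z < s \<and> (\<forall>j. F j z = 0)"
proof (rule ccontr)
  assume no: "\<not> ?thesis"
  have r: "r > 0" using ex expands_pos by blast
  \<comment> \<open>Points of norm at most R are within the required distance s and strictly inside
    the region where the F j can be differentiated.\<close>
  define R where "R = min (s/2) (r/3)"
  have R: "R > 0" "R < s" "R < r/2" using r s by (auto simp: R_def)
  have comp: "norm (z $ i) < r / 2" if "norm z \<le> R" for z :: "complex ^ 'n" and i
    using norm_nth_le_norm[of z i] that R by linarith
  define Q where "Q z = (\<Sum>j\<in>N. (norm (F j z))\<^sup>2)" for z
  have contF: "continuous_on (cball 0 R) (F j)" for j
    by (rule continuous_on_subset[OF expands_continuous[OF ex]]) (intro subsetI CollectI allI order_trans[OF norm_nth_le_norm], use R r in auto)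
  have contQ: "continuous_on (cball 0 R) Q" unfolding Q_def by (intro continuous_intros contF)
  have cX: "closed X" by (rule closed_vec_subspace[OF X])
  obtain x0 where x0: "x0 \<in> X" "x0 \<noteq> 0" by (rule kernel_in_subspace[OF X N, of "\<lambda>_ _. 0"])
  have X0: "0 \<in> X" using X by (rule vec.subspace_0)
  define S where "S = X \<inter> sphere 0 R"
  have "complex_of_real (R / norm x0) *s x0 \<in> S"
    using x0 X R by (auto simp: S_def vec.subspace_scale norm_vector_scalar_mult norm_divide)
  moreover have "compact S" unfolding S_def using cX by (intro closed_Int_compact) auto
  moreover have "continuous_on S Q" by (rule continuous_on_subset[OF contQ]) (auto simp: S_def)
  ultimately obtain y where y: "y \<in> S" "\<And>z. z \<in> S \<Longrightarrow> Q y \<le> Q z"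
    using continuous_attains_inf[of S Q] by blast
  have Qy: "Q y > 0"
  proof -
    have "y \<noteq> 0" "norm y < s" "y \<in> X" using y R by (auto simp: S_def)
    then obtain j where j: "F j y \<noteq> 0" using no by blast
    have "norm (y $ i) \<le> r" for i using norm_nth_le_norm[of y i] y(1) R r by (simp add: S_def)
    then have "j \<in> N" using van[OF \<open>y \<in> X\<close>, of j] j by blast
    then have "(norm (F j y))\<^sup>2 \<le> Q y" unfolding Q_def by (intro member_le_sum) auto
    moreover have "(norm (F j y))\<^sup>2 > 0" using j by simp
    ultimately show ?thesis by linarith
  qed
  \<comment> \<open>On the sphere Q is at least \<open>Q y\<close>, so there W is at most R^2 - (R^2
    + 1) < 0 = \<open>W 0\<close>, and the maximum is interior.\<close>
  define K where "K = (R\<^sup>2 + 1) / Q y"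
  have K: "K > 0" using Qy by (auto simp: K_def intro!: divide_pos_pos add_nonneg_pos)
  define W where "W z = (norm z)\<^sup>2 - K * Q z" for z
  have "compact (X \<inter> cball 0 R)" using cX by (intro closed_Int_compact) auto
  moreover have "continuous_on (X \<inter> cball 0 R) W" unfolding W_def
    by (intro continuous_intros continuous_on_subset[OF contQ]) auto
  moreover have "X \<inter> cball 0 R \<noteq> {}" using X0 R by force
  ultimately obtain p where p: "p \<in> X" "norm p \<le> R" "\<And>z. z \<in> X \<Longrightarrow> norm z \<le> R \<Longrightarrow> W z \<le> W p"
    using continuous_attains_sup[of "X \<inter> cball 0 R" W] by (metis IntE IntI mem_cball_0)
  have "W 0 = 0" by (simp add: W_def Q_def F0)
  then have "W p \<ge> 0" using p(3)[OF X0] R by simp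
  have pR: "norm p < R"
  proof (rule ccontr)
    assume "\<not> norm p < R"
    then have "p \<in> S" "norm p = R" using p by (auto simp: S_def)
    then have "K * Q y \<le> K * Q p" using y(2) K by simp
    moreover have "K * Q y = R\<^sup>2 + 1" using Qy by (simp add: K_def)
    ultimately have "W p < 0" using \<open>norm p = R\<close> by (simp add: W_def)
    with \<open>W p \<ge> 0\<close> show False by simp
  qed
  obtain \<xi> where xi: "\<xi> \<in> X" "\<xi> \<noteq> 0" "\<And>j. j \<in> N \<Longrightarrow> (\<Sum>i\<in>UNIV. \<xi> $ i * gradient (F j) p $ i) = 0"
    using kernel_in_subspace[OF X N, of "\<lambda>j i. gradient (F j) p $ i"] by blast
  define e where "e = (R - norm p) / norm \<xi>"
  have e: "e > 0" using xi pR by (simp add: e_def)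
  have inR: "norm (p + t *s \<xi>) < R" if "norm t < e" for t
  proof -
    have "norm (p + t *s \<xi>) \<le> norm p + norm t * norm \<xi>"
      using norm_triangle_ineq[of p "t *s \<xi>"] by (simp add: norm_vector_scalar_mult)
    also have "\<dots> < norm p + e * norm \<xi>" using that xi by simp
    also have "\<dots> = R" using xi by (simp add: e_def)
    finally show ?thesis .
  qed
  have inX: "p + t *s \<xi> \<in> X" for t using p xi X by (simp add: vec.subspace_add vec.subspace_scale)
  define g where "g k t = (case k of Inl i \<Rightarrow> (p + t *s \<xi>) $ i | Inr j \<Rightarrow> F j (p + t *s \<xi>))" for k :: "'n + 'n" and t
  define w :: "'n + 'n \<Rightarrow> real" where "w k = (case k of Inl i \<Rightarrow> 1 | Inr j \<Rightarrow> - K)" for k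
  have lhF: "(\<lambda>t. F j (p + t *s \<xi>)) holomorphic_on ball 0 e"
       "deriv (\<lambda>t. F j (p + t *s \<xi>)) 0 = (\<Sum>i\<in>UNIV. \<xi> $ i * gradient (F j) p $ i)" for j
  proof -
    have *: "((\<lambda>\<tau>. F j (z + \<tau> *s \<xi>)) has_field_derivative (\<Sum>i\<in>UNIV. \<xi> $ i * gradient (F j) z $ i)) (at 0)"
      if "z \<in> ball 0 R" for z
      by (rule expands_has_line_derivative[OF ex]) (use that comp in auto)
    show "(\<lambda>t. F j (p + t *s \<xi>)) holomorphic_on ball 0 e"
      by (rule line_holomorphic(1)[where U="ball 0 R", OF *]) (use inR e in auto)
    show "deriv (\<lambda>t. F j (p + t *s \<xi>)) 0 = (\<Sum>i\<in>UNIV. \<xi> $ i * gradient (F j) p $ i)"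
      by (rule line_holomorphic(2)[where U="ball 0 R", OF *]) (use inR e in auto)
  qed
  have dl: "deriv (\<lambda>t. p $ i + t * \<xi> $ i) 0 = \<xi> $ i" for i
    by (rule DERIV_imp_deriv) (auto intro!: derivative_eq_intros)
  have Weq: "(\<Sum>k\<in>UNIV <+> N. w k * (norm (g k t))\<^sup>2) = W (p + t *s \<xi>)" for t
    by (simp add: sum.Plus w_def g_def W_def Q_def norm_vec_square sum_distrib_left sum_negf)
  have "(\<Sum>k\<in>UNIV <+> N. w k * (norm (deriv (g k) 0))\<^sup>2) \<le> 0"
  proof (rule local_max_sum_norm_squares(2)[OF e])
    show "g k holomorphic_on ball 0 e" for k
    proof (cases k)
      case (Inl i)
      then show ?thesis by (auto simp: g_def[abs_def] intro!: holomorphic_intros)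
    next
      case (Inr j)
      then show ?thesis using lhF(1)[of j] by (simp add: g_def[abs_def])
    qed
    show "(\<Sum>k\<in>UNIV <+> N. w k * (norm (g k t))\<^sup>2) \<le> (\<Sum>k\<in>UNIV <+> N. w k * (norm (g k 0))\<^sup>2)" if "norm t < e" for t
      unfolding Weq using p(3)[OF inX, of t] inR[OF that] by simp
  qed simp
  \<comment> \<open>All differentials with index in N vanish on \<xi>, so only the coordinate terms,
    of weight 1, survive.\<close>
  then have "(norm \<xi>)\<^sup>2 \<le> 0"
    by (simp add: sum.Plus w_def g_def[abs_def] lhF(2) dl xi(3) norm_vec_square sum_negf)
  with xi show False by simp
qed

section \<open>Newton iteration and strict differentiability\<close>

text \<open>With A' the inverse of A, the map x - A' g(x) contracts by 1/2 and preserves the ball of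
  radius 2/\<mu> times |g 0|. The solution is thus bounded linearly by the initial error, which
  later bounds the distance from z to its correction by the gradient at z.\<close>

lemma newton_zero:
  fixes g :: "complex ^ 'n::finite \<Rightarrow> complex ^ 'n" and A :: "complex ^ 'n ^ 'n"
  assumes \<mu>: "0 < \<mu>" and A: "\<And>x. \<mu> * norm x \<le> norm (A *v x)"
    and lip: "\<And>x y. norm x \<le> \<rho> \<Longrightarrow> norm y \<le> \<rho> \<Longrightarrow> norm (g x - g y - A *v (x - y)) \<le> \<mu> / 2 * norm (x - y)"
    and g0: "norm (g 0) \<le> \<mu> / 2 * \<rho>"
  obtains x where "norm x \<le> 2 / \<mu> * norm (g 0)" "g x = 0"
proof -
  have "A *v x = 0 \<Longrightarrow> x = 0" for x
    using A[of x] \<mu> by (simp add: mult_le_0_iff)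
  then obtain A' where A'A: "A' ** A = mat 1" using matrix_left_invertible_ker by blast
  then have AA': "A ** A' = mat 1" by (simp add: matrix_left_right_inverse)
  have A': "norm (A' *v x) \<le> norm x / \<mu>" for x
  proof -
    have "\<mu> * norm (A' *v x) \<le> norm (A *v (A' *v x))" by (rule A)
    also have "A *v (A' *v x) = x" by (simp add: matrix_vector_mul_assoc AA')
    finally show ?thesis using \<mu> by (simp add: field_simps)
  qed
  define s where "s = 2 / \<mu> * norm (g 0)"
  have s: "0 \<le> s" "s \<le> \<rho>" using g0 \<mu> by (auto simp: s_def field_simps)
  define T where "T x = x - A' *v g x" for x
  have TT: "norm (T x - T y) \<le> 1/2 * norm (x - y)" if "norm x \<le> s" "norm y \<le> s" for x y
  proof -
    have "T x - T y = A' *v (- (g x - g y - A *v (x - y)))"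
      unfolding T_def vec.neg vec.diff by (simp add: matrix_vector_mul_assoc A'A vec.diff)
    then have "norm (T x - T y) \<le> norm (g x - g y - A *v (x - y)) / \<mu>" using A' by (metis norm_minus_cancel)
    also have "\<dots> \<le> (\<mu> / 2 * norm (x - y)) / \<mu>" using \<mu> s that by (intro divide_right_mono lip) auto
    finally show ?thesis using \<mu> by simp
  qed
  have T0: "norm (T 0) \<le> s / 2"
    using A'[of "g 0"] \<mu> by (simp add: T_def s_def)
  have "\<exists>!x\<in>cball 0 s. T x = x"
  proof (rule Banach_fix)
    show "complete (cball (0::complex ^ 'n) s)" by (simp add: compact_imp_complete)
    show "T ` cball 0 s \<subseteq> cball 0 s"
    proof safe
      fix x :: "complex ^ 'n" assume x: "x \<in> cball 0 s"
      have "norm (T x) \<le> norm (T x - T 0) + norm (T 0)" using norm_triangle_ineq[of "T x - T 0" "T 0"] by simp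
      also have "\<dots> \<le> 1/2 * norm (x - 0) + s / 2" using TT[of x 0] T0 x s by simp
      also have "\<dots> \<le> s" using x by simp
      finally show "T x \<in> cball 0 s" by simp
    qed
    show "dist (T x) (T y) \<le> 1/2 * dist x y" if "x \<in> cball 0 s" "y \<in> cball 0 s" for x y
      using TT[of x y] that by (simp add: dist_norm)
  qed (use s in auto)
  then obtain x where x: "norm x \<le> s" "T x = x" by auto
  then have "A' *v g x = 0" by (simp add: T_def)
  then have "A *v (A' *v g x) = 0" by simp
  then have "g x = 0" by (simp add: matrix_vector_mul_assoc AA')
  with x show thesis using that by (simp add: s_def)
qed

lemma invertible_bounded_below:
  fixes A :: "complex ^ 'n::finite ^ 'n"
  assumes ker: "\<And>x. A *v x = 0 \<Longrightarrow> x = 0"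
  obtains \<mu> where "0 < \<mu>" "\<And>x. \<mu> * norm x \<le> norm (A *v x)"
proof -
  obtain A' where A'A: "A' ** A = mat 1" using ker matrix_left_invertible_ker by blast
  define B where "B = (\<Sum>i\<in>UNIV. \<Sum>j\<in>UNIV. norm (A' $ i $ j))"
  have B: "norm (A' *v y) \<le> B * norm y" for y
  proof -
    have "norm (A' *v y) \<le> (\<Sum>i\<in>UNIV. norm ((A' *v y) $ i))" by (rule norm_le_sum_nth)
    also have "\<dots> \<le> (\<Sum>i\<in>UNIV. \<Sum>j\<in>UNIV. norm (A' $ i $ j) * norm y)"
      unfolding matrix_vector_mult_def
      by (intro sum_mono) (auto intro!: sum_norm_le mult_left_mono norm_nth_le_norm simp: norm_mult)
    finally show ?thesis by (simp add: B_def sum_distrib_right)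
  qed
  have B0: "B \<ge> 0" by (simp add: B_def sum_nonneg)
  show thesis
  proof (rule that[of "1 / (B + 1)"])
    show "0 < 1 / (B + 1)" using B0 by simp
    fix x
    have "norm x = norm (A' *v (A *v x))" by (simp add: matrix_vector_mul_assoc A'A)
    also have "\<dots> \<le> B * norm (A *v x)" by (rule B)
    also have "\<dots> \<le> (B + 1) * norm (A *v x)" by (simp add: algebra_simps)
    finally show "1 / (B + 1) * norm x \<le> norm (A *v x)" using B0 by (simp add: field_simps)
  qed
qed

text \<open>The contraction argument compares two moving points, so differentiability at 0 must be
  strict. After subtracting the linear part at 0, the mean value bound on the segment from y to x
  does it, because the gradient is continuous at 0.\<close>

lemma expands_strict_derivative:
  fixes h :: "complex ^ 'n::finite \<Rightarrow> complex"
  assumes h: "expands r h c" and eta: "0 < \<eta>"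
  obtains \<delta> where "0 < \<delta>" "\<And>x y. norm x \<le> \<delta> \<Longrightarrow> norm y \<le> \<delta> \<Longrightarrow>
     norm (h x - h y - (\<Sum>j\<in>UNIV. (x - y) $ j * gradient h 0 $ j)) \<le> \<eta> * norm (x - y)"
proof -
  have r: "r > 0" using h by (rule expands_pos)
  define \<eta>' where "\<eta>' = \<eta> / CARD('n)"
  have e': "\<eta>' > 0" using eta by (simp add: \<eta>'_def)
  have "\<exists>d>0. \<forall>z. norm z < d \<longrightarrow> norm (gradient h z $ j - gradient h 0 $ j) \<le> \<eta>'" for j
  proof -
    have "continuous_on (ball 0 (r/3)) (\<lambda>z. gradient h z $ j)"
      by (rule continuous_on_subset[OF expands_continuous[OF expands_gradient[OF h]]])
         (intro subsetI CollectI allI order_trans[OF norm_nth_le_norm], auto)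
    then have "isCont (\<lambda>z. gradient h z $ j) 0"
      using r by (simp add: continuous_on_eq_continuous_at)
    then obtain d where "d > 0" "\<And>z. dist z 0 < d \<Longrightarrow> dist (gradient h z $ j) (gradient h 0 $ j) < \<eta>'"
      unfolding continuous_at_eps_delta using e' by meson
    then show ?thesis by (auto simp: dist_norm intro!: exI[of _ d] less_imp_le)
  qed
  then obtain d where d: "\<And>j. d j > 0" "\<And>j z. norm z < d j \<Longrightarrow> norm (gradient h z $ j - gradient h 0 $ j) \<le> \<eta>'"
    by metis
  define \<delta> where "\<delta> = min (r/3) (Min (range d) / 2)"
  have Md: "Min (range d) > 0" using d by (simp add: Min_gr_iff)
  have del: "\<delta> > 0" using r Md by (simp add: \<delta>_def)
  have deld: "\<delta> < d j" for j
  proof -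
    have "Min (range d) \<le> d j" by simp
    moreover have "\<delta> \<le> Min (range d) / 2" unfolding \<delta>_def by (rule min.cobounded2)
    ultimately show ?thesis using Md by linarith
  qed
  show thesis
  proof (rule that[OF del])
    fix x y :: "complex ^ 'n" assume x: "norm x \<le> \<delta>" and y: "norm y \<le> \<delta>"
    define \<xi> where "\<xi> = x - y"
    define L where "L = (\<Sum>j\<in>UNIV. \<xi> $ j * gradient h 0 $ j)"
    define S :: "complex set" where "S = closed_segment 0 1"
    have inb: "norm (y + t *s \<xi>) \<le> \<delta>" if tS: "t \<in> S" for t
    proof -
      obtain u where u: "t = of_real u" "0 \<le> u" "u \<le> 1"
        using tS unfolding S_def in_segment by (auto simp: scaleR_conv_of_real)
      have eq: "y + t *s \<xi> = of_real (1-u) *s y + of_real u *s x"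
      proof -
        have "y $ i + w * (x $ i - y $ i) = (1 - w) * y $ i + w * x $ i" for w i
          by (simp add: algebra_simps)
        then show ?thesis unfolding vec_eq_iff u(1) \<xi>_def by simp
      qed
      have "norm (y + t *s \<xi>) \<le> norm (complex_of_real (1-u) *s y) + norm (complex_of_real u *s x)"
        unfolding eq by (rule norm_triangle_ineq)
      also have "\<dots> = \<bar>1-u\<bar> * norm y + \<bar>u\<bar> * norm x"
        by (simp only: norm_vector_scalar_mult norm_of_real)
      also have "\<dots> = (1-u) * norm y + u * norm x" using u by simp
      also have "\<dots> \<le> (1-u) * \<delta> + u * \<delta>" using u x y by (intro add_mono mult_left_mono) auto
      finally show ?thesis by (simp add: algebra_simps)
    qed
    have der: "((\<lambda>t. h (y + t *s \<xi>) - t * L) has_field_derivative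
        ((\<Sum>j\<in>UNIV. \<xi> $ j * gradient h (y + s *s \<xi>) $ j) - L)) (at s within S)" if s: "s \<in> S" for s
    proof -
      have "norm ((y + s *s \<xi>) $ i) < r / 2" for i
        using norm_nth_le_norm[of "y + s *s \<xi>" i] inb[OF s] r by (simp add: \<delta>_def)
      then have "((\<lambda>\<tau>. h ((y + s *s \<xi>) + \<tau> *s \<xi>)) has_field_derivative (\<Sum>j\<in>UNIV. \<xi> $ j * gradient h (y + s *s \<xi>) $ j)) (at (s - s))"
        using expands_has_line_derivative[OF h] by simp
      then have "((\<lambda>t. h ((y + s *s \<xi>) + (t - s) *s \<xi>)) has_field_derivative (\<Sum>j\<in>UNIV. \<xi> $ j * gradient h (y + s *s \<xi>) $ j)) (at s)"
        using DERIV_at_within_shift[of "\<lambda>\<tau>. h ((y + s *s \<xi>) + \<tau> *s \<xi>)" _ "-s" s UNIV] by (simp add: add.commute)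
      moreover have "(y + s *s \<xi>) + (t - s) *s \<xi> = y + t *s \<xi>" for t
        by (simp add: vec_eq_iff algebra_simps)
      ultimately have "((\<lambda>t. h (y + t *s \<xi>)) has_field_derivative (\<Sum>j\<in>UNIV. \<xi> $ j * gradient h (y + s *s \<xi>) $ j)) (at s)"
        by simp
      then show ?thesis by (auto intro!: derivative_eq_intros intro: has_field_derivative_at_within)
    qed
    have bd: "norm ((\<Sum>j\<in>UNIV. \<xi> $ j * gradient h (y + s *s \<xi>) $ j) - L) \<le> \<eta> * norm \<xi>" if s: "s \<in> S" for s
    proof -
      have "(\<Sum>j\<in>UNIV. \<xi> $ j * gradient h (y + s *s \<xi>) $ j) - L
          = (\<Sum>j\<in>UNIV. \<xi> $ j * (gradient h (y + s *s \<xi>) $ j - gradient h 0 $ j))"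
        by (simp add: L_def sum_subtractf right_diff_distrib)
      also have "norm \<dots> \<le> (\<Sum>j\<in>(UNIV::'n set). norm \<xi> * \<eta>')"
      proof (intro sum_norm_le)
        fix j
        have "norm (gradient h (y + s *s \<xi>) $ j - gradient h 0 $ j) \<le> \<eta>'"
          by (rule d(2)) (use inb[OF s] deld[of j] in linarith)
        then show "norm (\<xi> $ j * (gradient h (y + s *s \<xi>) $ j - gradient h 0 $ j)) \<le> norm \<xi> * \<eta>'"
          unfolding norm_mult by (intro mult_mono norm_nth_le_norm) auto
      qed
      finally show ?thesis by (simp add: \<eta>'_def mult.commute)
    qed
    have "norm ((h (y + 1 *s \<xi>) - 1 * L) - (h (y + 0 *s \<xi>) - 0 * L)) \<le> (\<eta> * norm \<xi>) * norm (1 - 0 :: complex)"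
      by (rule field_differentiable_bound[where S=S, OF _ der bd]) (auto simp: S_def)
    then show "norm (h x - h y - (\<Sum>j\<in>UNIV. (x - y) $ j * gradient h 0 $ j)) \<le> \<eta> * norm (x - y)"
      by (simp add: \<xi>_def L_def algebra_simps)
  qed
qed

section \<open>Continuation of critical points\<close>

lemma sqrt_le_tangent:
  assumes "0 < S" "0 \<le> y" shows "sqrt y \<le> S + (y - S\<^sup>2) / (2 * S)"
proof -
  have "0 \<le> (sqrt y - S)\<^sup>2" by simp
  also have "\<dots> = y - 2 * S * sqrt y + S\<^sup>2" using assms by (simp add: power2_diff)
  finally show ?thesis using assms by (simp add: field_simps power2_eq_square)
qed

lemma ln_le_tangent:
  assumes "0 < P" "0 < x" shows "ln x \<le> ln P + (x - P) / (P::real)"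
  using ln_diff_le[of x P] assms by simp

text \<open>The coordinate \<open>k\<close> of \<open>w\<close> stores the deformation parameter \<open>s\<close>; \<open>\<phi>\<close>, \<open>G\<close> and \<open>p\<close> do not depend on it, except
  that they are evaluated at such \<open>w\<close>. The start is \<open>s = 1\<close> with \<open>G = a\<close>, the goal is a zero of \<open>G\<close>.\<close>

locale continuation =
  fixes \<phi> :: "complex ^ 'n::finite \<Rightarrow> complex" and G :: "'n \<Rightarrow> complex ^ 'n \<Rightarrow> complex"
    and H :: "'n \<Rightarrow> 'n \<Rightarrow> complex ^ 'n \<Rightarrow> complex" and k :: 'n and p :: "complex ^ 'n \<Rightarrow> complex"
    and R C \<eta> M B A :: real and w1 :: "complex ^ 'n" and a :: "'n \<Rightarrow> complex"
  assumes R: "0 < R"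
    and d\<phi>: "\<And>w \<xi>. (\<And>i. i \<noteq> k \<Longrightarrow> norm (w $ i) < R) \<Longrightarrow>
        ((\<lambda>\<tau>. \<phi> (w + \<tau> *s \<xi>)) has_field_derivative (\<Sum>i\<in>-{k}. \<xi> $ i * G i w)) (at 0)"
    and dG: "\<And>j w \<xi>. j \<noteq> k \<Longrightarrow> (\<And>i. i \<noteq> k \<Longrightarrow> norm (w $ i) < R) \<Longrightarrow>
        ((\<lambda>\<tau>. G j (w + \<tau> *s \<xi>)) has_field_derivative (\<Sum>i\<in>-{k}. \<xi> $ i * H j i w)) (at 0)"
    and cont\<phi>: "continuous_on {w. \<forall>i. i \<noteq> k \<longrightarrow> norm (w $ i) \<le> R} \<phi>"
    and contG: "\<And>j. j \<noteq> k \<Longrightarrow> continuous_on {w. \<forall>i. i \<noteq> k \<longrightarrow> norm (w $ i) \<le> R} (G j)"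
    and p_def: "\<And>w. p w = \<phi> w - (\<Sum>i\<in>-{k}. w $ i * G i w)"
    and w1: "w1 $ k = 1" "\<And>i. i \<noteq> k \<Longrightarrow> norm (w1 $ i) < R"
    and a: "\<And>j. j \<noteq> k \<Longrightarrow> a j = G j w1"
    and B: "norm (p w1) \<le> B" and C: "0 \<le> C" and \<eta>: "0 < \<eta>"
    and est: "\<And>w. (\<And>i. i \<noteq> k \<Longrightarrow> norm (w $ i) \<le> R) \<Longrightarrow> norm (w $ k) \<le> 2 \<Longrightarrow>
        (\<And>j. j \<noteq> k \<Longrightarrow> norm (G j w - w $ k * a j) \<le> \<eta>) \<Longrightarrow> norm (\<Sum>i\<in>-{k}. w $ i * a i) \<le> C * (1 + norm (p w))"
    and bdry: "\<And>w i. (\<And>i. i \<noteq> k \<Longrightarrow> norm (w $ i) \<le> R) \<Longrightarrow> norm (w $ k) \<le> 2 \<Longrightarrow>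
        (\<And>j. j \<noteq> k \<Longrightarrow> norm (G j w - w $ k * a j) \<le> \<eta>) \<Longrightarrow> i \<noteq> k \<Longrightarrow> norm (w $ i) = R \<Longrightarrow> M \<le> norm (p w)"
    and A: "A = 4 * (2 * C + 1) + 2 * (ln (1 + B\<^sup>2) + 1)"
    and M: "0 \<le> M" "2 * A + ln (1 + B\<^sup>2) + 1 < ln (1 + M\<^sup>2)"
begin

definition "K' = {w :: complex ^ 'n. norm (w $ k) \<le> 2 \<and> (\<forall>i. i \<noteq> k \<longrightarrow> norm (w $ i) \<le> R)}"
definition "U = {w :: complex ^ 'n. norm (w $ k) < 2 \<and> (\<forall>i. i \<noteq> k \<longrightarrow> norm (w $ i) < R)}"

lemma A_pos: "A > 0"
  using C by (auto simp: A intro!: add_pos_nonneg)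

lemma K'_comp: "w \<in> K' \<Longrightarrow> norm (w $ i) \<le> R + 2"
  using R by (cases "i = k") (force simp: K'_def)+

lemma compact_K': "compact K'"
proof -
  have "bounded K'"
    unfolding bounded_iff using norm_le_card_nth[OF K'_comp] by blast
  moreover have "closed K'"
  proof -
    have "K' = {w. norm (w $ k) \<le> 2} \<inter> (\<Inter>i\<in>-{k}. {w. norm (w $ i) \<le> R})" by (auto simp: K'_def)
    moreover have "closed \<dots>"
      by (intro closed_Int closed_INT ballI closed_Collect_le continuous_intros)
    ultimately show ?thesis by simp
  qed
  ultimately show ?thesis by (simp add: compact_eq_bounded_closed)
qed

lemma open_U: "open U"
proof -
  have "U = {w. norm (w $ k) < 2} \<inter> (\<Inter>i\<in>-{k}. {w. norm (w $ i) < R})" by (auto simp: U_def)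
  moreover have "open \<dots>"
    by (intro open_Int open_INT ballI open_Collect_less continuous_intros) auto
  ultimately show ?thesis by simp
qed

lemma U_K': "U \<subseteq> K'" by (force simp: U_def K'_def less_imp_le)

lemma contK': "continuous_on K' \<phi>" "j \<noteq> k \<Longrightarrow> continuous_on K' (G j)" "continuous_on K' p"
proof -
  have *: "K' \<subseteq> {w. \<forall>i. i \<noteq> k \<longrightarrow> norm (w $ i) \<le> R}" by (auto simp: K'_def)
  show 1: "continuous_on K' \<phi>" by (rule continuous_on_subset[OF cont\<phi> *])
  show 2: "continuous_on K' (G j)" if "j \<noteq> k" for j by (rule continuous_on_subset[OF contG[OF that] *])
  show "continuous_on K' p" unfolding p_def[abs_def] by (intro continuous_intros 1 2) auto
qed

text \<open>The maximum of \<open>W\<close> lies at \<open>|s| < \<delta>\<close>: along a kernel direction of the constraints \<open>G = s a\<close> the logarithm of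
  \<open>p\<close> varies more slowly than \<open>A |s|\<close>, and \<open>\<epsilon> |w|\<^sup>2\<close> excludes points where \<open>s\<close> is stationary.\<close>

lemma approx:
  assumes \<delta>: "0 < \<delta>" "\<delta> \<le> 1"
  obtains w where "w \<in> K'" "norm (w $ k) < \<delta>" "\<And>j. j \<noteq> k \<Longrightarrow> norm (G j w - w $ k * a j) \<le> \<delta>"
proof -
  define lB where "lB = ln (1 + B\<^sup>2)"
  have lB: "lB \<ge> 0" by (simp add: lB_def)
  define Z where "Z = CARD('n) * (R + 2)"
  have Z: "Z \<ge> 0" using R by (simp add: Z_def)
  \<comment> \<open>The second-order condition in a direction with \<xi>_k = 1 will give \<epsilon>
    |\<xi>|^2 <= E. This bound does not involve \<epsilon>, so \<epsilon> can be chosen from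
    it.\<close>
  define E where "E = A / (2 * \<delta>) + 2 * C\<^sup>2"
  have E: "E \<ge> 0" using A_pos \<delta> by (simp add: E_def)
  \<comment> \<open>Small enough for \<epsilon> |w|^2 <= 1 on \<open>K'\<close> and, combined with
    \<epsilon> |\<xi>|^2 <= E, for \<epsilon> Z |\<xi>| <= 1: the auxiliary term then disturbs the
    first-order condition by at most 1.\<close>
  define \<epsilon> where "\<epsilon> = 1 / ((Z\<^sup>2 + 1) * (E + 1))"
  have ep: "\<epsilon> > 0" using E by (auto simp: \<epsilon>_def intro!: divide_pos_pos mult_pos_pos add_nonneg_pos)
  have epZE: "\<epsilon> * (Z\<^sup>2 * E) \<le> 1" "\<epsilon> * Z\<^sup>2 \<le> 1"
  proof -
    have pos: "0 < (Z\<^sup>2 + 1) * (E + 1)" using E by (auto intro!: mult_pos_pos add_nonneg_pos)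
    have "Z\<^sup>2 * E \<le> (Z\<^sup>2 + 1) * (E + 1)" using E by (intro mult_mono) auto
    then show "\<epsilon> * (Z\<^sup>2 * E) \<le> 1" using pos by (simp add: \<epsilon>_def divide_le_eq)
    have "Z\<^sup>2 * 1 \<le> (Z\<^sup>2 + 1) * (E + 1)" using E by (intro mult_mono) auto
    then show "\<epsilon> * Z\<^sup>2 \<le> 1" using pos by (simp add: \<epsilon>_def divide_le_eq)
  qed
  have normZ: "norm w \<le> Z" if "w \<in> K'" for w
    unfolding Z_def by (rule norm_le_card_nth) (rule K'_comp[OF that])
  have eZ: "\<epsilon> * (norm w)\<^sup>2 \<le> 1" if "w \<in> K'" for w
  proof -
    have "\<epsilon> * (norm w)\<^sup>2 \<le> \<epsilon> * Z\<^sup>2" using normZ[OF that] ep by (intro mult_left_mono power_mono) auto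
    with epZE show ?thesis by linarith
  qed
  \<comment> \<open>An upper bound for \<open>K * V\<close> at a maximiser: at the start W is at
    least -3A/2 - lB, and among the other terms of W only \<epsilon> |w|^2 is positive, being at
    most 1. The penalty K below turns this into the constraints up to \<eta>'.\<close>
  define Q where "Q = 2 * A + lB + 1"
  have Q: "Q > 0" using A_pos lB by (simp add: Q_def)
  define \<eta>' where "\<eta>' = min \<eta> \<delta>"
  have et': "\<eta>' > 0" "\<eta>' \<le> \<eta>" "\<eta>' \<le> \<delta>" using \<eta> \<delta> by (auto simp: \<eta>'_def)
  define K where "K = (Q + 1) / \<eta>'\<^sup>2"
  have K: "K > 0" using Q et' by (simp add: K_def)
  define V where "V w = (\<Sum>j\<in>-{k}. (norm (G j w - w $ k * a j))\<^sup>2)" for w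
  define W where "W w = - (A * sqrt (\<delta>\<^sup>2 + (norm (w $ k))\<^sup>2)) - ln (1 + (norm (p w))\<^sup>2) + \<epsilon> * (norm w)\<^sup>2 - K * V w" for w
  have "continuous_on K' W" unfolding W_def V_def
    by (intro continuous_intros contK') (auto simp: add_pos_nonneg add_nonneg_eq_0_iff)
  moreover have w1K: "w1 \<in> K'" using w1 by (auto simp: K'_def less_imp_le)
  ultimately obtain w where w: "w \<in> K'" "\<And>v. v \<in> K' \<Longrightarrow> W v \<le> W w"
    using continuous_attains_sup[OF compact_K', of W] by blast
  \<comment> \<open>At s = 1 the root is at most 3/2, whereas at |s| = 2 it is at least 2. The
    resulting gap A/2 excludes the boundary |s| = 2.\<close>
  have sq: "sqrt (\<delta>\<^sup>2 + 1) \<le> 3/2"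
  proof (rule real_le_lsqrt)
    show "\<delta>\<^sup>2 + 1 \<le> (3/2)\<^sup>2" using power_le_one[of \<delta> 2] \<delta> by (simp add: power2_eq_square)
  qed auto
  have Ww1: "W w1 \<ge> - (A * (3/2)) - lB"
  proof -
    have "V w1 = 0" unfolding V_def by (intro sum.neutral) (auto simp: w1 a)
    moreover have "A * sqrt (\<delta>\<^sup>2 + (norm (w1 $ k))\<^sup>2) \<le> A * (3/2)"
      using sq A_pos by (simp add: w1)
    moreover have "ln (1 + (norm (p w1))\<^sup>2) \<le> lB"
      unfolding lB_def using B by (subst ln_le_cancel_iff) (auto intro!: add_pos_nonneg power_mono)
    moreover have "\<epsilon> * (norm w1)\<^sup>2 \<ge> 0" using ep by simp
    ultimately show ?thesis by (simp add: W_def)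
  qed
  have Ww: "W w \<ge> - (A * (3/2)) - lB" using w(2)[OF w1K] Ww1 by linarith
  have Vn: "V v \<ge> 0" for v by (simp add: V_def sum_nonneg)
  have ln0: "ln (1 + (norm (p v))\<^sup>2) \<ge> 0" for v by simp
  have Vw: "V w < \<eta>'\<^sup>2"
  proof -
    have "A * sqrt (\<delta>\<^sup>2 + (norm (w $ k))\<^sup>2) \<ge> 0" using A_pos by simp
    then have "K * V w \<le> Q" using Ww eZ[OF w(1)] ln0[of w] A_pos unfolding W_def Q_def by linarith
    also have "Q < Q + 1" by simp
    also have "\<dots> = K * \<eta>'\<^sup>2" using et' by (simp add: K_def)
    finally show ?thesis using K by simp
  qed
  have cons: "norm (G j w - w $ k * a j) \<le> \<eta>'" if "j \<noteq> k" for j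
  proof -
    have "(norm (G j w - w $ k * a j))\<^sup>2 \<le> V w"
      unfolding V_def by (rule member_le_sum) (use that in auto)
    with Vw have "(norm (G j w - w $ k * a j))\<^sup>2 \<le> \<eta>'\<^sup>2" by linarith
    then show ?thesis by (rule power2_le_imp_le) (use et' in simp)
  qed
  have cons\<eta>: "norm (G j w - w $ k * a j) \<le> \<eta>" if "j \<noteq> k" for j
    using cons[OF that] et' by linarith
  have wR: "norm (w $ i) \<le> R" if "i \<noteq> k" for i using w(1) that by (auto simp: K'_def)
  have wk2: "norm (w $ k) \<le> 2" using w(1) by (auto simp: K'_def)
  \<comment> \<open>The maximiser is interior. At |s| = 2 the gap A/2 exceeds lB + 1 by the choice
    of A; where some |w_i| = R, the barrier |p| >= M pushes W below its value at the start.\<close>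
  have "w \<in> U"
  proof -
    have "norm (w $ k) \<noteq> 2"
    proof
      assume 2: "norm (w $ k) = 2"
      have "sqrt (\<delta>\<^sup>2 + 4) \<ge> 2" by (rule real_le_rsqrt) auto
      then have "A * sqrt (\<delta>\<^sup>2 + (norm (w $ k))\<^sup>2) \<ge> A * 2" using A_pos by (simp add: 2)
      moreover have "K * V w \<ge> 0" using K Vn by simp
      ultimately have "A * 2 \<le> A * (3/2) + lB + 1" using Ww eZ[OF w(1)] ln0[of w] unfolding W_def by linarith
      then have "A \<le> 2 * (lB + 1)" by (simp add: field_simps)
      moreover have "A = (8 * C + 4) + 2 * (lB + 1)" unfolding A lB_def by (simp add: algebra_simps)
      ultimately have "8 * C + 4 \<le> 0" by linarith
      then show False using C by linarith
    qed
    moreover have "norm (w $ i) \<noteq> R" if i: "i \<noteq> k" for i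
    proof
      assume "norm (w $ i) = R"
      then have "M \<le> norm (p w)" using bdry[of w i] wR wk2 cons\<eta> i by blast
      then have "ln (1 + M\<^sup>2) \<le> ln (1 + (norm (p w))\<^sup>2)"
        using M by (subst ln_le_cancel_iff) (auto intro!: add_pos_nonneg power_mono)
      moreover have "A * sqrt (\<delta>\<^sup>2 + (norm (w $ k))\<^sup>2) \<ge> 0" using A_pos by simp
      moreover have "K * V w \<ge> 0" using K Vn by simp
      ultimately have "ln (1 + M\<^sup>2) \<le> A * (3/2) + lB + 1" using Ww eZ[OF w(1)] unfolding W_def by linarith
      then show False using M(2) A_pos unfolding lB_def by linarith
    qed
    ultimately show ?thesis using wR wk2 by (force simp: U_def order_less_le)
  qed
  define S where "S = sqrt (\<delta>\<^sup>2 + (norm (w $ k))\<^sup>2)"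
  have S2: "S\<^sup>2 = \<delta>\<^sup>2 + (norm (w $ k))\<^sup>2" by (simp add: S_def)
  have S: "S \<ge> \<delta>" unfolding S_def by (rule real_le_rsqrt) simp
  then have S0: "S > 0" using \<delta> by linarith
  define P where "P = 1 + (norm (p w))\<^sup>2"
  have P: "P > 0" "P \<ge> 1" by (auto simp: P_def intro: add_pos_nonneg)
  \<comment> \<open>Concavity of \<open>sqrt\<close> and \<open>ln\<close> gives a minorant of \<open>W\<close>, exact at \<open>w\<close>, of the form the second-order test needs.\<close>
  define Wt where "Wt v = - (A / (2 * S)) * (norm (v $ k))\<^sup>2 - (norm (p v))\<^sup>2 / P + \<epsilon> * (norm v)\<^sup>2 - K * V v" for v
  have Wt: "Wt v \<le> Wt w" if v: "v \<in> U" for v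
  proof -
    have "sqrt (\<delta>\<^sup>2 + (norm (v $ k))\<^sup>2) \<le> S + ((norm (v $ k))\<^sup>2 - (norm (w $ k))\<^sup>2) / (2 * S)"
      using sqrt_le_tangent[OF S0, of "\<delta>\<^sup>2 + (norm (v $ k))\<^sup>2"] by (simp add: S2)
    then have "A * sqrt (\<delta>\<^sup>2 + (norm (v $ k))\<^sup>2) \<le> A * (S + ((norm (v $ k))\<^sup>2 - (norm (w $ k))\<^sup>2) / (2 * S))"
      using A_pos by (intro mult_left_mono) auto
    also have "\<dots> = A * S + (A / (2 * S)) * (norm (v $ k))\<^sup>2 - (A / (2 * S)) * (norm (w $ k))\<^sup>2"
      by (simp add: algebra_simps diff_divide_distrib)
    finally have 1: "A * sqrt (\<delta>\<^sup>2 + (norm (v $ k))\<^sup>2) \<le> A * S + (A / (2 * S)) * (norm (v $ k))\<^sup>2 - (A / (2 * S)) * (norm (w $ k))\<^sup>2" .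
    have 2: "ln (1 + (norm (p v))\<^sup>2) \<le> ln P + (norm (p v))\<^sup>2 / P - (norm (p w))\<^sup>2 / P"
      using ln_le_tangent[OF P(1), of "1 + (norm (p v))\<^sup>2"]
      by (simp add: P_def add_pos_nonneg diff_divide_distrib)
    have "W v \<le> W w" using w(2) v U_K' by blast
    then show ?thesis using 1 2 unfolding W_def Wt_def S_def[symmetric] P_def[symmetric] by linarith
  qed
  \<comment> \<open>First-order and second-order conditions in a direction in which the constraints
    G - s a are stationary. There the Legendre transform has differential - \<xi>_k times the sum of
    w_i a_i.\<close>
  have opt: "of_real (- (A / (2 * S))) * (cnj (w $ k) * \<xi> $ k) + of_real (- (1 / P)) * (cnj (p w) * - (\<xi> $ k * (\<Sum>i\<in>-{k}. w $ i * a i)))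
        + of_real \<epsilon> * (\<Sum>i\<in>UNIV. cnj (w $ i) * \<xi> $ i) = 0"
      "- (A / (2 * S)) * (norm (\<xi> $ k))\<^sup>2 - (norm (\<xi> $ k * (\<Sum>i\<in>-{k}. w $ i * a i)))\<^sup>2 / P + \<epsilon> * (norm \<xi>)\<^sup>2 \<le> 0"
    if ker: "\<And>j. j \<noteq> k \<Longrightarrow> (\<Sum>i\<in>-{k}. \<xi> $ i * H j i w) = \<xi> $ k * a j" for \<xi>
  proof -
    obtain d where d: "d > 0" "ball w d \<subseteq> U" using open_U \<open>w \<in> U\<close> open_contains_ball by blast
    define e where "e = d / (norm \<xi> + 1)"
    have e: "e > 0" using d by (auto simp: e_def intro!: divide_pos_pos add_nonneg_pos)
    have inU: "w + t *s \<xi> \<in> U" if "norm t < e" for t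
    proof -
      have "norm t * norm \<xi> \<le> norm t * (norm \<xi> + 1)" by (intro mult_left_mono) auto
      also have "\<dots> < e * (norm \<xi> + 1)" using that by (intro mult_strict_right_mono) (auto intro!: add_nonneg_pos)
      also have "\<dots> = d" unfolding e_def by (simp add: add_nonneg_eq_0_iff)
      finally have "w + t *s \<xi> \<in> ball w d" by (simp add: dist_norm norm_vector_scalar_mult)
      with d show ?thesis by blast
    qed
    have URl: "norm (v $ i) < R" if "v \<in> U" "i \<noteq> k" for v i using that by (auto simp: U_def)
    have dp: "((\<lambda>\<tau>. p (v + \<tau> *s \<xi>)) has_field_derivative - (\<Sum>j\<in>-{k}. v $ j * (\<Sum>i\<in>-{k}. \<xi> $ i * H j i v))) (at 0)"
      if "v \<in> U" for v
    proof -
      have "((\<lambda>\<tau>. \<phi> (v + \<tau> *s \<xi>) - (\<Sum>i\<in>-{k}. (v $ i + \<tau> * \<xi> $ i) * G i (v + \<tau> *s \<xi>))) has_field_derivative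
        (\<Sum>i\<in>-{k}. \<xi> $ i * G i v) - (\<Sum>j\<in>-{k}. \<xi> $ j * G j v + v $ j * (\<Sum>i\<in>-{k}. \<xi> $ i * H j i v))) (at 0)"
      proof (intro DERIV_diff DERIV_sum d\<phi> URl that)
        fix j assume j: "j \<in> - {k}"
        have "((\<lambda>\<tau>. G j (v + \<tau> *s \<xi>)) has_field_derivative (\<Sum>i\<in>-{k}. \<xi> $ i * H j i v)) (at 0)"
          using j by (intro dG URl that) auto
        then show "((\<lambda>\<tau>. (v $ j + \<tau> * \<xi> $ j) * G j (v + \<tau> *s \<xi>)) has_field_derivative
            \<xi> $ j * G j v + v $ j * (\<Sum>i\<in>-{k}. \<xi> $ i * H j i v)) (at 0)"
          by (auto intro!: derivative_eq_intros)
      qed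
      then show ?thesis by (simp add: p_def sum.distrib)
    qed
    \<comment> \<open>The summands of Wt as holomorphic functions on the line: the parameter, p, the
      coordinates with weight \<epsilon>, and the constraints with weight -K.\<close>
    define g where "g x t = (case x of Inl b \<Rightarrow> (if b then (w + t *s \<xi>) $ k else p (w + t *s \<xi>)) |
        Inr y \<Rightarrow> (case y of Inl i \<Rightarrow> (w + t *s \<xi>) $ i | Inr j \<Rightarrow> G j (w + t *s \<xi>) - (w + t *s \<xi>) $ k * a j))"
      for x :: "bool + 'n + 'n" and t
    define c where "c x = (case x of Inl b \<Rightarrow> (if b then - (A / (2 * S)) else - (1 / P)) |
        Inr y \<Rightarrow> (case y of Inl i \<Rightarrow> \<epsilon> | Inr j \<Rightarrow> - K))" for x :: "bool + 'n + 'n"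
    define I :: "(bool + 'n + 'n) set" where "I = UNIV <+> (UNIV <+> -{k})"
    have hp: "(\<lambda>t. p (w + t *s \<xi>)) holomorphic_on ball 0 e"
        "deriv (\<lambda>t. p (w + t *s \<xi>)) 0 = - (\<Sum>j\<in>-{k}. w $ j * (\<Sum>i\<in>-{k}. \<xi> $ i * H j i w))"
      using line_holomorphic[where U=U, OF dp inU e] by auto
    have hG: "(\<lambda>t. G j (w + t *s \<xi>)) holomorphic_on ball 0 e"
        "((\<lambda>t. G j (w + t *s \<xi>)) has_field_derivative (\<Sum>i\<in>-{k}. \<xi> $ i * H j i w)) (at 0)" if "j \<noteq> k" for j
    proof -
      have *: "((\<lambda>\<tau>. G j (v + \<tau> *s \<xi>)) has_field_derivative (\<Sum>i\<in>-{k}. \<xi> $ i * H j i v)) (at 0)" if "v \<in> U" for v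
        by (intro dG URl that \<open>j \<noteq> k\<close>)
      show "(\<lambda>t. G j (w + t *s \<xi>)) holomorphic_on ball 0 e"
        using line_holomorphic[where U=U, OF * inU e] by auto
      show "((\<lambda>t. G j (w + t *s \<xi>)) has_field_derivative (\<Sum>i\<in>-{k}. \<xi> $ i * H j i w)) (at 0)"
        by (rule *[OF \<open>w \<in> U\<close>])
    qed
    have dw: "deriv (\<lambda>t. w $ i + t * \<xi> $ i) 0 = \<xi> $ i" for i
      by (rule DERIV_imp_deriv) (auto intro!: derivative_eq_intros)
    have dc: "deriv (\<lambda>t. G j (w + t *s \<xi>) - (w $ k + t * \<xi> $ k) * a j) 0 = 0" if "j \<noteq> k" for j
    proof (rule DERIV_imp_deriv)
      show "((\<lambda>t. G j (w + t *s \<xi>) - (w $ k + t * \<xi> $ k) * a j) has_field_derivative 0) (at 0)"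
        using ker[OF that] by (auto intro!: derivative_eq_intros hG(2)[OF that])
    qed
    have pk: "(\<Sum>j\<in>-{k}. w $ j * (\<Sum>i\<in>-{k}. \<xi> $ i * H j i w)) = \<xi> $ k * (\<Sum>i\<in>-{k}. w $ i * a i)"
      using ker by (simp add: sum_distrib_left mult_ac)
    define qq where "qq = (\<Sum>i\<in>-{k}. w $ i * a i)"
    have hp2: "deriv (\<lambda>t. p (w + t *s \<xi>)) 0 = - (\<xi> $ k * qq)" using hp(2) pk by (simp add: qq_def)
    have hol: "g x holomorphic_on ball 0 e" if xI: "x \<in> I" for x
    proof -
      consider "x = Inl True" | "x = Inl False" | i where "x = Inr (Inl i)" | j where "x = Inr (Inr j)" "j \<noteq> k"
        using xI unfolding I_def by (cases x) (auto elim!: PlusE)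
      then show ?thesis
      proof cases
        case 4 then show ?thesis using hG(1)[OF 4(2)] by (auto simp: g_def[abs_def] intro!: holomorphic_intros)
      qed (auto simp: g_def[abs_def] hp intro!: holomorphic_intros)
    qed
    have Weq: "(\<Sum>x\<in>I. c x * (norm (g x t))\<^sup>2) = Wt (w + t *s \<xi>)" for t
      by (simp add: I_def sum.Plus UNIV_bool c_def g_def Wt_def V_def norm_vec_square sum_distrib_left sum_negf)
    have mx: "(\<Sum>x\<in>I. c x * (norm (g x t))\<^sup>2) \<le> (\<Sum>x\<in>I. c x * (norm (g x 0))\<^sup>2)" if "norm t < e" for t
      unfolding Weq using Wt[OF inU[OF that]] by simp
    have fI: "finite I" by (simp add: I_def)
    have s1: "(\<Sum>x\<in>I. of_real (c x) * (cnj (g x 0) * deriv (g x) 0)) = 0"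
      and s2: "(\<Sum>x\<in>I. c x * (norm (deriv (g x) 0))\<^sup>2) \<le> 0"
      using local_max_sum_norm_squares[of e I g c, OF e fI hol mx] by auto
    show "of_real (- (A / (2 * S))) * (cnj (w $ k) * \<xi> $ k) + of_real (- (1 / P)) * (cnj (p w) * - (\<xi> $ k * (\<Sum>i\<in>-{k}. w $ i * a i)))
        + of_real \<epsilon> * (\<Sum>i\<in>UNIV. cnj (w $ i) * \<xi> $ i) = 0"
      using s1 unfolding qq_def[symmetric]
      by (simp add: I_def sum.Plus UNIV_bool c_def g_def[abs_def] hp2 dw dc sum_distrib_left add_ac)
    show "- (A / (2 * S)) * (norm (\<xi> $ k))\<^sup>2 - (norm (\<xi> $ k * (\<Sum>i\<in>-{k}. w $ i * a i)))\<^sup>2 / P + \<epsilon> * (norm \<xi>)\<^sup>2 \<le> 0"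
      using s2 unfolding qq_def[symmetric]
      by (simp add: I_def sum.Plus UNIV_bool c_def g_def[abs_def] hp2 dw dc norm_vec_square sum_distrib_left)
  qed
  have card: "card (- {k}) < vec.dim (UNIV :: (complex ^ 'n) set)"
    unfolding vec_dim_card by (rule psubset_card_mono) auto
  obtain \<xi>0 where x0: "\<xi>0 \<noteq> 0" "\<And>j. j \<in> -{k} \<Longrightarrow> (\<Sum>i\<in>UNIV. \<xi>0 $ i * (if i = k then - a j else H j i w)) = 0"
    using kernel_in_subspace[OF vec.subspace_UNIV card, of "\<lambda>j i. if i = k then - a j else H j i w"] by blast
  have ker0: "(\<Sum>i\<in>-{k}. \<xi>0 $ i * H j i w) = \<xi>0 $ k * a j" if "j \<noteq> k" for j
  proof -
    have "(\<Sum>i\<in>UNIV. \<xi>0 $ i * (if i = k then - a j else H j i w)) = - (\<xi>0 $ k * a j) + (\<Sum>i\<in>UNIV - {k}. \<xi>0 $ i * H j i w)"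
      by (subst sum.remove[of UNIV k]) auto
    with x0(2)[of j] that show ?thesis by (simp add: Compl_eq_Diff_UNIV)
  qed
  \<comment> \<open>In a kernel direction with \<xi>_k = 0 both negative terms of the second-order
    condition disappear and \<epsilon> |\<xi>|^2 <= 0 remains. This argument takes the place of a
    smoothness assumption on the solution set.\<close>
  have xk: "\<xi>0 $ k \<noteq> 0"
  proof
    assume "\<xi>0 $ k = 0"
    then have "\<epsilon> * (norm \<xi>0)\<^sup>2 \<le> 0" using opt(2)[OF ker0] by simp
    then show False using ep x0 by (simp add: mult_le_0_iff)
  qed
  define \<xi> where "\<xi> = inverse (\<xi>0 $ k) *s \<xi>0"
  have x1: "\<xi> $ k = 1" using xk by (simp add: \<xi>_def)
  have ker: "(\<Sum>i\<in>-{k}. \<xi> $ i * H j i w) = \<xi> $ k * a j" if "j \<noteq> k" for j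
    using ker0[OF that] xk by (simp add: \<xi>_def mult.assoc sum_distrib_left[symmetric])
  define q where "q = (\<Sum>i\<in>-{k}. w $ i * a i)"
  have q: "norm q \<le> C * (1 + norm (p w))" unfolding q_def using est[of w] wR wk2 cons\<eta> by blast
  have o1: "of_real (- (A / (2 * S))) * cnj (w $ k) + of_real (1 / P) * (cnj (p w) * q)
        + of_real \<epsilon> * (\<Sum>i\<in>UNIV. cnj (w $ i) * \<xi> $ i) = 0"
    using opt(1)[OF ker] by (simp add: x1 q_def)
  have o2: "\<epsilon> * (norm \<xi>)\<^sup>2 \<le> A / (2 * S) + (norm q)\<^sup>2 / P"
    using opt(2)[OF ker] by (simp add: x1 q_def)
  have pp: "norm (p w) * (1 + norm (p w)) \<le> 2 * P" "(1 + norm (p w))\<^sup>2 \<le> 2 * P"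
  proof -
    have "0 \<le> (norm (p w) - 1)\<^sup>2" by simp
    then show "(1 + norm (p w))\<^sup>2 \<le> 2 * P" by (simp add: P_def power2_eq_square algebra_simps)
    moreover have "norm (p w) * (1 + norm (p w)) \<le> (1 + norm (p w)) * (1 + norm (p w))"
      by (intro mult_right_mono) auto
    ultimately show "norm (p w) * (1 + norm (p w)) \<le> 2 * P" by (simp add: power2_eq_square)
  qed
  have "\<epsilon> * (norm \<xi>)\<^sup>2 \<le> E"
  proof -
    have "A / (2 * S) \<le> A / (2 * \<delta>)" using S \<delta> A_pos by (intro divide_left_mono) auto
    moreover have "(norm q)\<^sup>2 / P \<le> 2 * C\<^sup>2"
    proof -
      have "(norm q)\<^sup>2 \<le> (C * (1 + norm (p w)))\<^sup>2" using q by (intro power_mono) auto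
      also have "\<dots> \<le> C\<^sup>2 * (2 * P)" unfolding power_mult_distrib using pp by (intro mult_left_mono) auto
      finally show ?thesis using P by (simp add: divide_le_eq)
    qed
    ultimately show ?thesis using o2 unfolding E_def by linarith
  qed
  then have "\<epsilon> * (Z\<^sup>2 * (\<epsilon> * (norm \<xi>)\<^sup>2)) \<le> \<epsilon> * (Z\<^sup>2 * E)" using ep by (intro mult_left_mono) auto
  also have "\<dots> \<le> 1\<^sup>2" using epZE by simp
  finally have "(\<epsilon> * (Z * norm \<xi>))\<^sup>2 \<le> 1\<^sup>2" by (simp add: power_mult_distrib power2_eq_square mult_ac)
  then have eZx: "\<epsilon> * (Z * norm \<xi>) \<le> 1" by (rule power2_le_imp_le) simp
  have n3: "norm (\<Sum>i\<in>UNIV. cnj (w $ i) * \<xi> $ i) \<le> Z * norm \<xi>"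
  proof -
    have "norm (\<Sum>i\<in>UNIV. cnj (w $ i) * \<xi> $ i) \<le> (\<Sum>i\<in>(UNIV::'n set). (R + 2) * norm \<xi>)"
      by (intro sum_norm_le) (auto simp: norm_mult intro!: mult_mono K'_comp[OF w(1)] norm_nth_le_norm, use R in simp)
    then show ?thesis by (simp add: Z_def mult_ac)
  qed
  have "norm (of_real (A / (2 * S)) * cnj (w $ k)) = norm (of_real (1 / P) * (cnj (p w) * q)
        + of_real \<epsilon> * (\<Sum>i\<in>UNIV. cnj (w $ i) * \<xi> $ i))"
    using o1 by (simp add: algebra_simps)
  also have "\<dots> \<le> norm (of_real (1 / P) * (cnj (p w) * q)) + norm (of_real \<epsilon> * (\<Sum>i\<in>UNIV. cnj (w $ i) * \<xi> $ i))"
    by (rule norm_triangle_ineq)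
  also have "norm (of_real (1 / P) * (cnj (p w) * q)) = (1 / P) * (norm (p w) * norm q)"
    using P by (simp add: norm_mult norm_divide)
  also have "norm (of_real \<epsilon> * (\<Sum>i\<in>UNIV. cnj (w $ i) * \<xi> $ i)) = \<epsilon> * norm (\<Sum>i\<in>UNIV. cnj (w $ i) * \<xi> $ i)"
    using ep by (simp add: norm_mult)
  also have "\<epsilon> * norm (\<Sum>i\<in>UNIV. cnj (w $ i) * \<xi> $ i) \<le> 1"
    using mult_left_mono[OF n3, of \<epsilon>] ep eZx by linarith
  also have "(1 / P) * (norm (p w) * norm q) \<le> 2 * C"
  proof -
    have "norm (p w) * norm q \<le> norm (p w) * (C * (1 + norm (p w)))" using q by (intro mult_left_mono) auto
    also have "\<dots> = C * (norm (p w) * (1 + norm (p w)))" by simp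
    also have "\<dots> \<le> C * (2 * P)" using pp C by (intro mult_left_mono) auto
    finally show ?thesis using P by (simp add: divide_le_eq)
  qed
  also have "norm (of_real (A / (2 * S)) * cnj (w $ k)) = A * norm (w $ k) / (2 * S)"
    using A_pos S0 by (simp add: norm_mult norm_divide)
  finally have "A * norm (w $ k) / (2 * S) \<le> 2 * C + 1" by simp
  \<comment> \<open>As A is at least 4 (2 C + 1), this yields 2 |s| <= S; since S^2 = \<delta>^2 +
    |s|^2, it follows that 3 |s|^2 <= \<delta>^2.\<close>
  then have "A * norm (w $ k) \<le> (2 * C + 1) * (2 * S)" using S0 by (simp add: divide_le_eq)
  moreover have "4 * (2 * C + 1) * norm (w $ k) \<le> A * norm (w $ k)"
    unfolding A by (intro mult_right_mono) auto
  ultimately have "(2 * C + 1) * (4 * norm (w $ k)) \<le> (2 * C + 1) * (2 * S)" by (simp add: algebra_simps)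
  then have "4 * norm (w $ k) \<le> 2 * S" using C by (subst (asm) mult_le_cancel_left_pos) auto
  then have "(2 * norm (w $ k))\<^sup>2 \<le> S\<^sup>2" by (intro power_mono) auto
  then have "3 * (norm (w $ k))\<^sup>2 \<le> \<delta>\<^sup>2" by (simp add: S2 power_mult_distrib)
  then have "(norm (w $ k))\<^sup>2 < \<delta>\<^sup>2" using \<delta> by (smt (verit) zero_less_power zero_le_power2)
  then have "norm (w $ k) < \<delta>" by (rule power2_less_imp_less) (use \<delta> in simp)
  moreover have "norm (G j w - w $ k * a j) \<le> \<delta>" if "j \<noteq> k" for j using cons[OF that] et' by linarith
  ultimately show thesis using w(1) that by blast
qed

text \<open>By compactness of \<open>K'\<close> the total defect of the equations attains its
  minimum, and the approximate solutions for small \<delta> show that this minimum cannot be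
  positive.\<close>

theorem zero_exists: "\<exists>w. (\<forall>i. i \<noteq> k \<longrightarrow> norm (w $ i) \<le> R) \<and> (\<forall>j. j \<noteq> k \<longrightarrow> G j w = 0)"
proof -
  define \<Psi> where "\<Psi> w = (\<Sum>j\<in>-{k}. norm (G j w))" for w
  have "continuous_on K' \<Psi>" unfolding \<Psi>_def by (intro continuous_intros contK') auto
  moreover have "w1 \<in> K'" using w1 by (auto simp: K'_def less_imp_le)
  ultimately obtain w where w: "w \<in> K'" "\<And>v. v \<in> K' \<Longrightarrow> \<Psi> w \<le> \<Psi> v"
    using continuous_attains_inf[OF compact_K', of \<Psi>] by blast
  have n: "\<Psi> w \<ge> 0" by (simp add: \<Psi>_def sum_nonneg)
  have "\<Psi> w = 0"
  proof (rule ccontr)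
    assume "\<Psi> w \<noteq> 0"
    with n have pos: "\<Psi> w > 0" by simp
    define Y where "Y = (\<Sum>j\<in>-{k}. 1 + norm (a j))"
    have Y: "Y \<ge> 0" by (simp add: Y_def sum_nonneg)
    define \<delta> where "\<delta> = min 1 (\<Psi> w / (2 * (Y + 1)))"
    have \<delta>: "0 < \<delta>" "\<delta> \<le> 1" using pos Y by (auto simp: \<delta>_def)
    obtain v where v: "v \<in> K'" "norm (v $ k) < \<delta>" "\<And>j. j \<noteq> k \<Longrightarrow> norm (G j v - v $ k * a j) \<le> \<delta>"
      using approx[OF \<delta>] by blast
    have "\<Psi> v \<le> (\<Sum>j\<in>-{k}. \<delta> * (1 + norm (a j)))"
      unfolding \<Psi>_def
    proof (rule sum_mono)
      fix j assume "j \<in> -{k}"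
      then have j: "j \<noteq> k" by simp
      have "norm (G j v) \<le> norm (G j v - v $ k * a j) + norm (v $ k * a j)"
        using norm_triangle_ineq[of "G j v - v $ k * a j" "v $ k * a j"] by simp
      also have "\<dots> \<le> \<delta> + \<delta> * norm (a j)" using v(3)[OF j] v(2)
        by (intro add_mono) (auto simp: norm_mult intro!: mult_right_mono)
      finally show "norm (G j v) \<le> \<delta> * (1 + norm (a j))" by (simp add: algebra_simps)
    qed
    also have "\<dots> = \<delta> * Y" by (simp add: Y_def sum_distrib_left)
    also have "\<dots> \<le> (\<Psi> w / (2 * (Y + 1))) * (Y + 1)" using \<delta> Y by (intro mult_mono) (auto simp: \<delta>_def)
    also have "\<dots> = \<Psi> w / 2" using Y by (simp add: field_simps)
    finally show False using w(2)[OF v(1)] pos by simp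
  qed
  then have "G j w = 0" if "j \<noteq> k" for j
    using that by (auto simp: \<Psi>_def sum_nonneg_eq_0_iff)
  then show ?thesis using w(1) by (auto simp: K'_def intro!: exI[of _ w])
qed

end

section \<open>Positive weights: scaling to the principal part\<close>

definition dil :: "real ^ 'n::finite \<Rightarrow> real \<Rightarrow> complex ^ 'n \<Rightarrow> complex ^ 'n" where
  "dil l \<mu> z = (\<chi> i. of_real (\<mu> powr (l $ i)) * z $ i)"

lemma norm_has_sum_le:
  fixes f :: "'a \<Rightarrow> complex"
  assumes f: "(f has_sum s) UNIV" and g: "g summable_on UNIV" and le: "\<And>a. norm (f a) \<le> g a"
  shows "norm s \<le> infsum g UNIV"
proof -
  have n: "(\<lambda>a. norm (f a)) summable_on UNIV" by (rule summable_on_comparison_test[OF g le]) auto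
  have "norm s \<le> infsum (\<lambda>a. norm (f a)) UNIV"
    by (rule norm_has_sum_bound[OF has_sum_infsum[OF n] f])
  also have "\<dots> \<le> infsum g UNIV" by (rule infsum_mono[OF n g le])
  finally show ?thesis .
qed

lemma monomial_dil:
  assumes "0 < \<mu>"
  shows "monomial a (dil l \<mu> z) = of_real (\<mu> powr weighted_degree l a) * monomial a z"
proof -
  have "(\<Prod>i\<in>UNIV. (\<mu> powr l $ i) ^ a i) = \<mu> powr weighted_degree l a"
    unfolding weighted_degree_def using assms
    by (simp add: powr_sum powr_power)
  then show ?thesis
    by (simp add: monomial_def dil_def power_mult_distrib prod.distrib flip: of_real_power of_real_prod)
qed

text \<open>Positivity of the weights bounds every exponent. It makes principal parts polynomials
  and leaves a gap between consecutive degrees.\<close>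

lemma finite_weighted_degree_le:
  fixes l :: "real ^ 'n::finite"
  assumes l: "\<And>i. 0 < l $ i"
  shows "finite {a. weighted_degree l a \<le> b}"
proof -
  define m where "m = Min (range (\<lambda>i. l $ i))"
  have m: "m > 0" using l by (simp add: m_def Min_gr_iff)
  have ml: "m \<le> l $ i" for i by (simp add: m_def)
  define N where "N = nat \<lceil>b / m\<rceil>"
  have "a i \<in> {..N}" if a: "weighted_degree l a \<le> b" for a i
  proof -
    have "real (a i) * m \<le> real (a i) * l $ i" using ml by (intro mult_left_mono) auto
    also have "\<dots> \<le> weighted_degree l a" unfolding weighted_degree_def
      by (rule member_le_sum) (use l less_imp_le in \<open>auto intro!: mult_nonneg_nonneg\<close>)
    finally have "real (a i) \<le> b / m" using a m by (simp add: field_simps)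
    then show ?thesis unfolding N_def by (simp add: le_nat_iff) linarith
  qed
  then have "{a. weighted_degree l a \<le> b} \<subseteq> Pi\<^sub>E UNIV (\<lambda>_. {..N})" by (auto simp: PiE_def)
  then show ?thesis by (rule finite_subset) (intro finite_PiE, auto)
qed

lemma powr_small:
  assumes "0 < g" "0 < (b::real)"
  obtains \<mu> where "0 < \<mu>" "\<mu> \<le> 1" "\<And>x. 0 < x \<Longrightarrow> x \<le> \<mu> \<Longrightarrow> x powr g \<le> b"
proof (rule that[of "min 1 (b powr (1/g))"])
  show "x powr g \<le> b" if "0 < x" "x \<le> min 1 (b powr (1/g))" for x
  proof -
    have "x powr g \<le> (b powr (1/g)) powr g" using that assms by (intro powr_mono2) auto
    then show ?thesis using assms by (simp add: powr_powr)
  qed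
qed (use assms in auto)

lemma powr_small_all:
  fixes l :: "real ^ 'n::finite"
  assumes l: "\<And>i. 0 < l $ i" and b: "0 < b"
  obtains \<mu> where "0 < \<mu>" "\<mu> \<le> 1" "\<And>x i. 0 < x \<Longrightarrow> x \<le> \<mu> \<Longrightarrow> x powr (l $ i) \<le> b"
proof -
  have "\<forall>i. \<exists>\<mu>>0. \<mu> \<le> 1 \<and> (\<forall>x. 0 < x \<longrightarrow> x \<le> \<mu> \<longrightarrow> x powr (l $ i) \<le> b)"
    using powr_small[OF l b] by metis
  then obtain \<Lambda> where L: "\<And>i. \<Lambda> i > 0" "\<And>i. \<Lambda> i \<le> 1" "\<And>i x. 0 < x \<Longrightarrow> x \<le> \<Lambda> i \<Longrightarrow> x powr (l $ i) \<le> b"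
    by metis
  show thesis
  proof (rule that[of "Min (range \<Lambda>)"])
    show "0 < Min (range \<Lambda>)" using L by (simp add: Min_gr_iff)
    have m: "Min (range \<Lambda>) \<le> \<Lambda> i" for i by simp
    then show "Min (range \<Lambda>) \<le> 1" using L(2) order_trans by blast
    show "x powr (l $ i) \<le> b" if "0 < x" "x \<le> Min (range \<Lambda>)" for x i
      using L(3) that m order_trans by blast
  qed
qed

text \<open>All degrees above e exceed it by at least a gap \<gamma>, so under dilation the
  remaining terms are smaller by the factor (\<mu> / \<mu>1)^\<gamma>. Here \<mu>1 brings the
  polydisc of radius R into the domain of the series, where a summable majorant is
  available.\<close>

lemma scaling_limit:
  fixes l :: "real ^ 'n::finite"
  assumes l: "\<And>i. 0 < l $ i" and g: "expands r g d" and deg: "\<And>a. d a \<noteq> 0 \<Longrightarrow> e \<le> weighted_degree l a"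
    and eta: "0 < \<eta>" and R: "0 < R"
  obtains \<mu>0 where "0 < \<mu>0" "\<mu>0 \<le> 1" "\<And>\<mu> z. 0 < \<mu> \<Longrightarrow> \<mu> \<le> \<mu>0 \<Longrightarrow> (\<And>i. norm (z $ i) \<le> R) \<Longrightarrow>
     norm (of_real (\<mu> powr (-e)) * g (dil l \<mu> z) - (\<Sum>a\<in>{a. d a \<noteq> 0 \<and> weighted_degree l a = e}. d a * monomial a z)) \<le> \<eta>"
proof -
  have r: "r > 0" using g by (rule expands_pos)
  obtain \<mu>1 where l1: "0 < \<mu>1" "\<mu>1 \<le> 1" "\<And>x i. 0 < x \<Longrightarrow> x \<le> \<mu>1 \<Longrightarrow> x powr (l $ i) \<le> r / R"
    using powr_small_all[OF l, of "r / R"] r R by auto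
  define T where "T = {a. d a \<noteq> 0 \<and> weighted_degree l a = e}"
  have fT: "finite T" unfolding T_def
    by (rule finite_subset[OF _ finite_weighted_degree_le[OF l, of e]]) auto
  \<comment> \<open>Only finitely many degrees lie between e and e + 1; the inserted 1 serves all
    degrees beyond.\<close>
  define J where "J = insert 1 ((\<lambda>a. weighted_degree l a - e) ` {a. weighted_degree l a \<le> e + 1 \<and> weighted_degree l a > e})"
  have fJ: "finite J" unfolding J_def
    by (intro finite.insertI finite_imageI) (rule finite_subset[OF _ finite_weighted_degree_le[OF l, of "e+1"]], auto)
  define \<gamma> where "\<gamma> = Min J"
  have gam: "\<gamma> > 0" using fJ by (auto simp: \<gamma>_def J_def Min_gr_iff)
  have gam2: "weighted_degree l a - e \<ge> \<gamma>" if "d a \<noteq> 0" "a \<notin> T" for a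
  proof -
    have gt: "weighted_degree l a > e" using deg[OF that(1)] that by (auto simp: T_def)
    show ?thesis
    proof (cases "weighted_degree l a \<le> e + 1")
      case True
      then have "weighted_degree l a - e \<in> J" using gt by (auto simp: J_def)
      then show ?thesis unfolding \<gamma>_def using fJ by simp
    next
      case False
      have "\<gamma> \<le> 1" unfolding \<gamma>_def using fJ by (intro Min_le) (auto simp: J_def)
      then show ?thesis using False by linarith
    qed
  qed
  define b where "b a = norm (d a) * r ^ (\<Sum>i\<in>UNIV. a i)" for a
  have b: "b summable_on UNIV" unfolding b_def by (rule expands_summable[OF g])
  define Q where "Q = \<mu>1 powr (-e) * infsum b UNIV"
  have Q: "Q \<ge> 0" unfolding Q_def by (intro mult_nonneg_nonneg infsum_nonneg) (use r in \<open>auto simp: b_def\<close>)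
  obtain \<mu>2 where l2: "0 < \<mu>2" "\<mu>2 \<le> 1" "\<And>x. 0 < x \<Longrightarrow> x \<le> \<mu>2 \<Longrightarrow> x powr \<gamma> \<le> \<eta> / (Q + 1)"
    using powr_small[OF gam, of "\<eta> / (Q + 1)"] eta Q by auto
  show thesis
  proof (rule that[of "\<mu>1 * \<mu>2"])
    show "0 < \<mu>1 * \<mu>2" using l1 l2 by simp
    show "\<mu>1 * \<mu>2 \<le> 1" using l1 l2 by (simp add: mult_le_one)
    fix \<mu> :: real and z :: "complex ^ 'n" assume lam: "0 < \<mu>" "\<mu> \<le> \<mu>1 * \<mu>2" and z: "\<And>i. norm (z $ i) \<le> R"
    have lam1: "\<mu> \<le> \<mu>1" using lam l1 l2 mult_left_le[of \<mu>2 \<mu>1] by linarith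
    have inr: "norm (dil l x z $ i) \<le> r" if "0 < x" "x \<le> \<mu>1" for x i
    proof -
      have "norm (dil l x z $ i) \<le> (r / R) * R"
        using that l1(3)[OF that, of i] z[of i] R r unfolding dil_def
        by (auto simp: norm_mult simp del: times_divide_eq_left intro!: mult_mono)
      then show ?thesis using R by simp
    qed
    let ?F = "\<lambda>a. of_real (\<mu> powr (-e)) * (d a * monomial a (dil l \<mu> z))"
    have "((\<lambda>a. d a * monomial a (dil l \<mu> z)) has_sum g (dil l \<mu> z)) UNIV"
      by (rule expandsD[OF g]) (use inr lam lam1 in auto)
    then have F: "(?F has_sum of_real (\<mu> powr (-e)) * g (dil l \<mu> z)) UNIV" by (rule has_sum_cmult_right)
    have Feq: "?F a = d a * of_real (\<mu> powr (weighted_degree l a - e)) * monomial a z" for a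
      using lam by (simp add: monomial_dil powr_diff powr_minus_divide)
    have T: "((\<lambda>a. if a \<in> T then - ?F a else 0) has_sum (\<Sum>a\<in>T. - ?F a)) UNIV"
      by (rule has_sum_finite_neutralI[OF fT]) auto
    have "(\<Sum>a\<in>T. - ?F a) = - (\<Sum>a\<in>T. d a * monomial a z)"
      unfolding Feq sum_negf[symmetric] using lam by (intro sum.cong) (auto simp: T_def)
    with has_sum_add[OF F T] have D: "((\<lambda>a. ?F a + (if a \<in> T then - ?F a else 0)) has_sum
        (of_real (\<mu> powr (-e)) * g (dil l \<mu> z) - (\<Sum>a\<in>T. d a * monomial a z))) UNIV" by simp
    have le: "norm (?F a + (if a \<in> T then - ?F a else 0)) \<le> ((\<mu> / \<mu>1) powr \<gamma> * \<mu>1 powr (-e)) * b a" for a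
    proof (cases "a \<in> T \<or> d a = 0")
      case True
      then show ?thesis using r by (auto simp: b_def)
    next
      case False
      define w where "w = weighted_degree l a"
      have "norm (?F a + (if a \<in> T then - ?F a else 0)) = norm (d a) * (\<mu> powr (w - e) * norm (monomial a z))"
        unfolding Feq using False by (simp add: norm_mult w_def)
      also have "\<mu> powr (w - e) = (\<mu> / \<mu>1) powr (w - e) * \<mu>1 powr (w - e)"
        using lam l1 by (simp add: powr_divide)
      also have "(\<mu> / \<mu>1) powr (w - e) * \<mu>1 powr (w - e) * norm (monomial a z)
          = (\<mu> / \<mu>1) powr (w - e) * \<mu>1 powr (-e) * (\<mu>1 powr w * norm (monomial a z))"
        using l1 by (simp add: powr_diff powr_minus_divide)
      also have "\<mu>1 powr w * norm (monomial a z) = norm (monomial a (dil l \<mu>1 z))"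
        using l1 by (simp add: monomial_dil norm_mult w_def)
      also have "norm (d a) * ((\<mu> / \<mu>1) powr (w - e) * \<mu>1 powr (-e) * norm (monomial a (dil l \<mu>1 z)))
          \<le> norm (d a) * ((\<mu> / \<mu>1) powr \<gamma> * \<mu>1 powr (-e) * r ^ (\<Sum>i\<in>UNIV. a i))"
      proof (intro mult_left_mono mult_mono norm_monomial_le inr)
        show "(\<mu> / \<mu>1) powr (w - e) \<le> (\<mu> / \<mu>1) powr \<gamma>"
          using gam2[of a] False lam lam1 l1 by (intro powr_mono') (auto simp: w_def)
      qed (use l1 in auto)
      finally show ?thesis by (simp add: b_def mult_ac)
    qed
    have "norm (of_real (\<mu> powr (-e)) * g (dil l \<mu> z) - (\<Sum>a\<in>T. d a * monomial a z))
       \<le> infsum (\<lambda>a. ((\<mu> / \<mu>1) powr \<gamma> * \<mu>1 powr (-e)) * b a) UNIV"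
      by (rule norm_has_sum_le[OF D _ le]) (intro summable_on_cmult_right b)
    also have "\<dots> = (\<mu> / \<mu>1) powr \<gamma> * Q" by (simp add: infsum_cmult_right' Q_def)
    also have "\<dots> \<le> \<eta> / (Q + 1) * (Q + 1)"
      using lam l1 l2 Q eta by (intro mult_mono l2(3)) (auto simp: field_simps)
    also have "\<dots> = \<eta>" using Q by simp
    finally show "norm (of_real (\<mu> powr (-e)) * g (dil l \<mu> z) - (\<Sum>a\<in>{a. d a \<noteq> 0 \<and> weighted_degree l a = e}. d a * monomial a z)) \<le> \<eta>"
      by (simp add: T_def)
  qed
qed

section \<open>Weighted norm and Hessian coefficients\<close>

definition rho :: "real ^ 'n::finite \<Rightarrow> complex ^ 'n \<Rightarrow> real" where
  "rho l z = Max (range (\<lambda>i. norm (z $ i) powr (1 / l $ i)))"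

definition unit_idx :: "'n \<Rightarrow> 'n \<Rightarrow> nat" where "unit_idx i = (\<lambda>j. if j = i then 1 else 0)"

text \<open>The second partial derivatives at 0: for i = j the factor 2 comes from
  \<open>diff_coeff\<close>.\<close>

definition hess :: "(('n \<Rightarrow> nat) \<Rightarrow> complex) \<Rightarrow> 'n \<Rightarrow> 'n \<Rightarrow> complex" where
  "hess c j i = diff_coeff j c (unit_idx i)"

lemma hess_sym: "hess c j i = hess c i j"
proof -
  have "(unit_idx i)(j := Suc (unit_idx i j)) = (unit_idx j)(i := Suc (unit_idx j i))"
    by (auto simp: unit_idx_def fun_eq_iff)
  moreover have "unit_idx i j = unit_idx j i" by (auto simp: unit_idx_def)
  ultimately show ?thesis by (simp add: hess_def diff_coeff_def)
qed

lemma inj_unit_idx: "inj unit_idx"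
  by (auto simp: inj_def unit_idx_def fun_eq_iff split: if_splits)

lemma sum_eq_1_unit_idx:
  fixes a :: "'n::finite \<Rightarrow> nat"
  assumes "(\<Sum>i\<in>UNIV. a i) = 1"
  obtains i where "a = unit_idx i"
proof -
  obtain i where i: "a i \<noteq> 0" using assms by (metis sum.neutral zero_neq_one)
  have "a = unit_idx i"
  proof
    fix k
    have "a i + (\<Sum>k\<in>UNIV - {i}. a k) = 1" using assms by (simp add: sum.remove[of UNIV i])
    then have "a i = 1" and 0: "(\<Sum>k\<in>UNIV - {i}. a k) = 0" using i by linarith+
    moreover have "a k = 0" if "k \<noteq> i" using 0 that by (simp add: sum_eq_0_iff)
    ultimately show "a k = unit_idx i k" by (cases "k = i") (auto simp: unit_idx_def)
  qed
  then show thesis by (rule that)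
qed

lemma weighted_degree_const:
  assumes "\<And>i. a i \<noteq> 0 \<Longrightarrow> l $ i = b"
  shows "weighted_degree l a = real (\<Sum>i\<in>UNIV. a i) * b"
proof -
  have "weighted_degree l a = (\<Sum>i\<in>UNIV. real (a i) * b)"
    unfolding weighted_degree_def by (intro sum.cong) (use assms in force)+
  then show ?thesis by (simp add: sum_distrib_right)
qed

lemma monomial_unit_idx: "monomial (unit_idx i) z = z $ i"
proof -
  have "monomial (unit_idx i) z = (\<Prod>j\<in>UNIV. if j = i then z $ j else 1)"
    unfolding monomial_def unit_idx_def by (intro prod.cong) auto
  then show ?thesis by simp
qed

lemma weighted_degree_unit_idx: "weighted_degree l (unit_idx i) = l $ i"
proof -
  have "weighted_degree l (unit_idx i) = (\<Sum>j\<in>UNIV. if j = i then l $ j else 0)"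
    unfolding weighted_degree_def unit_idx_def by (intro sum.cong) auto
  then show ?thesis by simp
qed

lemma weighted_degree_upd_Suc: "weighted_degree l (a(j := Suc (a j))) = weighted_degree l a + l $ j"
  unfolding weighted_degree_def by (simp add: sum.remove[of UNIV j] algebra_simps)

lemma diff_coeff_degree:
  assumes "\<And>a. c a \<noteq> 0 \<Longrightarrow> 1 \<le> weighted_degree l a" "diff_coeff j c a \<noteq> 0"
  shows "1 - l $ j \<le> weighted_degree l a"
  using assms(1)[of "a(j := Suc (a j))"] assms(2) by (auto simp: diff_coeff_def weighted_degree_upd_Suc)

lemma gradient_hess:
  assumes "expands r f c"
  shows "gradient (\<lambda>z. gradient f z $ j) 0 $ i = hess c j i"
proof -
  have "gradient (\<lambda>z. gradient f z $ j) 0 $ i = diff_coeff i (diff_coeff j c) (\<lambda>_. 0)"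
    by (rule expands_at_0[OF expands_gradient[OF expands_gradient[OF assms]]])
  also have "\<dots> = diff_coeff j c ((\<lambda>_. 0)(i := Suc 0))" by (simp add: diff_coeff_def[of i "diff_coeff j c"])
  also have "(\<lambda>_. 0)(i := Suc 0) = unit_idx i" by (auto simp: unit_idx_def fun_eq_iff)
  also have "diff_coeff j c (unit_idx i) = hess c j i" by (simp add: hess_def)
  finally show ?thesis .
qed

lemma gradient_at_0: 
  assumes "expands r f c" shows "gradient f 0 $ j = c (unit_idx j)"
proof -
  have "gradient f 0 $ j = diff_coeff j c (\<lambda>_. 0)" by (rule expands_at_0[OF expands_gradient[OF assms]])
  also have "\<dots> = c (unit_idx j)" by (simp add: diff_coeff_def unit_idx_def fun_upd_def cong: if_cong)
  finally show ?thesis .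
qed

lemma gradient_strict_derivative:
  fixes f :: "complex ^ 'n::finite \<Rightarrow> complex"
  assumes ex: "expands r f c" and eta: "0 < \<eta>"
  obtains \<delta> where "0 < \<delta>" "\<And>j x y. norm x \<le> \<delta> \<Longrightarrow> norm y \<le> \<delta> \<Longrightarrow>
     norm (gradient f x $ j - gradient f y $ j - (\<Sum>i\<in>UNIV. hess c j i * (x - y) $ i)) \<le> \<eta> * norm (x - y)"
proof -
  have "\<exists>\<delta>>0. \<forall>x y. norm x \<le> \<delta> \<longrightarrow> norm y \<le> \<delta> \<longrightarrow>
     norm (gradient f x $ j - gradient f y $ j - (\<Sum>i\<in>UNIV. hess c j i * (x - y) $ i)) \<le> \<eta> * norm (x - y)" for j
  proof -
    obtain \<delta> where "0 < \<delta>" "\<And>x y. norm x \<le> \<delta> \<Longrightarrow> norm y \<le> \<delta> \<Longrightarrow>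
      norm (gradient f x $ j - gradient f y $ j - (\<Sum>i\<in>UNIV. (x - y) $ i * gradient (\<lambda>z. gradient f z $ j) 0 $ i)) \<le> \<eta> * norm (x - y)"
      using expands_strict_derivative[OF expands_gradient[OF ex, of j] eta] by blast
    then show ?thesis unfolding gradient_hess[OF ex] mult.commute[of "(_ - _) $ _"] by blast
  qed
  then obtain d where d: "\<And>j. d j > 0" "\<And>j x y. norm x \<le> d j \<Longrightarrow> norm y \<le> d j \<Longrightarrow>
     norm (gradient f x $ j - gradient f y $ j - (\<Sum>i\<in>UNIV. hess c j i * (x - y) $ i)) \<le> \<eta> * norm (x - y)" by metis
  have m: "Min (range d) \<le> d j" for j by simp
  show thesis
  proof (rule that[of "Min (range d)"])
    show "0 < Min (range d)" using d by (simp add: Min_gr_iff)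
    show "norm (gradient f x $ j - gradient f y $ j - (\<Sum>i\<in>UNIV. hess c j i * (x - y) $ i)) \<le> \<eta> * norm (x - y)"
      if "norm x \<le> Min (range d)" "norm y \<le> Min (range d)" for j x y
      using d(2)[of x j y] that m[of j] by linarith
  qed
qed

lemma gradient_lipschitz:
  fixes f :: "complex ^ 'n::finite \<Rightarrow> complex"
  assumes ex: "expands r f c"
  obtains B \<delta> where "0 < B" "0 < \<delta>" "\<And>j x y. norm x \<le> \<delta> \<Longrightarrow> norm y \<le> \<delta> \<Longrightarrow> norm (gradient f x $ j - gradient f y $ j) \<le> B * norm (x - y)"
proof -
  obtain \<delta> where d: "0 < \<delta>" "\<And>j x y. norm x \<le> \<delta> \<Longrightarrow> norm y \<le> \<delta> \<Longrightarrow>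
     norm (gradient f x $ j - gradient f y $ j - (\<Sum>i\<in>UNIV. hess c j i * (x - y) $ i)) \<le> 1 * norm (x - y)"
    using gradient_strict_derivative[OF ex, of 1] by auto
  define B where "B = 1 + (\<Sum>j\<in>UNIV. \<Sum>i\<in>UNIV. norm (hess c j i))"
  have B0: "B > 0" unfolding B_def by (intro add_pos_nonneg sum_nonneg) auto
  show thesis
  proof (rule that[OF B0 d(1)])
    fix j and x y :: "complex ^ 'n" assume x: "norm x \<le> \<delta>" "norm y \<le> \<delta>"
    have "norm (\<Sum>i\<in>UNIV. hess c j i * (x - y) $ i) \<le> (\<Sum>i\<in>UNIV. norm (hess c j i) * norm (x - y))"
      by (intro sum_norm_le) (metis norm_mult mult_left_mono norm_nth_le_norm norm_ge_zero)
    also have "\<dots> = (\<Sum>i\<in>UNIV. norm (hess c j i)) * norm (x - y)" by (simp add: sum_distrib_right)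
    also have "\<dots> \<le> (\<Sum>j\<in>UNIV. \<Sum>i\<in>UNIV. norm (hess c j i)) * norm (x - y)"
      by (intro mult_right_mono member_le_sum) (auto intro: sum_nonneg)
    finally have 1: "norm (\<Sum>i\<in>UNIV. hess c j i * (x - y) $ i) \<le> (\<Sum>j\<in>UNIV. \<Sum>i\<in>UNIV. norm (hess c j i)) * norm (x - y)" .
    have "norm (gradient f x $ j - gradient f y $ j) \<le> norm (\<Sum>i\<in>UNIV. hess c j i * (x - y) $ i) + norm (gradient f x $ j - gradient f y $ j - (\<Sum>i\<in>UNIV. hess c j i * (x - y) $ i))"
      by (rule norm_triangle_sub)
    with 1 d(2)[OF x, of j] show "norm (gradient f x $ j - gradient f y $ j) \<le> B * norm (x - y)" by (simp add: B_def distrib_right)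
  qed
qed

text \<open>The sum in \<open>iso\<close> is the j-th partial derivative of the principal part, a
  polynomial because the weights are positive. By homogeneity an isolated common zero at 0 is the
  only one anywhere, so \<open>iso\<close> can speak of all z.\<close>

locale positive_weights =
  fixes l :: "real ^ 'n::finite" and c :: "('n \<Rightarrow> nat) \<Rightarrow> complex"
    and f :: "complex ^ 'n \<Rightarrow> complex" and r :: real
  assumes ex: "expands r f c" and lpos: "\<And>i. 0 < l $ i" and l1: "\<And>i. l $ i < 1"
    and deg: "\<And>a. c a \<noteq> 0 \<Longrightarrow> 1 \<le> weighted_degree l a"
    and iso: "\<And>z. (\<And>j. (\<Sum>a\<in>{a. diff_coeff j c a \<noteq> 0 \<and> weighted_degree l a = 1 - l $ j}. diff_coeff j c a * monomial a z) = 0) \<Longrightarrow> z = 0"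
begin

definition F :: "'n \<Rightarrow> complex ^ 'n \<Rightarrow> complex" where "F j z = gradient f z $ j"
definition F0 :: "'n \<Rightarrow> complex ^ 'n \<Rightarrow> complex" where
  "F0 j z = (\<Sum>a\<in>{a. diff_coeff j c a \<noteq> 0 \<and> weighted_degree l a = 1 - l $ j}. diff_coeff j c a * monomial a z)"
definition f0 :: "complex ^ 'n \<Rightarrow> complex" where
  "f0 z = (\<Sum>a\<in>{a. c a \<noteq> 0 \<and> weighted_degree l a = 1}. c a * monomial a z)"

lemma r_pos: "r > 0" using ex by (rule expands_pos)

lemma exF: "expands (r/3) (F j) (diff_coeff j c)"
  unfolding F_def[abs_def] by (rule expands_gradient[OF ex])

lemma finite_degree_eq: "finite {a. P a \<and> weighted_degree l a = b}"
  by (rule finite_subset[OF _ finite_weighted_degree_le[OF lpos, of b]]) auto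

lemma iso0: "(\<And>j. F0 j z = 0) \<Longrightarrow> z = 0" unfolding F0_def using iso by blast

lemma F0_dil: "0 < \<mu> \<Longrightarrow> F0 j (dil l \<mu> z) = of_real (\<mu> powr (1 - l $ j)) * F0 j z"
  unfolding F0_def sum_distrib_left by (intro sum.cong) (auto simp: monomial_dil)

lemma continuous_monomial: "continuous_on S (monomial a)"
  unfolding monomial_def[abs_def] by (intro continuous_intros)

lemma continuous_F0: "continuous_on S (F0 j)"
  unfolding F0_def[abs_def] by (intro continuous_intros continuous_monomial)

text \<open>Each product z_i F0_i multiplies the monomial with exponent a by a_i, and on the
  principal part the sum of a_i l_i equals 1.\<close>

lemma euler: "f0 z = (\<Sum>i\<in>UNIV. of_real (l $ i) * z $ i * F0 i z)"
proof -
  let ?T = "{a. c a \<noteq> 0 \<and> weighted_degree l a = 1}"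
  have zF: "z $ i * F0 i z = (\<Sum>a\<in>?T. of_nat (a i) * (c a * monomial a z))" for i
  proof -
    let ?u = "\<lambda>a. a(i := Suc (a i))"
    have "(\<Sum>a\<in>?T. of_nat (a i) * (c a * monomial a z)) = (\<Sum>a\<in>{a \<in> ?T. a i \<noteq> 0}. of_nat (a i) * (c a * monomial a z))"
      using finite_degree_eq by (intro sum.mono_neutral_right) auto
    also have "\<dots> = (\<Sum>a\<in>{a. diff_coeff i c a \<noteq> 0 \<and> weighted_degree l a = 1 - l $ i}. z $ i * (diff_coeff i c a * monomial a z))"
    proof (rule sum.reindex_bij_witness[of _ ?u "\<lambda>a. a(i := a i - 1)"])
      fix a assume "a \<in> {a \<in> ?T. a i \<noteq> 0}"
      then have a: "c a \<noteq> 0" "weighted_degree l a = 1" "a i \<noteq> 0" by auto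
      let ?a = "a(i := a i - 1)"
      show ua: "?u ?a = a" using a by (auto simp: fun_eq_iff)
      show "?a \<in> {a. diff_coeff i c a \<noteq> 0 \<and> weighted_degree l a = 1 - l $ i}"
        using ua a weighted_degree_upd_Suc[of l ?a i] by (simp add: diff_coeff_def)
      obtain n where n: "a i = Suc n" using a not0_implies_Suc by blast
      have "(\<Prod>j\<in>UNIV - {i}. z $ j ^ ?a j) = (\<Prod>j\<in>UNIV - {i}. z $ j ^ a j)"
        by (intro prod.cong) auto
      then have m: "monomial a z = z $ i * monomial ?a z"
        unfolding monomial_def by (subst (1 2) prod.remove[of UNIV i]) (auto simp: n)
      have "diff_coeff i c ?a = of_nat (a i) * c a" using ua a by (simp add: diff_coeff_def)
      then show "z $ i * (diff_coeff i c ?a * monomial ?a z) = of_nat (a i) * (c a * monomial a z)"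
        by (simp add: m)
    next
      fix a assume "a \<in> {a. diff_coeff i c a \<noteq> 0 \<and> weighted_degree l a = 1 - l $ i}"
      then show "?u a \<in> {a \<in> ?T. a i \<noteq> 0}" by (auto simp: diff_coeff_def weighted_degree_upd_Suc)
    qed auto
    finally show ?thesis by (simp add: F0_def sum_distrib_left)
  qed
  have "(\<Sum>i\<in>UNIV. of_real (l $ i) * z $ i * F0 i z) = (\<Sum>i\<in>UNIV. of_real (l $ i) * (\<Sum>a\<in>?T. of_nat (a i) * (c a * monomial a z)))"
    by (simp add: zF[symmetric] mult.assoc)
  also have "\<dots> = (\<Sum>a\<in>?T. (\<Sum>i\<in>UNIV. of_real (l $ i) * of_nat (a i)) * (c a * monomial a z))"
    unfolding sum_distrib_left sum_distrib_right by (subst sum.swap) (simp add: mult.assoc)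
  also have "\<dots> = (\<Sum>a\<in>?T. c a * monomial a z)"
  proof (rule sum.cong)
    fix a assume "a \<in> ?T"
    then have "(\<Sum>i\<in>UNIV. real (a i) * l $ i) = 1" by (simp add: weighted_degree_def)
    then have "of_real (\<Sum>i\<in>UNIV. real (a i) * l $ i) = (1::complex)" by simp
    then show "(\<Sum>i\<in>UNIV. of_real (l $ i) * of_nat (a i)) * (c a * monomial a z) = c a * monomial a z"
      by (simp add: mult.commute)
  qed simp
  finally show ?thesis by (simp add: f0_def)
qed

lemma diff_coeff_deg: "diff_coeff j c a \<noteq> 0 \<Longrightarrow> 1 - l $ j \<le> weighted_degree l a"
  using diff_coeff_degree[of c l j a] deg by blast

lemma F_limit:
  assumes "0 < \<eta>" "0 < R"
  obtains \<mu>0 where "0 < \<mu>0" "\<mu>0 \<le> 1" "\<And>\<mu> z j. 0 < \<mu> \<Longrightarrow> \<mu> \<le> \<mu>0 \<Longrightarrow> (\<And>i. norm (z $ i) \<le> R) \<Longrightarrow>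
     norm (of_real (\<mu> powr (l $ j - 1)) * F j (dil l \<mu> z) - F0 j z) \<le> \<eta>"
proof -
  have "\<exists>\<mu>0>0. \<mu>0 \<le> 1 \<and> (\<forall>\<mu> z. 0 < \<mu> \<longrightarrow> \<mu> \<le> \<mu>0 \<longrightarrow> (\<forall>i. norm (z $ i) \<le> R) \<longrightarrow>
     norm (of_real (\<mu> powr (l $ j - 1)) * F j (dil l \<mu> z) - F0 j z) \<le> \<eta>)" for j
  proof -
    have e: "- (1 - l $ j) = l $ j - 1" by simp
    obtain \<mu>0 where "0 < \<mu>0" "\<mu>0 \<le> 1" "\<And>\<mu> z. 0 < \<mu> \<Longrightarrow> \<mu> \<le> \<mu>0 \<Longrightarrow> (\<And>i. norm (z $ i) \<le> R) \<Longrightarrow>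
     norm (of_real (\<mu> powr (- (1 - l $ j))) * F j (dil l \<mu> z) - F0 j z) \<le> \<eta>"
      using scaling_limit[OF lpos exF[of j] diff_coeff_deg assms] unfolding F0_def by blast
    then show ?thesis unfolding e by blast
  qed
  then obtain \<Lambda> where L: "\<And>j. \<Lambda> j > 0" "\<And>j. \<Lambda> j \<le> 1" "\<And>j \<mu> z. 0 < \<mu> \<Longrightarrow> \<mu> \<le> \<Lambda> j \<Longrightarrow> (\<And>i. norm (z $ i) \<le> R) \<Longrightarrow>
     norm (of_real (\<mu> powr (l $ j - 1)) * F j (dil l \<mu> z) - F0 j z) \<le> \<eta>"
    by metis
  show thesis
  proof (rule that[of "Min (range \<Lambda>)"])
    show "0 < Min (range \<Lambda>)" using L by (simp add: Min_gr_iff)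
    have m: "Min (range \<Lambda>) \<le> \<Lambda> i" for i by simp
    then show "Min (range \<Lambda>) \<le> 1" using L(2) order_trans by blast
    show "norm (of_real (\<mu> powr (l $ j - 1)) * F j (dil l \<mu> z) - F0 j z) \<le> \<eta>"
      if "0 < \<mu>" "\<mu> \<le> Min (range \<Lambda>)" "\<And>i. norm (z $ i) \<le> R" for \<mu> z j
      using L(3)[OF that(1) order_trans[OF that(2) m] that(3)] .
  qed
qed

lemma f_limit:
  assumes "0 < \<eta>" "0 < R"
  obtains \<mu>0 where "0 < \<mu>0" "\<mu>0 \<le> 1" "\<And>\<mu> z. 0 < \<mu> \<Longrightarrow> \<mu> \<le> \<mu>0 \<Longrightarrow> (\<And>i. norm (z $ i) \<le> R) \<Longrightarrow>
     norm (of_real (\<mu> powr (-1)) * f (dil l \<mu> z) - f0 z) \<le> \<eta>"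
  using scaling_limit[OF lpos ex deg assms] unfolding f0_def by blast

lemma norm_nth_le_rho: "norm (z $ i) \<le> rho l z powr (l $ i)"
proof -
  have "norm (z $ i) = (norm (z $ i) powr (1 / l $ i)) powr (l $ i)"
    using lpos[of i] by (simp add: powr_powr)
  also have "\<dots> \<le> rho l z powr (l $ i)"
    unfolding rho_def using lpos[of i] by (intro powr_mono2) (auto intro!: Max_ge)
  finally show ?thesis .
qed

lemma rho_nonneg: "rho l z \<ge> 0"
proof -
  have "norm (z $ undefined) powr (1 / l $ undefined) \<le> rho l z" unfolding rho_def by (rule Max_ge) auto
  then show ?thesis using powr_ge_zero order_trans by blast
qed

lemma rho_pos: assumes "z \<noteq> 0" shows "rho l z > 0"
proof (rule ccontr)
  assume "\<not> ?thesis"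
  then have "rho l z = 0" using rho_nonneg[of z] by simp
  then have "norm (z $ i) \<le> 0" for i using norm_nth_le_rho[of z i] by simp
  then show False using assms by (simp add: vec_eq_iff)
qed

lemma rho_ge: "norm (z $ i) powr (1 / l $ i) \<le> rho l z"
  unfolding rho_def by (rule Max_ge) auto

lemma rho_le: "0 < \<delta> \<Longrightarrow> (\<And>i. norm (z $ i) \<le> \<delta> powr (l $ i)) \<Longrightarrow> rho l z \<le> \<delta>"
proof -
  assume d: "0 < \<delta>" and z: "\<And>i. norm (z $ i) \<le> \<delta> powr (l $ i)"
  have "norm (z $ i) powr (1 / l $ i) \<le> \<delta>" for i
  proof -
    have "norm (z $ i) powr (1 / l $ i) \<le> (\<delta> powr (l $ i)) powr (1 / l $ i)"
      using z lpos[of i] by (intro powr_mono2) auto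
    then show ?thesis using d lpos[of i] by (simp add: powr_powr)
  qed
  then show ?thesis unfolding rho_def by (subst Max_le_iff) auto
qed

text \<open>The boundary of the unit polydisc, which is the level set
  \<open>rho l z = 1\<close>.\<close>

definition Sph :: "(complex ^ 'n) set" where "Sph = {z. (\<forall>i. norm (z $ i) \<le> 1) \<and> (\<exists>i. norm (z $ i) = 1)}"

lemma compact_Sph: "compact Sph"
proof -
  have "Sph = (\<Inter>i\<in>UNIV. {z. norm (z $ i) \<le> 1}) \<inter> (\<Union>i\<in>UNIV. {z. norm (z $ i) = 1})"
    by (auto simp: Sph_def)
  moreover have "closed \<dots>"
    by (intro closed_Int closed_INT closed_UN ballI closed_Collect_le closed_Collect_eq continuous_intros) auto
  moreover have "bounded Sph"
    unfolding bounded_iff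
    by (intro exI[of _ "of_nat CARD('n) * 1"] ballI norm_le_card_nth) (auto simp: Sph_def)
  ultimately show ?thesis by (simp add: compact_eq_bounded_closed)
qed

lemma dil_rho:
  assumes "z \<noteq> 0"
  obtains \<zeta> where "\<zeta> \<in> Sph" "z = dil l (rho l z) \<zeta>"
proof -
  define t where "t = rho l z"
  have t: "t > 0" using rho_pos[OF assms] by (simp add: t_def)
  define \<zeta> where "\<zeta> = dil l (1/t) z"
  have n: "norm (\<zeta> $ i) = norm (z $ i) / t powr (l $ i)" for i
    using t by (simp add: \<zeta>_def dil_def norm_mult powr_divide norm_divide)
  have "norm (\<zeta> $ i) \<le> 1" for i unfolding n using norm_nth_le_rho[of z i] t by (simp add: t_def)
  moreover have "\<exists>i. norm (\<zeta> $ i) = 1"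
  proof -
    have "t \<in> range (\<lambda>i. norm (z $ i) powr (1 / l $ i))" unfolding t_def rho_def by (rule Max_in) auto
    then obtain i where i: "t = norm (z $ i) powr (1 / l $ i)" by auto
    have "t powr (l $ i) = norm (z $ i)" unfolding i using lpos[of i] by (simp add: powr_powr)
    then show ?thesis using t n by (metis divide_self powr_eq_0_iff less_irrefl)
  qed
  ultimately have "\<zeta> \<in> Sph" by (simp add: Sph_def)
  moreover have "z = dil l t \<zeta>"
  proof -
    have "t powr (l $ i) * (1/t) powr (l $ i) = 1" for i
      using t powr_mult[of t "1/t" "l $ i"] by simp
    then have "complex_of_real (t powr (l $ i)) * complex_of_real ((1/t) powr (l $ i)) = 1" for i
      unfolding of_real_mult[symmetric] by simp
    then show ?thesis by (simp add: vec_eq_iff \<zeta>_def dil_def mult.assoc[symmetric])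
  qed
  ultimately show thesis using that unfolding t_def by blast
qed

text \<open>On the compact set \<open>Sph\<close> the partial derivatives have no common zero, and
  homogeneity carries the bound to all other points. Which component is large depends on z, and the
  power of rho with it.\<close>

lemma F0_lower:
  obtains c0 where "0 < c0" "\<And>z. z \<noteq> 0 \<Longrightarrow> \<exists>i. c0 * rho l z powr (1 - l $ i) \<le> norm (F0 i z)"
    "\<And>z. z \<in> Sph \<Longrightarrow> \<exists>i. c0 \<le> norm (F0 i z)"
proof -
  define \<Psi> where "\<Psi> z = (\<Sum>i\<in>UNIV. norm (F0 i z))" for z
  have "continuous_on Sph \<Psi>" unfolding \<Psi>_def by (intro continuous_intros continuous_F0)
  moreover have "(\<chi> i. 1) \<in> Sph" by (simp add: Sph_def)
  ultimately obtain y where y: "y \<in> Sph" "\<And>z. z \<in> Sph \<Longrightarrow> \<Psi> y \<le> \<Psi> z"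
    using continuous_attains_inf[OF compact_Sph, of \<Psi>] by blast
  have "y \<noteq> 0" using y(1) by (auto simp: Sph_def)
  then obtain j where "F0 j y \<noteq> 0" using iso0 by blast
  moreover have "norm (F0 j y) \<le> \<Psi> y" unfolding \<Psi>_def by (rule member_le_sum) auto
  ultimately have Py: "\<Psi> y > 0" by (smt (verit) zero_less_norm_iff)
  define c0 where "c0 = \<Psi> y / CARD('n)"
  have c0: "c0 > 0" using Py by (simp add: c0_def)
  have S: "\<exists>i. c0 \<le> norm (F0 i z)" if "z \<in> Sph" for z
  proof (rule ccontr)
    assume "\<not> ?thesis"
    then have "norm (F0 i z) < c0" for i by (simp add: not_le)
    then have "\<Psi> z < (\<Sum>i\<in>(UNIV::'n set). c0)" unfolding \<Psi>_def by (intro sum_strict_mono) auto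
    then have "\<Psi> z < \<Psi> y" by (simp add: c0_def)
    with y(2)[OF that] show False by simp
  qed
  show thesis
  proof (rule that[OF c0 _ S])
    fix z :: "complex ^ 'n" assume z: "z \<noteq> 0"
    obtain \<zeta> where zeta: "\<zeta> \<in> Sph" "z = dil l (rho l z) \<zeta>" by (rule dil_rho[OF z])
    obtain i where i: "c0 \<le> norm (F0 i \<zeta>)" using S[OF zeta(1)] by blast
    have "norm (F0 i z) = rho l z powr (1 - l $ i) * norm (F0 i \<zeta>)"
      by (subst zeta(2)) (use rho_pos[OF z] in \<open>simp add: F0_dil norm_mult\<close>)
    also have "\<dots> \<ge> rho l z powr (1 - l $ i) * c0" using i by (intro mult_left_mono) auto
    finally show "\<exists>i. c0 * rho l z powr (1 - l $ i) \<le> norm (F0 i z)" by (auto simp: mult.commute)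
  qed
qed

lemma F_lower:
  obtains c0 \<mu>0 where "0 < c0" "0 < \<mu>0" "\<mu>0 \<le> 1"
    "\<And>z. z \<noteq> 0 \<Longrightarrow> rho l z \<le> \<mu>0 \<Longrightarrow> \<exists>i. c0 * rho l z powr (1 - l $ i) \<le> norm (F i z)"
proof -
  obtain c0 where c0: "0 < c0" "\<And>z. z \<in> Sph \<Longrightarrow> \<exists>i. c0 \<le> norm (F0 i z)" using F0_lower by metis
  obtain \<mu>0 where L: "0 < \<mu>0" "\<mu>0 \<le> 1" "\<And>\<mu> z j. 0 < \<mu> \<Longrightarrow> \<mu> \<le> \<mu>0 \<Longrightarrow> (\<And>i. norm (z $ i) \<le> 1) \<Longrightarrow>
     norm (of_real (\<mu> powr (l $ j - 1)) * F j (dil l \<mu> z) - F0 j z) \<le> c0 / 2"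
    using F_limit[of "c0/2" 1] c0 by auto
  show thesis
  proof (rule that[of "c0/2" \<mu>0])
    fix z :: "complex ^ 'n" assume z: "z \<noteq> 0" and rz: "rho l z \<le> \<mu>0"
    obtain \<zeta> where zeta: "\<zeta> \<in> Sph" "z = dil l (rho l z) \<zeta>" by (rule dil_rho[OF z])
    obtain i where i: "c0 \<le> norm (F0 i \<zeta>)" using c0(2)[OF zeta(1)] by blast
    define t where "t = rho l z"
    have t: "t > 0" "t \<le> \<mu>0" "z = dil l t \<zeta>" using rho_pos[OF z] rz zeta by (auto simp: t_def)
    have "norm (of_real (t powr (l $ i - 1)) * F i (dil l t \<zeta>) - F0 i \<zeta>) \<le> c0 / 2"
      by (rule L(3)) (use t zeta in \<open>auto simp: Sph_def\<close>)
    then have "norm (F0 i \<zeta>) - norm (of_real (t powr (l $ i - 1)) * F i z) \<le> c0 / 2"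
      using norm_triangle_ineq2[of "F0 i \<zeta>" "of_real (t powr (l $ i - 1)) * F i z"] t(3) by (simp add: norm_minus_commute)
    then have "c0 / 2 \<le> t powr (l $ i - 1) * norm (F i z)" using i by (simp add: norm_mult)
    then have "c0 / 2 * t powr (1 - l $ i) \<le> (t powr (l $ i - 1) * norm (F i z)) * t powr (1 - l $ i)"
      by (intro mult_right_mono) auto
    also have "\<dots> = norm (F i z) * t powr (l $ i - 1 + (1 - l $ i))" by (simp only: powr_add mult_ac)
    also have "\<dots> = norm (F i z)" using t by simp
    finally show "\<exists>i. c0 / 2 * rho l z powr (1 - l $ i) \<le> norm (F i z)" unfolding t_def by blast
  qed (use c0 L in auto)
qed

lemma hess_nz: "hess c j i \<noteq> 0 \<Longrightarrow> 1 \<le> l $ i + l $ j"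
  using diff_coeff_deg[of j "unit_idx i"] by (simp add: hess_def weighted_degree_unit_idx)

text \<open>For \<open>x\<close> of pure weight \<open>b\<close> no monomial of order two or more can reach the degree \<open>1 - l\<^sub>j\<close>.\<close>

lemma F0_pure:
  assumes x: "\<And>i. x $ i \<noteq> 0 \<Longrightarrow> l $ i = b" and b: "1 < l $ j + 2 * b"
  shows "F0 j x = (if l $ j + b = 1 then \<Sum>i\<in>UNIV. hess c j i * x $ i else 0)"
proof -
  let ?A = "{a. diff_coeff j c a \<noteq> 0 \<and> weighted_degree l a = 1 - l $ j}"
  let ?g = "\<lambda>a. diff_coeff j c a * monomial a x"
  have key: "\<exists>i. a = unit_idx i \<and> l $ i = b \<and> l $ j + b = 1" if a: "a \<in> ?A" "?g a \<noteq> 0" for a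
  proof -
    have supp: "l $ i = b" if "a i \<noteq> 0" for i
    proof -
      have "(x $ i) ^ a i \<noteq> 0" using a(2) unfolding monomial_def by (auto simp: prod_zero_iff)
      then show ?thesis using that x by (simp add: zero_power)
    qed
    have "weighted_degree l a = real (\<Sum>i\<in>UNIV. a i) * b" by (rule weighted_degree_const[OF supp])
    then have w: "real (\<Sum>i\<in>UNIV. a i) * b = 1 - l $ j" using a by simp
    have "l $ j < 1" by (rule l1)
    have s0: "(\<Sum>i\<in>UNIV. a i) \<noteq> 0"
    proof
      assume z: "(\<Sum>i\<in>UNIV. a i) = 0"
      have "real 0 * b = 1 - l $ j" using w unfolding z .
      with \<open>l $ j < 1\<close> show False by simp
    qed
    then obtain i where i: "a i \<noteq> 0" by (meson sum.neutral)
    have b0: "b > 0" using supp[OF i] lpos by metis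
    have "real (\<Sum>i\<in>UNIV. a i) * b < 2 * b" using w b by linarith
    then have "(\<Sum>i\<in>UNIV. a i) < 2" using b0 by (simp only: mult_less_cancel_right_pos)
    with s0 have s1: "(\<Sum>i\<in>UNIV. a i) = 1" by linarith
    obtain i' where "a = unit_idx i'" by (rule sum_eq_1_unit_idx[OF s1])
    moreover from this have "l $ i' = b" by (intro supp) (simp add: unit_idx_def)
    moreover have "l $ j + b = 1" using w s1 by simp
    ultimately show ?thesis by blast
  qed
  show ?thesis
  proof (cases "l $ j + b = 1")
    case False
    then have "F0 j x = 0" unfolding F0_def using key by (intro sum.neutral) blast
    then show ?thesis using False by simp
  next
    case True
    have "F0 j x = (\<Sum>a\<in>?A \<inter> range unit_idx. ?g a)"
      unfolding F0_def
    proof (rule sum.mono_neutral_right)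
      show "\<forall>a\<in>?A - ?A \<inter> range unit_idx. ?g a = 0" using key by blast
    qed (auto simp: finite_degree_eq)
    also have "\<dots> = (\<Sum>a\<in>range unit_idx. ?g a)"
    proof (rule sum.mono_neutral_left)
      show "\<forall>a\<in>range unit_idx - ?A \<inter> range unit_idx. ?g a = 0"
      proof
        fix a assume a: "a \<in> range unit_idx - ?A \<inter> range unit_idx"
        then obtain i where i: "a = unit_idx i" by auto
        show "?g a = 0"
        proof (cases "diff_coeff j c a = 0")
          case False
          then have "l $ i \<noteq> b" using a True by (auto simp: i weighted_degree_unit_idx)
          then show ?thesis using x[of i] by (auto simp: i monomial_unit_idx)
        qed simp
      qed
    qed auto
    also have "\<dots> = (\<Sum>i\<in>UNIV. hess c j i * x $ i)"
      by (simp add: sum.reindex[OF inj_unit_idx] hess_def monomial_unit_idx)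
    finally show ?thesis using True by simp
  qed
qed

end

section \<open>Matched weights and the upper bound\<close>

text \<open>Complete the independent rows by unit vectors to an invertible matrix; a nonvanishing term of the Leibniz
  expansion of its determinant is the injection \<open>p\<close>.\<close>

lemma matching_minor:
  fixes A :: "'n::finite \<Rightarrow> 'n \<Rightarrow> complex"
  assumes indep: "\<And>y :: complex ^ 'n. (\<And>i. i \<notin> V \<Longrightarrow> y $ i = 0) \<Longrightarrow> (\<And>j. (\<Sum>i\<in>UNIV. y $ i * A i j) = 0) \<Longrightarrow> y = 0"
  obtains p :: "'n \<Rightarrow> 'n" where "inj p" "\<And>v. v \<in> V \<Longrightarrow> A v (p v) \<noteq> 0"
    "\<And>x :: complex ^ 'n. (\<And>i. i \<notin> p ` V \<Longrightarrow> x $ i = 0) \<Longrightarrow> (\<And>v. v \<in> V \<Longrightarrow> (\<Sum>i\<in>UNIV. A v i * x $ i) = 0) \<Longrightarrow> x = 0"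
    "\<And>y :: complex ^ 'n. (\<And>i. i \<notin> V \<Longrightarrow> y $ i = 0) \<Longrightarrow> (\<And>u. u \<in> p ` V \<Longrightarrow> (\<Sum>i\<in>UNIV. y $ i * A i u) = 0) \<Longrightarrow> y = 0"
    "\<And>k. k \<notin> p ` V \<Longrightarrow> \<exists>x :: complex ^ 'n. x $ k = 1 \<and> (\<forall>i. i \<notin> p ` V \<longrightarrow> i \<noteq> k \<longrightarrow> x $ i = 0) \<and>
        (\<forall>v\<in>V. (\<Sum>i\<in>UNIV. A v i * x $ i) = 0)"
proof -
  define row where "row v = (\<chi> j. A v j)" for v
  have inj: "inj_on row V"
  proof (rule inj_onI)
    fix v w assume v: "v \<in> V" "w \<in> V" "row v = row w"
    show "v = w"
    proof (rule ccontr)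
      assume ne: "v \<noteq> w"
      define y :: "complex ^ 'n" where "y = axis v 1 - axis w 1"
      have "(\<Sum>i\<in>UNIV. y $ i * A i j) = A v j - A w j" for j
        by (simp add: y_def left_diff_distrib sum_subtractf axis_def if_distrib[of "\<lambda>x. x * _"] cong: if_cong)
      moreover have "A v j = A w j" for j using v(3) by (simp add: row_def vec_eq_iff)
      ultimately have "y = 0" using v by (intro indep) (auto simp: y_def axis_def)
      then have "y $ v = 0" by simp
      then show False using ne by (simp add: y_def axis_def)
    qed
  qed
  define S where "S = row ` V"
  have indS: "vec.independent S"
  proof (rule vec.independent_if_scalars_zero)
    fix g x assume s: "(\<Sum>x\<in>S. g x *s x) = 0" and x: "x \<in> S"
    define y :: "complex ^ 'n" where "y = (\<chi> v. if v \<in> V then g (row v) else 0)"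
    have "(\<Sum>v\<in>V. g (row v) *s row v) = 0" using s unfolding S_def by (simp add: sum.reindex[OF inj])
    then have z: "(\<Sum>v\<in>V. g (row v) *s row v) $ j = 0" for j by simp
    have "(\<Sum>i\<in>UNIV. y $ i * A i j) = (\<Sum>v\<in>V. g (row v) * A v j)" for j
      unfolding y_def by (rule sum.mono_neutral_cong_right) auto
    also have "\<dots> j = 0" for j using z[of j] by (simp add: row_def)
    finally have "y = 0" by (intro indep) (auto simp: y_def)
    obtain v where v: "v \<in> V" "x = row v" using x by (auto simp: S_def)
    have "y $ v = 0" using \<open>y = 0\<close> by simp
    then show "g x = 0" using v by (simp add: y_def)
  qed (simp add: S_def)
  obtain B where B: "S \<subseteq> B" "B \<subseteq> S \<union> cart_basis" "vec.independent B" "S \<union> cart_basis \<subseteq> vec.span B"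
    using vec.maximal_independent_subset_extend[of S "S \<union> cart_basis"] indS by blast
  have spB: "vec.span B = UNIV"
  proof -
    have "vec.span cart_basis \<subseteq> vec.span B" using B(4) by (intro vec.span_minimal vec.subspace_span) auto
    then show ?thesis by auto
  qed
  have cB: "card B = CARD('n)"
    using vec.basis_card_eq_dim[of B UNIV] B(3) spB vec_dim_card[where 'a=complex and 'n='n] by simp
  have fB: "finite B" using B(3) by (rule vec.finiteI_independent)
  define R where "R = {i. axis i (1::complex) \<in> B - S}"
  have axinj: "inj_on (\<lambda>i. axis i (1::complex)) X" for X :: "'n set" by (auto simp: inj_on_def axis_eq_axis)
  have BS: "B - S = (\<lambda>i. axis i 1) ` R" using B(2) by (auto simp: R_def cart_basis_def)
  have "card (B - S) = CARD('n) - card V"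
    using card_Diff_subset[of S B] B(1) fB cB card_image[OF inj] by (simp add: S_def finite_subset)
  then have "card R = card (-V)" unfolding BS by (simp add: card_image[OF axinj] card_Diff_subset Compl_eq_Diff_UNIV)
  then obtain \<beta> where beta: "bij_betw \<beta> (-V) R" using finite_same_card_bij[of "-V" R] by auto
  define M :: "complex ^ 'n ^ 'n" where "M = (\<chi> i. if i \<in> V then row i else axis (\<beta> i) 1)"
  have "range (\<lambda>i. M $ i) = row ` V \<union> (\<lambda>i. axis (\<beta> i) 1) ` (-V)" by (auto simp: M_def)
  also have "(\<lambda>i. axis (\<beta> i) (1::complex)) ` (-V) = (\<lambda>i. axis i 1) ` R"
    using beta by (auto simp: bij_betw_def)
  finally have "range (\<lambda>i. M $ i) = B" using BS B(1) by (auto simp: S_def)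
  moreover have "rows M = range (\<lambda>i. M $ i)" by (auto simp: rows_def Finite_Cartesian_Product.row_def)
  ultimately have "vec.span (rows M) = UNIV" using spB by simp
  then obtain M' where M'M: "M' ** M = mat 1" using matrix_left_invertible_span_rows_gen by blast
  then have MM': "M ** M' = mat 1" by (simp add: matrix_left_right_inverse)
  have "invertible M" unfolding invertible_def using M'M MM' by blast
  then have "det M \<noteq> 0" by (simp add: invertible_det_nz)
  then obtain p where p: "p permutes UNIV" "(\<Prod>i\<in>UNIV. M $ i $ p i) \<noteq> 0"
    unfolding det_def by (metis (no_types, lifting) mem_Collect_eq mult_zero_right sum.neutral)
  have pM: "M $ i $ p i \<noteq> 0" for i using p(2) by (metis UNIV_I finite prod_zero_iff)
  have bp: "bij p" using p(1) by (rule permutes_bij)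
  have pb: "p i = \<beta> i" if "i \<notin> V" for i using pM[of i] that by (auto simp: M_def axis_def split: if_splits)
  have pR: "p ` (-V) = R" using beta pb by (auto simp: bij_betw_def)
  have U: "- (p ` V) = R" unfolding pR[symmetric] using bp by (simp add: bij_image_Compl_eq)
  have Mx: "(M *v x) $ i = (if i \<in> V then \<Sum>j\<in>UNIV. A i j * x $ j else x $ \<beta> i)" for x i
    by (simp add: M_def matrix_vector_mult_def row_def axis_def if_distrib[of "\<lambda>x. x * _"] cong: if_cong)
  show thesis
  proof (rule that)
    show "inj p" using bp by (rule bij_is_inj)
    show "A v (p v) \<noteq> 0" if "v \<in> V" for v using pM[of v] that by (simp add: M_def row_def)
    show "x = 0" if "\<And>i. i \<notin> p ` V \<Longrightarrow> x $ i = 0" "\<And>v. v \<in> V \<Longrightarrow> (\<Sum>i\<in>UNIV. A v i * x $ i) = 0" for x :: "complex ^ 'n"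
    proof -
      have "x $ \<beta> i = 0" if "i \<notin> V" for i
        by (rule \<open>\<And>i. i \<notin> p ` V \<Longrightarrow> x $ i = 0\<close>) (use that bp pb in \<open>metis bij_is_inj inj_image_mem_iff\<close>)
      then have "M *v x = 0" using that(2) by (simp add: vec_eq_iff Mx)
      then have "M' *v (M *v x) = 0" by simp
      then show ?thesis by (simp add: matrix_vector_mul_assoc M'M)
    qed
    show "y = 0" if y: "\<And>i. i \<notin> V \<Longrightarrow> y $ i = 0" and u: "\<And>u. u \<in> p ` V \<Longrightarrow> (\<Sum>i\<in>UNIV. y $ i * A i u) = 0" for y :: "complex ^ 'n"
    proof -
      define w where "w j = (\<Sum>i\<in>UNIV. y $ i * A i j)" for j
      \<comment> \<open>An extension of y to a left null vector of M: on the completing unit rows it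
        takes the values that cancel the remaining columns.\<close>
      define y' :: "complex ^ 'n" where "y' = (\<chi> i. if i \<in> V then y $ i else - w (\<beta> i))"
      have "(transpose M *v y') $ j = 0" for j
      proof -
        have "(transpose M *v y') $ j = (\<Sum>i\<in>UNIV. M $ i $ j * y' $ i)"
          by (simp add: matrix_vector_mult_def transpose_def)
        also have "\<dots> = (\<Sum>i\<in>V. M $ i $ j * y' $ i) + (\<Sum>i\<in>-V. M $ i $ j * y' $ i)"
          by (metis (no_types) Compl_partition Compl_disjoint finite sum.union_disjoint)
        also have "(\<Sum>i\<in>V. M $ i $ j * y' $ i) = (\<Sum>i\<in>V. y $ i * A i j)"
          by (intro sum.cong) (auto simp: M_def y'_def row_def)
        also have "\<dots> = w j" unfolding w_def using y by (intro sum.mono_neutral_left) auto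
        also have "(\<Sum>i\<in>-V. M $ i $ j * y' $ i) = (\<Sum>i\<in>-V. (\<lambda>b. if b = j then - w b else 0) (\<beta> i))"
          by (intro sum.cong) (auto simp: M_def y'_def axis_def)
        also have "\<dots> = (\<Sum>b\<in>R. if b = j then - w b else 0)"
          by (rule sum.reindex_bij_betw[OF beta])
        also have "\<dots> = (if j \<in> R then - w j else 0)" by (simp add: sum.delta)
        also have "w j + (if j \<in> R then - w j else 0) = 0" using u[of j] U by (auto simp: w_def)
        finally show ?thesis .
      qed
      then have "transpose M *v y' = 0" by (simp add: vec_eq_iff)
      moreover have "transpose M' ** transpose M = mat 1"
        by (simp add: matrix_transpose_mul[symmetric] MM' transpose_mat)
      ultimately have "y' = 0"
        by (metis matrix_vector_mul_assoc matrix_vector_mul_lid matrix_vector_mult_0_right)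
      then have "y $ i = 0" for i using y[of i] by (cases "i \<in> V") (auto simp: y'_def vec_eq_iff dest: spec[of _ i])
      then show ?thesis by (simp add: vec_eq_iff)
    qed
    show "\<exists>x :: complex ^ 'n. x $ k = 1 \<and> (\<forall>i. i \<notin> p ` V \<longrightarrow> i \<noteq> k \<longrightarrow> x $ i = 0) \<and>
        (\<forall>v\<in>V. (\<Sum>i\<in>UNIV. A v i * x $ i) = 0)" if k: "k \<notin> p ` V" for k
    proof -
      define b :: "complex ^ 'n" where "b = (\<chi> i. if i \<notin> V \<and> \<beta> i = k then 1 else 0)"
      define x where "x = M' *v b"
      have "M *v x = b" by (simp add: x_def matrix_vector_mul_assoc MM')
      then have bi: "(if i \<in> V then \<Sum>j\<in>UNIV. A i j * x $ j else x $ \<beta> i) = b $ i" for i using Mx[of x i] by simp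
      have xr: "x $ i = (if i = k then 1 else 0)" if "i \<notin> p ` V" for i
      proof -
        have "i \<in> \<beta> ` (-V)" using that U beta by (auto simp: bij_betw_def)
        then obtain j where "j \<notin> V" "i = \<beta> j" by auto
        then show ?thesis using bi[of j] by (auto simp: b_def)
      qed
      have "(\<Sum>i\<in>UNIV. A v i * x $ i) = 0" if "v \<in> V" for v using bi[of v] that by (simp add: b_def)
      then show ?thesis using xr k by (intro exI[of _ x]) auto
    qed
  qed
qed

context positive_weights
begin

definition V :: "'n set" where "V = {i. l $ i > 1/2}"
text \<open>The Hessian at 0 of the principal part: a product of two variables has degree 1 exactly
  when their weights add up to 1.\<close>

definition H0 :: "'n \<Rightarrow> 'n \<Rightarrow> complex" where "H0 j i = (if l $ i + l $ j = 1 then hess c j i else 0)"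

lemma H0_sym: "H0 j i = H0 i j"
  by (auto simp: H0_def hess_sym[of c j i])

text \<open>The part x of y in one weight a > 1/2 is a null vector by itself, because a row of H0
  meets a single weight. By \<open>F0_pure\<close> the partial derivatives of the principal part at
  x are these same linear forms, so a nonzero x would be a second zero of its gradient.\<close>

lemma rows_indep:
  fixes y :: "complex ^ 'n"
  assumes y: "\<And>i. i \<notin> V \<Longrightarrow> y $ i = 0" and z: "\<And>j. (\<Sum>i\<in>UNIV. y $ i * H0 i j) = 0"
  shows "y = 0"
proof (rule ccontr)
  assume "y \<noteq> 0"
  then obtain i0 where i0: "y $ i0 \<noteq> 0" by (auto simp: vec_eq_iff)
  define a where "a = l $ i0"
  have a: "a > 1/2" using y i0 by (auto simp: a_def V_def)
  define x :: "complex ^ 'n" where "x = (\<chi> i. if l $ i = a then y $ i else 0)"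
  have "F0 j x = 0" for j
  proof -
    have "F0 j x = (if l $ j + a = 1 then \<Sum>i\<in>UNIV. hess c j i * x $ i else 0)"
      by (rule F0_pure) (use a lpos[of j] in \<open>auto simp: x_def split: if_splits\<close>)
    also have "\<dots> = 0"
    proof (cases "l $ j + a = 1")
      case True
      have "(\<Sum>i\<in>UNIV. hess c j i * x $ i) = (\<Sum>i\<in>UNIV. y $ i * H0 i j)"
      proof (rule sum.cong)
        fix i show "hess c j i * x $ i = y $ i * H0 i j"
          using True unfolding H0_sym[of i j] by (auto simp: x_def H0_def)
      qed simp
      then show ?thesis using z by simp
    qed simp
    finally show ?thesis .
  qed
  then have "x = 0" by (rule iso0)
  then have "x $ i0 = 0" by simp
  then show False using i0 by (simp add: x_def a_def)
qed

end

locale matched_weights = positive_weights l c f r for l :: "real ^ 'n::finite" and c f r +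
  fixes p :: "'n \<Rightarrow> 'n"
  assumes inj_p: "inj p" and l_p: "\<And>v. v \<in> V \<Longrightarrow> l $ p v = 1 - l $ v"
    and minor_injective: "\<And>x :: complex ^ 'n. (\<And>i. i \<notin> p ` V \<Longrightarrow> x $ i = 0) \<Longrightarrow> (\<And>v. v \<in> V \<Longrightarrow> (\<Sum>i\<in>UNIV. H0 v i * x $ i) = 0) \<Longrightarrow> x = 0"
    and minor_injective_left: "\<And>y :: complex ^ 'n. (\<And>i. i \<notin> V \<Longrightarrow> y $ i = 0) \<Longrightarrow> (\<And>u. u \<in> p ` V \<Longrightarrow> (\<Sum>i\<in>UNIV. y $ i * H0 i u) = 0) \<Longrightarrow> y = 0"
    and minor_lift: "\<And>k. k \<notin> p ` V \<Longrightarrow> \<exists>x :: complex ^ 'n. x $ k = 1 \<and> (\<forall>i. i \<notin> p ` V \<longrightarrow> i \<noteq> k \<longrightarrow> x $ i = 0) \<and>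
        (\<forall>v\<in>V. (\<Sum>i\<in>UNIV. H0 v i * x $ i) = 0)"

lemma (in positive_weights) matched: "\<exists>p. matched_weights l c f r p"
proof (rule matching_minor[of V H0])
  show "y = 0" if "\<And>i. i \<notin> V \<Longrightarrow> y $ i = 0" "\<And>j. (\<Sum>i\<in>UNIV. y $ i * H0 i j) = 0" for y :: "complex ^ 'n"
    using that by (rule rows_indep)
  fix p :: "'n \<Rightarrow> 'n"
  assume p: "inj p" "\<And>v. v \<in> V \<Longrightarrow> H0 v (p v) \<noteq> 0"
    "\<And>x :: complex ^ 'n. (\<And>i. i \<notin> p ` V \<Longrightarrow> x $ i = 0) \<Longrightarrow> (\<And>v. v \<in> V \<Longrightarrow> (\<Sum>i\<in>UNIV. H0 v i * x $ i) = 0) \<Longrightarrow> x = 0"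
    "\<And>y :: complex ^ 'n. (\<And>i. i \<notin> V \<Longrightarrow> y $ i = 0) \<Longrightarrow> (\<And>u. u \<in> p ` V \<Longrightarrow> (\<Sum>i\<in>UNIV. y $ i * H0 i u) = 0) \<Longrightarrow> y = 0"
    "\<And>k. k \<notin> p ` V \<Longrightarrow> \<exists>x :: complex ^ 'n. x $ k = 1 \<and> (\<forall>i. i \<notin> p ` V \<longrightarrow> i \<noteq> k \<longrightarrow> x $ i = 0) \<and>
        (\<forall>v\<in>V. (\<Sum>i\<in>UNIV. H0 v i * x $ i) = 0)"
  have "l $ p v = 1 - l $ v" if "v \<in> V" for v
    using p(2)[OF that] by (auto simp: H0_def split: if_splits)
  note lp = this
  have "matched_weights l c f r p"
    by unfold_locales (fact p(1), fact lp, fact p(3), fact p(4), fact p(5))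
  then show ?thesis by blast
qed

context matched_weights
begin

lemma reduced_eq: "reduced_weights l = (\<lambda>i. l $ i) ` (- p ` V) \<union> {1/2}"
proof -
  have "reflected_weights (weights l) = {# 1 - l $ i. i \<in># mset_set V #}"
    unfolding reflected_weights_def weights_def
    by (simp add: filter_mset_image_mset V_def image_mset.compositionality comp_def filter_mset_mset_set)
  also have "\<dots> = {# l $ p i. i \<in># mset_set V #}"
    by (intro image_mset_cong) (simp add: l_p)
  also have "\<dots> = {# l $ i. i \<in># image_mset p (mset_set V) #}"
    by (simp add: image_mset.compositionality comp_def)
  also have "image_mset p (mset_set V) = mset_set (p ` V)"
    using inj_p by (intro image_mset_mset_set) (auto intro: inj_on_subset)
  finally have refl: "reflected_weights (weights l) = {# l $ i. i \<in># mset_set (p ` V) #}" .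
  have "mset_set (UNIV :: 'n set) = mset_set (- p ` V) + mset_set (p ` V)"
    by (subst mset_set_Union[symmetric]) (auto simp: Compl_partition2)
  then have "weights l = {# l $ i. i \<in># mset_set (- p ` V) #} + {# l $ i. i \<in># mset_set (p ` V) #}"
    unfolding weights_def by simp
  then have "weights l - reflected_weights (weights l) = {# l $ i. i \<in># mset_set (- p ` V) #}"
    unfolding refl by simp
  then show ?thesis by (simp add: reduced_weights_def)
qed

definition "m = l_min l"

lemma finite_reduced: "finite (reduced_weights l)" by (simp add: reduced_eq)

lemma m_le: "m \<le> 1/2" "i \<notin> p ` V \<Longrightarrow> m \<le> l $ i"
  unfolding m_def l_min_def by (intro Min_le finite_reduced, simp add: reduced_eq)+

lemma m_cases: "m = 1/2 \<or> (\<exists>k. k \<notin> p ` V \<and> l $ k = m)"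
proof -
  have "m \<in> reduced_weights l" unfolding m_def l_min_def by (rule Min_in[OF finite_reduced]) (simp add: reduced_eq)
  then show ?thesis by (auto simp: reduced_eq)
qed

lemma m_pos: "m > 0" using m_cases lpos by (metis half_gt_zero zero_less_one)

definition T :: "'n set" where "T = V \<union> p ` V"

text \<open>Block triangularity. If a is the largest weight in the support of x, a row of weight 1 -
  a sees only the part of weight a, since entries for smaller weights vanish. On this part the
  Hessian agrees with H0, and the minor is injective from the left if a > 1/2 and from the right
  otherwise.\<close>

lemma hess_T_injective:
  fixes x :: "complex ^ 'n"
  assumes x: "\<And>i. i \<notin> T \<Longrightarrow> x $ i = 0" and z: "\<And>t. t \<in> T \<Longrightarrow> (\<Sum>i\<in>UNIV. hess c t i * x $ i) = 0"
  shows "x = 0"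
proof (rule ccontr)
  assume "x \<noteq> 0"
  then have ne: "{i. x $ i \<noteq> 0} \<noteq> {}" by (auto simp: vec_eq_iff)
  define a where "a = Max ((\<lambda>i. l $ i) ` {i. x $ i \<noteq> 0})"
  have "a \<in> (\<lambda>i. l $ i) ` {i. x $ i \<noteq> 0}" unfolding a_def using ne by (intro Max_in) auto
  then obtain i0 where i0: "x $ i0 \<noteq> 0" "l $ i0 = a" by auto
  have amax: "l $ i \<le> a" if "x $ i \<noteq> 0" for i unfolding a_def using that by (intro Max_ge) auto
  define y :: "complex ^ 'n" where "y = (\<chi> i. if l $ i = a then x $ i else 0)"
  have y0: "y $ i0 \<noteq> 0" using i0 by (simp add: y_def)
  have zy: "(\<Sum>i\<in>UNIV. H0 t i * y $ i) = 0" if t: "t \<in> T" for t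
  proof (cases "l $ t + a = 1")
    case True
    have "(\<Sum>i\<in>UNIV. H0 t i * y $ i) = (\<Sum>i\<in>UNIV. hess c t i * x $ i)"
    proof (rule sum.cong)
      fix i
      show "H0 t i * y $ i = hess c t i * x $ i"
      proof (cases "l $ i = a")
        case False
        have "hess c t i * x $ i = 0"
          using hess_nz[of t i] amax[of i] True False by force
        then show ?thesis using False by (simp add: y_def)
      qed (use True in \<open>simp add: H0_def y_def\<close>)
    qed simp
    then show ?thesis using z[OF t] by simp
  next
    case False
    then show ?thesis by (intro sum.neutral) (auto simp: H0_def y_def)
  qed
  have "y = 0"
  proof (cases "a > 1/2")
    case True
    show ?thesis
    proof (rule minor_injective_left)
      show "y $ i = 0" if "i \<notin> V" for i using that True by (auto simp: y_def V_def)
      show "(\<Sum>i\<in>UNIV. y $ i * H0 i u) = 0" if "u \<in> p ` V" for u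
        using zy[of u] that by (simp add: T_def H0_sym[of _ u] mult.commute)
    qed
  next
    case False
    show ?thesis
    proof (rule minor_injective)
      show "y $ i = 0" if "i \<notin> p ` V" for i using that False x[of i] by (auto simp: y_def T_def V_def)
      show "(\<Sum>i\<in>UNIV. H0 v i * y $ i) = 0" if "v \<in> V" for v using zy[of v] that by (simp add: T_def)
    qed
  qed
  with y0 show False by simp
qed

lemma F_at_0: "F j 0 = 0"
proof -
  have "F j 0 = c (unit_idx j)" unfolding F_def by (rule gradient_at_0[OF ex])
  also have "\<dots> = 0" using deg[of "unit_idx j"] l1[of j] by (force simp: weighted_degree_unit_idx)
  finally show ?thesis .
qed

lemma F_strict:
  assumes "0 < \<eta>"
  obtains \<delta> where "0 < \<delta>" "\<And>j x y. norm x \<le> \<delta> \<Longrightarrow> norm y \<le> \<delta> \<Longrightarrow>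
     norm (F j x - F j y - (\<Sum>i\<in>UNIV. hess c j i * (x - y) $ i)) \<le> \<eta> * norm (x - y)"
  using gradient_strict_derivative[OF ex assms] unfolding F_def by metis

lemma F_lipschitz:
  obtains B \<delta> where "0 < B" "0 < \<delta>" "\<And>j x y. norm x \<le> \<delta> \<Longrightarrow> norm y \<le> \<delta> \<Longrightarrow> norm (F j x - F j y) \<le> B * norm (x - y)"
  using gradient_lipschitz[OF ex] unfolding F_def by metis

lemma norm_F_le: "norm (F j z) \<le> norm (gradient f z)"
  unfolding F_def by (rule norm_nth_le_norm)

text \<open>Moving z to y = z + x inside T annihilates the partial derivatives of T at a cost linear
  in the gradient at z. Hence the large component promised by \<open>F_lower\<close> at y has an
  index outside T, where weights are at least m, and this controls rho of y. Outside T the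
  coordinates of z and y agree; those in T come back from the invertible Hessian block.\<close>

lemma upper_bound:
  obtains C d where "0 < C" "0 < d" "\<And>z. norm z < d \<Longrightarrow> C * norm z powr (1/m - 1) \<le> norm (gradient f z)"
proof -
  let ?n = "real CARD('n)"
  \<comment> \<open>The unit rows outside T force the Newton correction to be supported in
    T.\<close>
  define N :: "complex ^ 'n ^ 'n" where "N = (\<chi> t. if t \<in> T then (\<chi> i. hess c t i) else axis t 1)"
  have Nx: "(N *v x) $ t = (if t \<in> T then \<Sum>i\<in>UNIV. hess c t i * x $ i else x $ t)" for x t
    by (simp add: N_def matrix_vector_mult_def axis_def if_distrib[of "\<lambda>x. x * _"] cong: if_cong)
  have ker: "x = 0" if "N *v x = 0" for x
  proof (rule hess_T_injective)
    show "x $ i = 0" if "i \<notin> T" for i using Nx[of x i] that \<open>N *v x = 0\<close> by simp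
    show "(\<Sum>i\<in>UNIV. hess c t i * x $ i) = 0" if "t \<in> T" for t using Nx[of x t] that \<open>N *v x = 0\<close> by simp
  qed
  obtain \<mu> where mu: "0 < \<mu>" "\<And>x. \<mu> * norm x \<le> norm (N *v x)" using invertible_bounded_below[OF ker] by blast
  \<comment> \<open>The factor 1/(2n) turns a componentwise error into \<mu>/2 for the norm, half of
    what N controls; the same half is absorbed at the end of the estimate.\<close>
  obtain \<delta>1 where d1: "0 < \<delta>1" "\<And>j x y. norm x \<le> \<delta>1 \<Longrightarrow> norm y \<le> \<delta>1 \<Longrightarrow>
     norm (F j x - F j y - (\<Sum>i\<in>UNIV. hess c j i * (x - y) $ i)) \<le> (\<mu> / (2 * ?n)) * norm (x - y)"
    using F_strict[of "\<mu> / (2 * ?n)"] mu by auto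
  obtain B \<delta>2 where B: "0 < B" "0 < \<delta>2" "\<And>j x y. norm x \<le> \<delta>2 \<Longrightarrow> norm y \<le> \<delta>2 \<Longrightarrow> norm (F j x - F j y) \<le> B * norm (x - y)"
    using F_lipschitz by blast
  obtain c0 \<mu>0 where c0: "0 < c0" "0 < \<mu>0" "\<mu>0 \<le> 1"
    "\<And>z. z \<noteq> 0 \<Longrightarrow> rho l z \<le> \<mu>0 \<Longrightarrow> \<exists>i. c0 * rho l z powr (1 - l $ i) \<le> norm (F i z)"
    using F_lower by blast
  define \<delta> where "\<delta> = min (min \<delta>1 \<delta>2) \<mu>0"
  have del: "0 < \<delta>" "\<delta> \<le> \<delta>1" "\<delta> \<le> \<delta>2" "\<delta> \<le> \<mu>0" using d1 B c0 by (auto simp: \<delta>_def)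
  define G where "G z = norm (gradient f z)" for z
  have GB: "G z \<le> ?n * B * norm z" if "norm z \<le> \<delta>" for z
  proof -
    have "norm (gradient f z $ i) \<le> B * norm z" for i
      using B(3)[of z 0 i] that del F_at_0[of i] by (simp add: F_def)
    from norm_le_card_nth[OF this] show ?thesis by (simp add: G_def mult.assoc)
  qed
  define q where "q = 1/m - 1"
  have q1: "q \<ge> 1" using m_le(1) m_pos by (simp add: q_def field_simps)
  have mq: "1 - m = m * q" using m_pos by (simp add: q_def field_simps)
  define C1 where "C1 = (1 + 2 * B / \<mu>) / c0"
  have C1: "C1 > 0" using B mu c0 by (auto simp: C1_def intro!: divide_pos_pos add_pos_pos)
  define C2 where "C2 = (2 / \<mu>) * (?n + ?n * C1 powr (1/q))"
  have C2: "C2 > 0" using mu C1 unfolding C2_def by (intro mult_pos_pos add_pos_nonneg) auto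
  \<comment> \<open>The three bounds keep z within \<delta>/2, make G small enough to start the
    iteration on the ball of radius \<delta>/2, and give G <= 1.\<close>
  define d where "d = min (\<delta> / 2) (min (\<mu> * \<delta> / (4 * ?n * B)) (1 / (?n * B)))"
  have dpos: "d > 0" using del mu B by (auto simp: d_def intro!: divide_pos_pos mult_pos_pos)
  have main: "norm z \<le> C2 * G z powr (1/q)" if z: "norm z < d" for z
  proof -
    have zd: "norm z \<le> \<delta> / 2" "norm z \<le> \<mu> * \<delta> / (4 * ?n * B)" "norm z \<le> 1 / (?n * B)" using z by (auto simp: d_def)
    have zdel: "norm z \<le> \<delta>" using zd del by simp
    have nB: "?n * B > 0" using B by simp
    have G1: "G z \<le> 1"
    proof -
      have "G z \<le> ?n * B * (1 / (?n * B))" using GB[OF zdel] mult_left_mono[OF zd(3), of "?n * B"] nB by linarith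
      then show ?thesis using nB B by simp
    qed
    have G2: "G z \<le> \<mu> / 2 * (\<delta> / 2)"
    proof -
      have "G z \<le> ?n * B * (\<mu> * \<delta> / (4 * ?n * B))" using GB[OF zdel] mult_left_mono[OF zd(2), of "?n * B"] nB by linarith
      also have "\<dots> = \<mu> / 2 * (\<delta> / 2)" using B by (simp add: field_simps)
      finally show ?thesis .
    qed
    have G0: "G z \<ge> 0" by (simp add: G_def)
    define g where "g x = (\<chi> t. if t \<in> T then F t (z + x) else x $ t)" for x
    have g0: "norm (g 0) \<le> G z"
      unfolding G_def g_def by (rule norm_le_componentwise_cart) (auto simp: F_def)
    obtain x where x: "norm x \<le> 2 / \<mu> * norm (g 0)" "g x = 0"
    proof (rule newton_zero[OF mu, of "\<delta> / 2" g])
      fix x y :: "complex ^ 'n" assume xy: "norm x \<le> \<delta> / 2" "norm y \<le> \<delta> / 2"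
      have n: "norm (z + x) \<le> \<delta>1" "norm (z + y) \<le> \<delta>1"
        using norm_triangle_ineq[of z x] norm_triangle_ineq[of z y] xy zd(1) del by linarith+
      have "norm ((g x - g y - N *v (x - y)) $ t) \<le> (\<mu> / (2 * ?n)) * norm (x - y)" for t
      proof (cases "t \<in> T")
        case True
        then show ?thesis using d1(2)[OF n, of t] unfolding vector_minus_component Nx by (simp add: g_def)
      next
        case False
        then show ?thesis using mu unfolding vector_minus_component Nx by (simp add: g_def)
      qed
      from norm_le_card_nth[OF this] show "norm (g x - g y - N *v (x - y)) \<le> \<mu> / 2 * norm (x - y)" by simp
    next
      show "norm (g 0) \<le> \<mu> / 2 * (\<delta> / 2)" using g0 G2 by linarith
    qed
    have xG: "norm x \<le> 2 / \<mu> * G z"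
      using x(1) g0 mu mult_left_mono[of "norm (g 0)" "G z" "2 / \<mu>"] by simp
    define y where "y = z + x"
    have yT: "F t y = 0" if "t \<in> T" for t
    proof -
      have "g x $ t = 0" using x(2) by simp
      then show ?thesis using that by (simp add: g_def y_def)
    qed
    have xT: "x $ i = 0" if "i \<notin> T" for i
    proof -
      have "g x $ i = 0" using x(2) by simp
      then show ?thesis using that by (simp add: g_def)
    qed
    have x2: "norm x \<le> \<delta> / 2"
    proof -
      have "2 / \<mu> * G z \<le> 2 / \<mu> * (\<mu> / 2 * (\<delta> / 2))" using G2 mu by (intro mult_left_mono) auto
      then show ?thesis using xG mu by simp
    qed
    have ydel: "norm y \<le> \<delta>" using norm_triangle_ineq[of z x] zd(1) x2 by (simp add: y_def)
    have rest: "norm (z $ i) \<le> C1 powr (1/q) * G z powr (1/q)" if i: "i \<notin> T" for i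
    proof (cases "y = 0")
      case True
      then have "z $ i = - x $ i" by (simp add: y_def eq_neg_iff_add_eq_0 flip: vector_add_component)
      then show ?thesis using xT[OF i] by simp
    next
      case False
      have "norm (y $ j) \<le> \<mu>0 powr (l $ j)" for j
      proof -
        have "norm (y $ j) \<le> \<mu>0 powr 1" using norm_nth_le_norm[of y j] ydel del c0 by simp
        also have "\<dots> \<le> \<mu>0 powr (l $ j)" using c0 l1[of j] by (intro powr_mono') auto
        finally show ?thesis .
      qed
      then have ry: "rho l y \<le> \<mu>0" using c0 by (intro rho_le) auto
      have ry0: "rho l y > 0" by (rule rho_pos[OF False])
      obtain j where j: "c0 * rho l y powr (1 - l $ j) \<le> norm (F j y)" using c0(4)[OF False ry] by blast
      have "c0 * rho l y powr (1 - l $ j) > 0" using c0 ry0 by simp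
      then have jT: "j \<notin> T" using yT[of j] j by auto
      have "norm (F j y) \<le> norm (F j z) + norm (F j y - F j z)"
        using norm_triangle_ineq[of "F j z" "F j y - F j z"] by simp
      also have "\<dots> \<le> G z + B * (2 / \<mu> * G z)"
      proof (rule add_mono)
        show "norm (F j z) \<le> G z" unfolding G_def by (rule norm_F_le)
        have "norm (F j y - F j z) \<le> B * norm x"
          using B(3)[of y z j] ydel zdel del by (simp add: y_def)
        also have "\<dots> \<le> B * (2 / \<mu> * G z)" using xG B by (intro mult_left_mono) auto
        finally show "norm (F j y - F j z) \<le> B * (2 / \<mu> * G z)" .
      qed
      also have "\<dots> = (c0 * C1) * G z"
      proof -
        have "c0 * C1 = 1 + 2 * B / \<mu>" using c0 by (simp add: C1_def)
        then show ?thesis by (simp add: algebra_simps)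
      qed
      also have "\<dots> = c0 * (C1 * G z)" by (rule mult.assoc)
      finally have "rho l y powr (1 - l $ j) \<le> C1 * G z" using j c0 by (meson mult_le_cancel_left_pos order_trans)
      moreover have "rho l y powr (1 - m) \<le> rho l y powr (1 - l $ j)"
        using jT ry c0 ry0 m_le(2)[of j] by (intro powr_mono') (auto simp: T_def)
      ultimately have rm: "rho l y powr (1 - m) \<le> C1 * G z" by linarith
      have "norm (z $ i) = norm (y $ i)" using xT[OF i] by (simp add: y_def)
      also have "\<dots> \<le> rho l y powr (l $ i)" by (rule norm_nth_le_rho)
      also have "\<dots> \<le> rho l y powr m" using i ry c0 ry0 m_le(2)[of i] by (intro powr_mono') (auto simp: T_def)
      also have "\<dots> = (rho l y powr (1 - m)) powr (1/q)" using q1 by (simp add: powr_powr mq)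
      also have "\<dots> \<le> (C1 * G z) powr (1/q)" using rm q1 by (intro powr_mono2) auto
      also have "\<dots> = C1 powr (1/q) * G z powr (1/q)" using C1 G0 by (simp add: powr_mult)
      finally show ?thesis .
    qed
    \<comment> \<open>For t in T the row is \<open>F t z\<close> up to the strict-derivative error;
      otherwise it is the coordinate z_t, estimated in \<open>rest\<close>.\<close>
    have comp: "norm ((N *v z) $ t) \<le> G z + (\<mu> / (2 * ?n)) * norm z + C1 powr (1/q) * G z powr (1/q)" for t
    proof (cases "t \<in> T")
      case True
      have "norm (F t z - F t 0 - (\<Sum>i\<in>UNIV. hess c t i * (z - 0) $ i)) \<le> (\<mu> / (2 * ?n)) * norm (z - 0)"
        using zdel del by (intro d1(2)) auto
      then have "norm (F t z - (N *v z) $ t) \<le> (\<mu> / (2 * ?n)) * norm z" using True by (simp add: Nx F_at_0)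
      moreover have "norm (F t z) \<le> G z" unfolding G_def by (rule norm_F_le)
      moreover have "norm ((N *v z) $ t) \<le> norm (F t z) + norm (F t z - (N *v z) $ t)"
        using norm_triangle_ineq4[of "F t z" "F t z - (N *v z) $ t"] by simp
      ultimately show ?thesis using powr_ge_zero by (smt (verit) mult_nonneg_nonneg)
    next
      case False
      have "(\<mu> / (2 * ?n)) * norm z \<ge> 0" using mu by simp
      then show ?thesis using rest[OF False] G0 False unfolding Nx by simp
    qed
    have GG: "G z \<le> G z powr (1/q)"
    proof (cases "G z = 0")
      case False
      then have "G z powr 1 \<le> G z powr (1/q)" using G0 G1 q1 by (intro powr_mono') auto
      then show ?thesis using G0 False by simp
    qed simp
    have "\<mu> * norm z \<le> ?n * (G z + (\<mu> / (2 * ?n)) * norm z + C1 powr (1/q) * G z powr (1/q))"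
      using mu(2)[of z] norm_le_card_nth[OF comp] by linarith
    also have "\<dots> = ?n * G z + \<mu> / 2 * norm z + ?n * C1 powr (1/q) * G z powr (1/q)" by (simp add: algebra_simps)
    finally have "\<mu> / 2 * norm z \<le> ?n * G z + ?n * C1 powr (1/q) * G z powr (1/q)" by (simp add: field_simps)
    also have "\<dots> \<le> ?n * G z powr (1/q) + ?n * C1 powr (1/q) * G z powr (1/q)" using GG by simp
    finally have "(2/\<mu>) * (\<mu> / 2 * norm z) \<le> (2/\<mu>) * (?n * G z powr (1/q) + ?n * C1 powr (1/q) * G z powr (1/q))"
      using mu by (intro mult_left_mono) auto
    then show ?thesis using mu by (simp add: C2_def algebra_simps)
  qed
  show thesis
  proof (rule that[of "1 / C2 powr q" d])
    show "0 < 1 / C2 powr q" using C2 by simp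
    fix z :: "complex ^ 'n" assume z: "norm z < d"
    have "norm z powr q \<le> (C2 * G z powr (1/q)) powr q" using main[OF z] q1 by (intro powr_mono2) auto
    also have "\<dots> = C2 powr q * G z" using C2 q1 by (simp add: powr_mult powr_powr G_def)
    finally show "1 / C2 powr q * norm z powr (1/m - 1) \<le> norm (gradient f z)"
      using C2 by (simp add: q_def[symmetric] G_def divide_le_eq mult.commute)
  qed (rule dpos)
qed

end

section \<open>Polar points and the lower bound\<close>

lemma norm_axis: "norm (axis i x :: complex ^ 'n::finite) = norm x"
proof (rule power2_eq_imp_eq)
  show "(norm (axis i x :: complex ^ 'n))\<^sup>2 = (norm x)\<^sup>2"
    unfolding norm_vec_square axis_def by (simp add: if_distrib[of norm] if_distrib[of "\<lambda>x. x\<^sup>2"] cong: if_cong)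
qed auto

text \<open>Beyond x1 the higher power wins; below x1 the left side is bounded by its value at
  x1.\<close>

lemma powr_absorb:
  assumes s: "0 < s" "s < t" and K: "0 \<le> K" and k: "0 < \<kappa>"
  obtains D where "0 \<le> D" "\<And>x::real. 0 \<le> x \<Longrightarrow> K * x powr s \<le> \<kappa> * x powr t + D"
proof -
  define x1 where "x1 = (K / \<kappa>) powr (1 / (t - s))"
  have x1: "x1 \<ge> 0" by (simp add: x1_def)
  show thesis
  proof (rule that[of "K * x1 powr s"])
    show "0 \<le> K * x1 powr s" using K by simp
    fix x :: real assume x: "0 \<le> x"
    show "K * x powr s \<le> \<kappa> * x powr t + K * x1 powr s"
    proof (cases "x \<le> x1")
      case True
      then have "K * x powr s \<le> K * x1 powr s" using x s K by (intro mult_left_mono powr_mono2) auto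
      moreover have "0 \<le> \<kappa> * x powr t" using k by simp
      ultimately show ?thesis by linarith
    next
      case False
      then have x0: "x > 0" using x1 by linarith
      have "K / \<kappa> = x1 powr (t - s)" using K k s by (simp add: x1_def powr_powr)
      also have "\<dots> \<le> x powr (t - s)" using False x1 s by (intro powr_mono2) auto
      finally have "K \<le> \<kappa> * x powr (t - s)" using k by (simp add: field_simps)
      then have "K * x powr s \<le> \<kappa> * x powr (t - s) * x powr s" by (intro mult_right_mono) auto
      also have "\<dots> = \<kappa> * x powr t" by (simp add: mult.assoc flip: powr_add)
      finally show ?thesis using K powr_ge_zero[of x1 s] by (simp add: add_increasing2)
    qed
  qed
qed

context matched_weights
begin

text \<open>The constant C precedes the barrier Mt, because in the continuation the barrier is
  computed from C and the radius R from the barrier. For z_k = 1, Euler's relation turns the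
  Legendre transform into m F0_k minus terms of size |a_i| rho^(l_i) and an error at most 1. As the
  other partial derivatives are bounded, either F0_k is of size rho^(1-m) or rho itself is bounded;
  \<open>a0\<close> makes the remaining terms of lower order.\<close>

lemma p0_estimate:
  fixes a :: "'n \<Rightarrow> complex"
  assumes k: "l $ k = m" and m2: "m < 1/2" and a0: "\<And>j. 1 - m \<le> l $ j \<Longrightarrow> a j = 0"
  obtains C where "0 \<le> C" "\<And>Mt R0. \<exists>R \<eta>. R0 < R \<and> 1 \<le> R \<and> 0 < \<eta> \<and> (\<forall>z. z $ k = 1 \<longrightarrow> (\<forall>i. i \<noteq> k \<longrightarrow> norm (z $ i) \<le> R) \<longrightarrow>
     (\<forall>j. j \<noteq> k \<longrightarrow> norm (F0 j z) \<le> 2 * norm (a j) + \<eta>) \<longrightarrow>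
     norm (\<Sum>i\<in>-{k}. z $ i * a i) \<le> C * (1 + norm (f0 z - (\<Sum>i\<in>-{k}. z $ i * F0 i z))) \<and>
     (\<forall>i. i \<noteq> k \<longrightarrow> norm (z $ i) = R \<longrightarrow> Mt \<le> norm (f0 z - (\<Sum>i\<in>-{k}. z $ i * F0 i z))))"
proof -
  let ?n = "real CARD('n)"
  let ?p0 = "\<lambda>z. f0 z - (\<Sum>i\<in>-{k}. z $ i * F0 i z)"
  obtain c0 where c0: "0 < c0" "\<And>z. z \<noteq> 0 \<Longrightarrow> \<exists>i. c0 * rho l z powr (1 - l $ i) \<le> norm (F0 i z)"
    using F0_lower by metis
  \<comment> \<open>Covers the case that the large component of \<open>F0_lower\<close> is some i
    different from k: it is at most 2 |a_i| + 1, which bounds rho.\<close>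
  define D1 where "D1 = (\<Sum>i\<in>UNIV. c0 * ((2 * norm (a i) + 1) / c0) powr ((1 - m) / (1 - l $ i)))"
  have D1: "D1 \<ge> 0" unfolding D1_def using c0 by (intro sum_nonneg) auto
  \<comment> \<open>Each of the n coordinates may consume the share \<kappa>, so that together they
    take half of the main term m c0 rho^(1-m).\<close>
  define \<kappa> where "\<kappa> = m * c0 / (2 * ?n)"
  have kap: "\<kappa> > 0" using m_pos c0 by (simp add: \<kappa>_def)
  have "\<exists>D\<ge>0. \<forall>x\<ge>0. 2 * norm (a i) * x powr (l $ i) \<le> \<kappa> * x powr (1 - m) + D" for i
  proof (cases "l $ i < 1 - m")
    case True
    show ?thesis using powr_absorb[OF lpos True _ kap, of "2 * norm (a i)"] by (metis mult_nonneg_nonneg norm_ge_zero zero_le_numeral)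
  next
    case False
    then show ?thesis using a0[of i] kap by (auto intro!: exI[of _ 0])
  qed
  then obtain D where D: "\<And>i. D i \<ge> 0" "\<And>i x. 0 \<le> x \<Longrightarrow> 2 * norm (a i) * x powr (l $ i) \<le> \<kappa> * x powr (1 - m) + D i"
    by metis
  define D2 where "D2 = (\<Sum>i\<in>UNIV. D i)"
  have D2: "D2 \<ge> 0" using D by (simp add: D2_def sum_nonneg)
  define D3 where "D3 = m * D1 + D2 + 1"
  have D3: "D3 \<ge> 0" using D1 D2 m_pos by (simp add: D3_def)
  define b where "b = m * c0 / 2"
  have b: "b > 0" using m_pos c0 by (simp add: b_def)
  have sumD: "(\<Sum>i\<in>-{k}. 2 * norm (a i) * norm (z $ i)) \<le> b * rho l z powr (1 - m) + D2" for z :: "complex ^ 'n"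
  proof -
    have "(\<Sum>i\<in>-{k}. 2 * norm (a i) * norm (z $ i)) \<le> (\<Sum>i\<in>UNIV. 2 * norm (a i) * norm (z $ i))"
      by (intro sum_mono2) auto
    also have "\<dots> \<le> (\<Sum>i\<in>UNIV. \<kappa> * rho l z powr (1 - m) + D i)"
    proof (rule sum_mono)
      fix i
      have "2 * norm (a i) * norm (z $ i) \<le> 2 * norm (a i) * rho l z powr (l $ i)"
        by (intro mult_left_mono norm_nth_le_rho) auto
      also have "\<dots> \<le> \<kappa> * rho l z powr (1 - m) + D i" by (rule D(2)[OF rho_nonneg])
      finally show "2 * norm (a i) * norm (z $ i) \<le> \<kappa> * rho l z powr (1 - m) + D i" .
    qed
    also have "\<dots> = b * rho l z powr (1 - m) + D2" by (simp add: sum.distrib D2_def \<kappa>_def b_def)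
    finally show ?thesis .
  qed
  have main: "2 * b * rho l z powr (1 - m) - m * D1 - (\<Sum>i\<in>-{k}. 2 * norm (a i) * norm (z $ i)) - 1 \<le> norm (?p0 z)"
    if z1: "z $ k = 1" and zR: "\<And>i. i \<noteq> k \<Longrightarrow> norm (z $ i) \<le> R" and R: "1 \<le> R" and eta: "\<eta> = 1 / (?n * R)"
      and Fz: "\<And>j. j \<noteq> k \<Longrightarrow> norm (F0 j z) \<le> 2 * norm (a j) + \<eta>" for z :: "complex ^ 'n" and R \<eta>
  proof -
    have n1: "?n \<ge> 1" by (simp add: Suc_leI)
    have "?n * R \<ge> 1" using mult_mono[OF n1 R] by simp
    then have eta1: "\<eta> \<le> 1" "\<eta> > 0" unfolding eta by auto
    have z0: "z \<noteq> 0" using z1 by auto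
    obtain i where i: "c0 * rho l z powr (1 - l $ i) \<le> norm (F0 i z)" using c0(2)[OF z0] by blast
    have E1: "c0 * rho l z powr (1 - m) \<le> norm (F0 k z) + D1"
    proof (cases "i = k")
      case True
      then show ?thesis using i D1 k by simp
    next
      case False
      have "c0 * rho l z powr (1 - l $ i) \<le> 2 * norm (a i) + 1" using i Fz[OF False] eta1 by linarith
      then have le: "rho l z powr (1 - l $ i) \<le> (2 * norm (a i) + 1) / c0" using c0 by (simp add: field_simps)
      have "rho l z powr (1 - m) = (rho l z powr (1 - l $ i)) powr ((1 - m) / (1 - l $ i))"
        using l1[of i] by (simp add: powr_powr)
      also have "\<dots> \<le> ((2 * norm (a i) + 1) / c0) powr ((1 - m) / (1 - l $ i))"
        using le l1[of i] m2 by (intro powr_mono2) (auto intro!: divide_nonneg_pos)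
      finally have "c0 * rho l z powr (1 - m) \<le> c0 * ((2 * norm (a i) + 1) / c0) powr ((1 - m) / (1 - l $ i))"
        using c0 by (intro mult_left_mono) auto
      also have "\<dots> \<le> D1" unfolding D1_def using c0 by (intro member_le_sum[of i UNIV "\<lambda>i. c0 * ((2 * norm (a i) + 1) / c0) powr ((1 - m) / (1 - l $ i))"]) auto
      finally show ?thesis using norm_ge_zero[of "F0 k z"] by linarith
    qed
    define s where "s = (\<Sum>i\<in>-{k}. of_real (1 - l $ i) * (z $ i * F0 i z))"
    have p0: "?p0 z = of_real m * F0 k z - s"
    proof -
      have "f0 z = of_real m * F0 k z + (\<Sum>i\<in>-{k}. of_real (l $ i) * z $ i * F0 i z)"
        unfolding euler by (subst sum.remove[of UNIV k]) (auto simp: z1 k Compl_eq_Diff_UNIV)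
      moreover have "s = (\<Sum>i\<in>-{k}. z $ i * F0 i z) - (\<Sum>i\<in>-{k}. of_real (l $ i) * z $ i * F0 i z)"
        unfolding s_def sum_subtractf[symmetric] by (intro sum.cong) (auto simp: algebra_simps)
      ultimately show ?thesis by simp
    qed
    have "norm s \<le> (\<Sum>i\<in>-{k}. 2 * norm (a i) * norm (z $ i) + \<eta> * R)"
      unfolding s_def
    proof (rule sum_norm_le)
      fix i assume "i \<in> -{k}"
      then have ik: "i \<noteq> k" by simp
      have "norm (of_real (1 - l $ i) * (z $ i * F0 i z)) = (1 - l $ i) * (norm (z $ i) * norm (F0 i z))"
        using l1[of i] by (simp add: norm_mult del: of_real_diff)
      also have "\<dots> \<le> 1 * (norm (z $ i) * norm (F0 i z))" using lpos[of i] by (intro mult_right_mono) auto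
      also have "\<dots> \<le> norm (z $ i) * (2 * norm (a i) + \<eta>)" using Fz[OF ik] by (simp add: mult_left_mono)
      also have "\<dots> \<le> 2 * norm (a i) * norm (z $ i) + \<eta> * R"
        using mult_left_mono[OF zR[OF ik], of \<eta>] eta1 by (simp add: algebra_simps)
      finally show "norm (of_real (1 - l $ i) * (z $ i * F0 i z)) \<le> 2 * norm (a i) * norm (z $ i) + \<eta> * R" .
    qed
    also have "\<dots> \<le> (\<Sum>i\<in>-{k}. 2 * norm (a i) * norm (z $ i)) + 1"
    proof -
      have "real (card (-{k})) * (\<eta> * R) \<le> ?n * (\<eta> * R)"
        using eta1 R by (intro mult_right_mono) (auto intro: card_mono)
      also have "\<dots> = 1" using R by (simp add: eta)
      finally show ?thesis by (simp add: sum.distrib)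
    qed
    finally have ns: "norm s \<le> (\<Sum>i\<in>-{k}. 2 * norm (a i) * norm (z $ i)) + 1" .
    have "norm (?p0 z) \<ge> m * norm (F0 k z) - norm s"
      unfolding p0 using norm_triangle_ineq2[of "of_real m * F0 k z" s] m_pos by (simp add: norm_mult)
    moreover have "m * norm (F0 k z) \<ge> m * (c0 * rho l z powr (1 - m) - D1)"
      using E1 m_pos by (intro mult_left_mono) auto
    ultimately show ?thesis using ns by (simp add: b_def algebra_simps)
  qed
  define C where "C = 1 + D3 + D2"
  have C: "C \<ge> 1" "C \<ge> 0" using D3 D2 by (auto simp: C_def)
  show thesis
  proof (rule that[OF C(2)])
    fix Mt R0 :: real
    \<comment> \<open>If some |z_i| = R with i different from k, then rho is at least R because R >=
      1 and 1/l_i > 1. The last entry of the maximum then makes b rho^(1-m) at least Mt +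
      D3.\<close>
    define R where "R = max (max 1 (R0 + 1)) ((max 0 (Mt + D3) / b) powr (1 / (1 - m)))"
    have R: "1 \<le> R" "R0 < R" "(max 0 (Mt + D3) / b) powr (1 / (1 - m)) \<le> R" by (auto simp: R_def)
    \<comment> \<open>The products \<eta> |z_i|, summed over the coordinates, contribute at most
      1.\<close>
    define \<eta> where "\<eta> = 1 / (?n * R)"
    have eta: "\<eta> > 0" using R by (simp add: \<eta>_def)
    have "norm (\<Sum>i\<in>-{k}. z $ i * a i) \<le> C * (1 + norm (?p0 z)) \<and> (\<forall>i. i \<noteq> k \<longrightarrow> norm (z $ i) = R \<longrightarrow> Mt \<le> norm (?p0 z))"
      if z1: "z $ k = 1" and zR: "\<And>i. i \<noteq> k \<Longrightarrow> norm (z $ i) \<le> R"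
        and Fz: "\<And>j. j \<noteq> k \<Longrightarrow> norm (F0 j z) \<le> 2 * norm (a j) + \<eta>" for z :: "complex ^ 'n"
    proof -
      have low: "b * rho l z powr (1 - m) - D3 \<le> norm (?p0 z)"
        using main[OF z1 zR R(1) \<eta>_def Fz] sumD[of z] unfolding D3_def by linarith
      have "norm (\<Sum>i\<in>-{k}. z $ i * a i) \<le> (\<Sum>i\<in>-{k}. 2 * norm (a i) * norm (z $ i))"
        by (intro sum_norm_le) (simp add: norm_mult mult.commute mult_left_mono mult_le_cancel_right1)
      also have "\<dots> \<le> b * rho l z powr (1 - m) + D2" by (rule sumD)
      also have "\<dots> \<le> norm (?p0 z) + (D3 + D2)" using low by simp
      also have "\<dots> \<le> C * norm (?p0 z) + C"
        using C D3 D2 mult_right_mono[OF C(1), of "norm (?p0 z)"] by (simp add: C_def)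
      finally have 1: "norm (\<Sum>i\<in>-{k}. z $ i * a i) \<le> C * (1 + norm (?p0 z))" by (simp add: algebra_simps)
      have 2: "Mt \<le> norm (?p0 z)" if i: "i \<noteq> k" "norm (z $ i) = R" for i
      proof -
        have "R powr 1 \<le> R powr (1 / l $ i)" using R(1) lpos[of i] l1[of i] by (intro powr_mono) (auto simp: field_simps)
        then have "R \<le> rho l z" using rho_ge[of z i] i R(1) by simp
        then have "(max 0 (Mt + D3) / b) powr (1 / (1 - m)) \<le> rho l z" using R(3) by linarith
        then have "((max 0 (Mt + D3) / b) powr (1 / (1 - m))) powr (1 - m) \<le> rho l z powr (1 - m)"
          using m2 by (intro powr_mono2) auto
        then have "max 0 (Mt + D3) / b \<le> rho l z powr (1 - m)" using m2 b by (simp add: powr_powr)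
        then have "max 0 (Mt + D3) \<le> b * rho l z powr (1 - m)" using b by (simp add: field_simps)
        then show ?thesis using low by linarith
      qed
      show ?thesis using 1 2 by blast
    qed
    then show "\<exists>R \<eta>. R0 < R \<and> 1 \<le> R \<and> 0 < \<eta> \<and> (\<forall>z. z $ k = 1 \<longrightarrow> (\<forall>i. i \<noteq> k \<longrightarrow> norm (z $ i) \<le> R) \<longrightarrow>
     (\<forall>j. j \<noteq> k \<longrightarrow> norm (F0 j z) \<le> 2 * norm (a j) + \<eta>) \<longrightarrow>
     norm (\<Sum>i\<in>-{k}. z $ i * a i) \<le> C * (1 + norm (f0 z - (\<Sum>i\<in>-{k}. z $ i * F0 i z))) \<and>
     (\<forall>i. i \<noteq> k \<longrightarrow> norm (z $ i) = R \<longrightarrow> Mt \<le> norm (f0 z - (\<Sum>i\<in>-{k}. z $ i * F0 i z))))"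
      using R eta by blast
  qed
qed

text \<open>Restricting the vector of \<open>minor_lift\<close> to the weight m does not affect the
  rows of weight 1-m, which are the only linear conditions: by \<open>F0_pure\<close> rows of larger
  weight vanish on vectors of pure weight m. As m < 1/2, the rows of weight 1-m belong to V.\<close>

lemma start_point:
  assumes k: "k \<notin> p ` V" "l $ k = m" and m2: "m < 1/2"
  obtains \<zeta> where "\<zeta> $ k = 1" "\<And>j. 1 - m \<le> l $ j \<Longrightarrow> F0 j \<zeta> = 0"
proof -
  obtain x :: "complex ^ 'n" where x: "x $ k = 1" "\<And>v. v \<in> V \<Longrightarrow> (\<Sum>i\<in>UNIV. H0 v i * x $ i) = 0"
    using minor_lift[OF k(1)] by blast
  define \<zeta> :: "complex ^ 'n" where "\<zeta> = (\<chi> i. if l $ i = m then x $ i else 0)"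
  show thesis
  proof (rule that)
    show "\<zeta> $ k = 1" by (simp add: \<zeta>_def x k)
    fix j assume j: "1 - m \<le> l $ j"
    have "F0 j \<zeta> = (if l $ j + m = 1 then \<Sum>i\<in>UNIV. hess c j i * \<zeta> $ i else 0)"
      by (rule F0_pure) (use j m_pos in \<open>auto simp: \<zeta>_def split: if_splits\<close>)
    also have "\<dots> = 0"
    proof (cases "l $ j + m = 1")
      case True
      have "(\<Sum>i\<in>UNIV. hess c j i * \<zeta> $ i) = (\<Sum>i\<in>UNIV. H0 j i * x $ i)"
        by (intro sum.cong) (use True in \<open>auto simp: \<zeta>_def H0_def\<close>)
      also have "\<dots> = 0" using True m2 by (intro x) (simp add: V_def)
      finally show ?thesis by simp
    qed simp
    finally show "F0 j \<zeta> = 0" .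
  qed
qed

lemma dil_line: "dil l t (z + \<tau> *s \<xi>) = dil l t z + \<tau> *s dil l t \<xi>"
  by (simp add: dil_def vec_eq_iff algebra_simps)

text \<open>For small t the rescaled f and its partial derivatives are uniformly close to f0 and F0
  on the polydisc of radius R. The continuation is run on the rescaled functions themselves, with
  constants independent of t.\<close>

lemma polar_point:
  assumes k: "k \<notin> p ` V" "l $ k = m" and m2: "m < 1/2"
  obtains R t0 where "0 < R" "0 < t0" "t0 \<le> 1" "\<And>t. 0 < t \<Longrightarrow> t \<le> t0 \<Longrightarrow>
     \<exists>z. z $ k = 1 \<and> (\<forall>i. norm (z $ i) \<le> R) \<and> (\<forall>j. j \<noteq> k \<longrightarrow> F j (dil l t z) = 0)"
proof -
  let ?n = "real CARD('n)"
  obtain \<zeta> where zeta: "\<zeta> $ k = 1" "\<And>j. 1 - m \<le> l $ j \<Longrightarrow> F0 j \<zeta> = 0" using start_point[OF k m2] by blast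
  define a where "a j = F0 j \<zeta>" for j
  let ?p0 = "\<lambda>z. f0 z - (\<Sum>i\<in>-{k}. z $ i * F0 i z)"
  obtain C where C: "0 \<le> C" "\<And>Mt R0. \<exists>R \<eta>. R0 < R \<and> 1 \<le> R \<and> 0 < \<eta> \<and> (\<forall>z. z $ k = 1 \<longrightarrow> (\<forall>i. i \<noteq> k \<longrightarrow> norm (z $ i) \<le> R) \<longrightarrow>
     (\<forall>j. j \<noteq> k \<longrightarrow> norm (F0 j z) \<le> 2 * norm (a j) + \<eta>) \<longrightarrow>
     norm (\<Sum>i\<in>-{k}. z $ i * a i) \<le> C * (1 + norm (?p0 z)) \<and>
     (\<forall>i. i \<noteq> k \<longrightarrow> norm (z $ i) = R \<longrightarrow> Mt \<le> norm (?p0 z)))"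
    by (rule p0_estimate[OF k(2) m2, of a]) (use zeta in \<open>auto simp: a_def\<close>)
  \<comment> \<open>Replacing a by a' and the Legendre transform of f0 by that of the rescaled f
    costs at most 1 each; C' absorbs both. The 1 added in B has the same origin.\<close>
  define C' where "C' = 2 * C + 1"
  define B where "B = norm (?p0 \<zeta>) + 1"
  define A where "A = 4 * (2 * C' + 1) + 2 * (ln (1 + B\<^sup>2) + 1)"
  define M where "M = exp (2 * A + ln (1 + B\<^sup>2) + 1)"
  have M: "0 \<le> M" "2 * A + ln (1 + B\<^sup>2) + 1 < ln (1 + M\<^sup>2)"
  proof -
    show "0 \<le> M" by (simp add: M_def)
    have "M < 1 + M\<^sup>2"
    proof -
      have "0 \<le> (M - 1)\<^sup>2" by simp
      then have "2 * M \<le> 1 + M\<^sup>2" by (simp add: power2_diff)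
      moreover have "M > 0" by (simp add: M_def)
      ultimately show ?thesis by linarith
    qed
    then have "ln M < ln (1 + M\<^sup>2)" by (subst ln_less_cancel_iff) (auto simp: M_def add_pos_nonneg)
    then show "2 * A + ln (1 + B\<^sup>2) + 1 < ln (1 + M\<^sup>2)" by (simp add: M_def)
  qed
  obtain R \<eta> where R: "norm \<zeta> < R" "1 \<le> R" "0 < \<eta>" and est: "\<And>z. z $ k = 1 \<Longrightarrow> (\<And>i. i \<noteq> k \<Longrightarrow> norm (z $ i) \<le> R) \<Longrightarrow>
     (\<And>j. j \<noteq> k \<Longrightarrow> norm (F0 j z) \<le> 2 * norm (a j) + \<eta>) \<Longrightarrow> norm (\<Sum>i\<in>-{k}. z $ i * a i) \<le> C * (1 + norm (?p0 z))"
     "\<And>z i. z $ k = 1 \<Longrightarrow> (\<And>i. i \<noteq> k \<Longrightarrow> norm (z $ i) \<le> R) \<Longrightarrow>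
     (\<And>j. j \<noteq> k \<Longrightarrow> norm (F0 j z) \<le> 2 * norm (a j) + \<eta>) \<Longrightarrow> i \<noteq> k \<Longrightarrow> norm (z $ i) = R \<Longrightarrow> M + 1 \<le> norm (?p0 z)"
    using C(2)[of "norm \<zeta>" "M + 1"] by blast
  \<comment> \<open>The first entry serves \<open>hyp\<close>, the second keeps the two Legendre
    transforms within distance 1 of each other.\<close>
  define \<eta>1 where "\<eta>1 = min (\<eta> / 8) (1 / (1 + ?n * R))"
  have nR: "?n * R > 0" using R by simp
  have e1: "\<eta>1 > 0" "\<eta>1 \<le> \<eta> / 8" "\<eta>1 * (1 + ?n * R) \<le> 1"
  proof -
    show "\<eta>1 > 0" using R nR by (auto simp: \<eta>1_def intro!: divide_pos_pos add_pos_pos)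
    show "\<eta>1 \<le> \<eta> / 8" by (simp add: \<eta>1_def)
    have "\<eta>1 \<le> 1 / (1 + ?n * R)" by (simp add: \<eta>1_def)
    then show "\<eta>1 * (1 + ?n * R) \<le> 1" using nR by (simp add: field_simps)
  qed
  obtain t1 where t1: "0 < t1" "t1 \<le> 1" "\<And>t z j. 0 < t \<Longrightarrow> t \<le> t1 \<Longrightarrow> (\<And>i. norm (z $ i) \<le> R) \<Longrightarrow>
     norm (of_real (t powr (l $ j - 1)) * F j (dil l t z) - F0 j z) \<le> \<eta>1"
    using F_limit[of \<eta>1 R] e1 R by auto
  obtain t2 where t2: "0 < t2" "t2 \<le> 1" "\<And>t z. 0 < t \<Longrightarrow> t \<le> t2 \<Longrightarrow> (\<And>i. norm (z $ i) \<le> R) \<Longrightarrow>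
     norm (of_real (t powr (-1)) * f (dil l t z) - f0 z) \<le> \<eta>1"
    using f_limit[of \<eta>1 R] e1 R by auto
  \<comment> \<open>Dilated points then have coordinates below r/6, half of the radius r/3 on which
    the partial derivatives expand.\<close>
  obtain t3 where t3: "0 < t3" "t3 \<le> 1" "\<And>x i. 0 < x \<Longrightarrow> x \<le> t3 \<Longrightarrow> x powr (l $ i) \<le> r / (7 * R)"
    using powr_small_all[OF lpos, of "r / (7 * R)"] r_pos R by auto
  define t0 where "t0 = min t1 (min t2 t3)"
  have t0: "0 < t0" "t0 \<le> 1" "t0 \<le> t1" "t0 \<le> t2" "t0 \<le> t3" using t1 t2 t3 by (auto simp: t0_def)
  show thesis
  proof (rule that[of R t0])
    show "0 < R" using R by simp
    fix t assume t: "0 < t" "t \<le> t0"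
    \<comment> \<open>Coordinate k of w carries the parameter s; it is replaced by 1 before f is
      evaluated.\<close>
    define put :: "complex ^ 'n \<Rightarrow> complex ^ 'n" where "put w = (\<chi> i. if i = k then 1 else w $ i)" for w
    define \<phi> where "\<phi> w = of_real (t powr (-1)) * f (dil l t (put w))" for w
    define G where "G j w = of_real (t powr (l $ j - 1)) * F j (dil l t (put w))" for j w
    define H where "H j i w = of_real (t powr (l $ j - 1)) * (of_real (t powr (l $ i)) * gradient (F j) (dil l t (put w)) $ i)" for j i w
    define P where "P w = \<phi> w - (\<Sum>i\<in>-{k}. w $ i * G i w)" for w
    \<comment> \<open>Taking the rescaled derivatives at \<zeta>, instead of a, makes \<zeta> an
      exact solution at s = 1.\<close>
    define a' where "a' j = G j \<zeta>" for j
    have putR: "norm (put w $ i) \<le> R" if "\<And>i. i \<noteq> k \<Longrightarrow> norm (w $ i) \<le> R" for w i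
      using that R by (simp add: put_def)
    have putz: "put \<zeta> = \<zeta>" by (simp add: put_def vec_eq_iff zeta)
    have zR: "norm (\<zeta> $ i) < R" for i using norm_nth_le_norm[of \<zeta> i] R by linarith
    have Gd: "norm (G j w - F0 j (put w)) \<le> \<eta>1" if "\<And>i. i \<noteq> k \<Longrightarrow> norm (w $ i) \<le> R" for j w
      unfolding G_def by (rule t1(3)) (use t t0 putR that in auto)
    have phid: "norm (\<phi> w - f0 (put w)) \<le> \<eta>1" if "\<And>i. i \<noteq> k \<Longrightarrow> norm (w $ i) \<le> R" for w
      unfolding \<phi>_def by (rule t2(3)) (use t t0 putR that in auto)
    have Pd: "norm (P w - ?p0 (put w)) \<le> 1" if w: "\<And>i. i \<noteq> k \<Longrightarrow> norm (w $ i) \<le> R" for w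
    proof -
      have "P w - ?p0 (put w) = (\<phi> w - f0 (put w)) - (\<Sum>i\<in>-{k}. w $ i * (G i w - F0 i (put w)))"
        unfolding P_def by (simp add: right_diff_distrib sum_subtractf put_def)
      also have "norm \<dots> \<le> \<eta>1 + (\<Sum>i\<in>-{k}. R * \<eta>1)"
      proof (rule order_trans[OF norm_triangle_ineq4 add_mono[OF phid[OF w]]])
        show "norm (\<Sum>i\<in>-{k}. w $ i * (G i w - F0 i (put w))) \<le> (\<Sum>i\<in>-{k}. R * \<eta>1)"
          using R w Gd[OF w] by (intro sum_norm_le) (auto simp: norm_mult intro!: mult_mono)
      qed
      also have "\<dots> \<le> \<eta>1 + ?n * (R * \<eta>1)"
        using e1 R by (auto intro!: mult_right_mono card_mono)
      also have "\<dots> = \<eta>1 * (1 + ?n * R)" by (simp add: algebra_simps)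
      finally show ?thesis using e1 by linarith
    qed
    have a'd: "norm (a' j - a j) \<le> \<eta>1" for j
      using Gd[of \<zeta> j] zR less_imp_le unfolding a'_def a_def putz by blast
    \<comment> \<open>The factor 2 is the bound on |s|; the errors \<eta>/4 and 3 \<eta>1 fit into
      \<eta>.\<close>
    have hyp: "norm (F0 j (put w)) \<le> 2 * norm (a j) + \<eta>"
      if w: "\<And>i. i \<noteq> k \<Longrightarrow> norm (w $ i) \<le> R" and w2: "norm (w $ k) \<le> 2"
        and g: "norm (G j w - w $ k * a' j) \<le> \<eta> / 4" for w j
    proof -
      have "norm (a' j) \<le> norm (a j) + \<eta>1"
        using a'd[of j] norm_triangle_sub[of "a' j" "a j"] by linarith
      then have "norm (w $ k * a' j) \<le> 2 * (norm (a j) + \<eta>1)" unfolding norm_mult using w2 by (intro mult_mono) auto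
      moreover have "norm (G j w) \<le> norm (w $ k * a' j) + norm (G j w - w $ k * a' j)" by (rule norm_triangle_sub)
      moreover have "norm (F0 j (put w)) \<le> norm (G j w) + norm (F0 j (put w) - G j w)" by (rule norm_triangle_sub)
      moreover have "norm (F0 j (put w) - G j w) \<le> \<eta>1" using Gd[OF w] by (simp add: norm_minus_commute)
      moreover have "8 * \<eta>1 \<le> \<eta>" "4 * norm (G j w - w $ k * a' j) \<le> \<eta>" using e1(2) g by simp_all
      ultimately show ?thesis using R(3) by argo
    qed
    have putk: "put w $ k = 1" for w by (simp add: put_def)
    have puti: "i \<noteq> k \<Longrightarrow> put w $ i = w $ i" for w i by (simp add: put_def)
    have sumput: "(\<Sum>i\<in>-{k}. put w $ i * b i) = (\<Sum>i\<in>-{k}. w $ i * b i)" for w b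
      by (intro sum.cong) (auto simp: put_def)
    have dilr: "norm (dil l t (put w) $ i) < r / 6" if "\<And>i. i \<noteq> k \<Longrightarrow> norm (w $ i) \<le> R" for w i
    proof -
      have "norm (dil l t (put w) $ i) = t powr (l $ i) * norm (put w $ i)" by (simp add: dil_def norm_mult)
      also have "\<dots> \<le> r / (7 * R) * R" using t t0 r_pos R by (intro mult_mono t3(3) putR that) auto
      also have "\<dots> < r / 6" using R r_pos by (simp add: field_simps)
      finally show ?thesis .
    qed
    have dline: "((\<lambda>\<tau>. h (dil l t (put (w + \<tau> *s \<xi>)))) has_field_derivative
          (\<Sum>i\<in>-{k}. \<xi> $ i * (of_real (t powr (l $ i)) * gradient h (dil l t (put w)) $ i))) (at 0)"
      if h: "expands s h d" and s: "r / 3 \<le> s" and w: "\<And>i. i \<noteq> k \<Longrightarrow> norm (w $ i) < R" for h s d w \<xi>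
    proof -
      define \<xi>' :: "complex ^ 'n" where "\<xi>' = (\<chi> i. if i = k then 0 else \<xi> $ i)"
      have e: "put (w + \<tau> *s \<xi>) = put w + \<tau> *s \<xi>'" for \<tau> by (simp add: put_def \<xi>'_def vec_eq_iff)
      have "((\<lambda>\<tau>. h (dil l t (put w) + \<tau> *s dil l t \<xi>')) has_field_derivative
          (\<Sum>i\<in>UNIV. dil l t \<xi>' $ i * gradient h (dil l t (put w)) $ i)) (at 0)"
      proof (rule expands_has_line_derivative[OF h])
        fix i
        have "norm (dil l t (put w) $ i) < r / 6" by (rule dilr) (use w less_imp_le in blast)
        then show "norm (dil l t (put w) $ i) < s / 2" using s by linarith
      qed
      moreover have "(\<Sum>i\<in>UNIV. dil l t \<xi>' $ i * gradient h (dil l t (put w)) $ i)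
          = (\<Sum>i\<in>-{k}. \<xi> $ i * (of_real (t powr (l $ i)) * gradient h (dil l t (put w)) $ i))"
        by (rule sum.mono_neutral_cong_right) (auto simp: dil_def \<xi>'_def)
      ultimately show ?thesis by (simp add: e dil_line)
    qed
    have contput: "continuous_on X (\<lambda>w. dil l t (put w))" for X
    proof -
      have "continuous_on X (\<lambda>w :: complex ^ 'n. if i = k then 1 else w $ i)" for i
        by (cases "i = k") (auto intro!: continuous_intros)
      then show ?thesis unfolding dil_def put_def by (auto intro!: continuous_intros)
    qed
    have cont: "continuous_on {w. \<forall>i. i \<noteq> k \<longrightarrow> norm (w $ i) \<le> R} (\<lambda>w. h (dil l t (put w)))"
      if h: "expands s h d" and s: "r / 3 \<le> s" for h s d
    proof (rule continuous_on_compose2[OF expands_continuous[OF h] contput])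
      show "(\<lambda>w. dil l t (put w)) ` {w. \<forall>i. i \<noteq> k \<longrightarrow> norm (w $ i) \<le> R} \<subseteq> {z. \<forall>i. norm (z $ i) \<le> s}"
      proof (rule image_subsetI, rule CollectI, rule allI)
        fix w :: "complex ^ 'n" and i assume "w \<in> {w. \<forall>i. i \<noteq> k \<longrightarrow> norm (w $ i) \<le> R}"
        then have "norm (dil l t (put w) $ i) < r / 6" by (intro dilr) auto
        then show "norm (dil l t (put w) $ i) \<le> s" using s r_pos by linarith
      qed
    qed
    have r3: "r / 3 \<le> r" using r_pos by simp
    have tt: "of_real (t powr - 1) * of_real (t powr (l $ i)) = complex_of_real (t powr (l $ i - 1))" for i
      unfolding of_real_mult[symmetric] powr_add[symmetric] by simp
    interpret continuation \<phi> G H k P R C' "\<eta> / 4" M B A \<zeta> a'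
    proof unfold_locales
      show "0 < R" using R by simp
      show "((\<lambda>\<tau>. \<phi> (w + \<tau> *s \<xi>)) has_field_derivative (\<Sum>i\<in>-{k}. \<xi> $ i * G i w)) (at 0)"
        if "\<And>i. i \<noteq> k \<Longrightarrow> norm (w $ i) < R" for w \<xi>
      proof -
        have "((\<lambda>\<tau>. of_real (t powr (-1)) * f (dil l t (put (w + \<tau> *s \<xi>)))) has_field_derivative
          of_real (t powr (-1)) * (\<Sum>i\<in>-{k}. \<xi> $ i * (of_real (t powr (l $ i)) * gradient f (dil l t (put w)) $ i))) (at 0)"
          by (rule DERIV_cmult[OF dline[OF ex r3]]) (rule that)
        moreover have "of_real (t powr (-1)) * (\<Sum>i\<in>-{k}. \<xi> $ i * (of_real (t powr (l $ i)) * gradient f (dil l t (put w)) $ i))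
            = (\<Sum>i\<in>-{k}. \<xi> $ i * G i w)"
          unfolding G_def F_def tt[symmetric] sum_distrib_left by (intro sum.cong) (auto simp: mult_ac)
        ultimately show ?thesis unfolding \<phi>_def by simp
      qed
      show "((\<lambda>\<tau>. G j (w + \<tau> *s \<xi>)) has_field_derivative (\<Sum>i\<in>-{k}. \<xi> $ i * H j i w)) (at 0)"
        if "j \<noteq> k" "\<And>i. i \<noteq> k \<Longrightarrow> norm (w $ i) < R" for j w \<xi>
      proof -
        have "((\<lambda>\<tau>. of_real (t powr (l $ j - 1)) * F j (dil l t (put (w + \<tau> *s \<xi>)))) has_field_derivative
          of_real (t powr (l $ j - 1)) * (\<Sum>i\<in>-{k}. \<xi> $ i * (of_real (t powr (l $ i)) * gradient (F j) (dil l t (put w)) $ i))) (at 0)"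
          by (rule DERIV_cmult[OF dline[OF exF order_refl]]) (rule that(2))
        moreover have "of_real (t powr (l $ j - 1)) * (\<Sum>i\<in>-{k}. \<xi> $ i * (of_real (t powr (l $ i)) * gradient (F j) (dil l t (put w)) $ i))
            = (\<Sum>i\<in>-{k}. \<xi> $ i * H j i w)"
          unfolding H_def sum_distrib_left by (intro sum.cong) (auto simp: mult_ac)
        ultimately show ?thesis unfolding G_def by simp
      qed
      show "continuous_on {w. \<forall>i. i \<noteq> k \<longrightarrow> norm (w $ i) \<le> R} \<phi>"
        unfolding \<phi>_def[abs_def] by (intro continuous_intros cont[OF ex r3])
      show "continuous_on {w. \<forall>i. i \<noteq> k \<longrightarrow> norm (w $ i) \<le> R} (G j)" for j
        unfolding G_def[abs_def] by (intro continuous_intros cont[OF exF order_refl])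
      show "P w = \<phi> w - (\<Sum>i\<in>-{k}. w $ i * G i w)" for w by (simp add: P_def)
      show "\<zeta> $ k = 1" by (rule zeta)
      show "norm (\<zeta> $ i) < R" for i by (rule zR)
      show "a' j = G j \<zeta>" for j by (simp add: a'_def)
      show "norm (P \<zeta>) \<le> B"
      proof -
        have "norm (P \<zeta> - ?p0 (put \<zeta>)) \<le> 1" by (rule Pd) (use zR less_imp_le in blast)
        then show ?thesis using norm_triangle_sub[of "P \<zeta>" "?p0 \<zeta>"] unfolding putz B_def by linarith
      qed
      show "0 \<le> C'" using C by (simp add: C'_def)
      show "0 < \<eta> / 4" using R by simp
      show "norm (\<Sum>i\<in>-{k}. w $ i * a' i) \<le> C' * (1 + norm (P w))"
        if w: "\<And>i. i \<noteq> k \<Longrightarrow> norm (w $ i) \<le> R" and w2: "norm (w $ k) \<le> 2"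
          and g: "\<And>j. j \<noteq> k \<Longrightarrow> norm (G j w - w $ k * a' j) \<le> \<eta> / 4" for w
      proof -
        have "norm (\<Sum>i\<in>-{k}. put w $ i * a i) \<le> C * (1 + norm (?p0 (put w)))"
          by (rule est(1)) (use putk puti w hyp[OF w w2 g] in auto)
        then have 1: "norm (\<Sum>i\<in>-{k}. w $ i * a i) \<le> C * (1 + norm (?p0 (put w)))" by (simp only: sumput)
        have 2: "norm (\<Sum>i\<in>-{k}. w $ i * (a' i - a i)) \<le> 1"
        proof -
          have "norm (\<Sum>i\<in>-{k}. w $ i * (a' i - a i)) \<le> (\<Sum>i\<in>-{k}. R * \<eta>1)"
            using R w a'd by (intro sum_norm_le) (auto simp: norm_mult intro!: mult_mono)
          also have "\<dots> \<le> ?n * (R * \<eta>1)" using e1 R by (auto intro!: mult_right_mono card_mono)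
          also have "\<dots> \<le> \<eta>1 * (1 + ?n * R)" using e1 by (simp add: algebra_simps)
          finally show ?thesis using e1 by linarith
        qed
        have 3: "norm (?p0 (put w)) \<le> norm (P w) + 1"
          using Pd[OF w] norm_triangle_sub[of "?p0 (put w)" "P w"] by (simp add: norm_minus_commute)
        have "(\<Sum>i\<in>-{k}. w $ i * a' i) = (\<Sum>i\<in>-{k}. w $ i * a i) + (\<Sum>i\<in>-{k}. w $ i * (a' i - a i))"
          by (simp add: sum.distrib[symmetric] algebra_simps)
        then have "norm (\<Sum>i\<in>-{k}. w $ i * a' i) \<le> C * (1 + norm (?p0 (put w))) + 1"
          using norm_triangle_ineq[of "\<Sum>i\<in>-{k}. w $ i * a i" "\<Sum>i\<in>-{k}. w $ i * (a' i - a i)"] 1 2 by simp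
        also have "\<dots> \<le> C * (2 + norm (P w)) + 1" using 3 C by (simp add: mult_left_mono)
        also have "\<dots> \<le> C' * (1 + norm (P w))"
          using C mult_nonneg_nonneg[of C "norm (P w)"] by (simp add: C'_def algebra_simps)
        finally show ?thesis .
      qed
      show "M \<le> norm (P w)"
        if w: "\<And>i. i \<noteq> k \<Longrightarrow> norm (w $ i) \<le> R" and w2: "norm (w $ k) \<le> 2"
          and g: "\<And>j. j \<noteq> k \<Longrightarrow> norm (G j w - w $ k * a' j) \<le> \<eta> / 4" and i: "i \<noteq> k" "norm (w $ i) = R" for w i
      proof -
        have "M + 1 \<le> norm (?p0 (put w))"
          by (rule est(2)[of _ i]) (use putk puti w hyp[OF w w2 g] i in auto)
        then show ?thesis using Pd[OF w] norm_triangle_sub[of "?p0 (put w)" "P w"] by (simp add: norm_minus_commute)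
      qed
      show "A = 4 * (2 * C' + 1) + 2 * (ln (1 + B\<^sup>2) + 1)" by (rule A_def)
    qed (rule M)+
    obtain w where w: "\<And>i. i \<noteq> k \<Longrightarrow> norm (w $ i) \<le> R" "\<And>j. j \<noteq> k \<Longrightarrow> G j w = 0"
      using zero_exists by blast
    have "F j (dil l t (put w)) = 0" if "j \<noteq> k" for j
      using w(2)[OF that] t by (simp add: G_def)
    then show "\<exists>z. z $ k = 1 \<and> (\<forall>i. norm (z $ i) \<le> R) \<and> (\<forall>j. j \<noteq> k \<longrightarrow> F j (dil l t z) = 0)"
      using putk putR w(1) by (intro exI[of _ "put w"]) auto
  qed (use t0 in auto)
qed

text \<open>For m = 1/2 the exponent is 1 and the Lipschitz bound of the gradient suffices. For
  smaller m the polar points are dilated by small t.\<close>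

lemma lower_bound_points:
  obtains B where "0 < B" "\<And>s. 0 < s \<Longrightarrow> \<exists>z. z \<noteq> 0 \<and> norm z < s \<and> norm (gradient f z) \<le> B * norm z powr (1/m - 1)"
proof (cases "m = 1/2")
  case True
  let ?n = "real CARD('n)"
  obtain B \<delta> where B: "0 < B" "0 < \<delta>" "\<And>j x y. norm x \<le> \<delta> \<Longrightarrow> norm y \<le> \<delta> \<Longrightarrow> norm (F j x - F j y) \<le> B * norm (x - y)"
    using F_lipschitz by blast
  show thesis
  proof (rule that[of "?n * B"])
    show "0 < ?n * B" using B by simp
    fix s :: real assume s: "0 < s"
    define z :: "complex ^ 'n" where "z = axis undefined (of_real (min (s/2) \<delta>))"
    have nz: "norm z = min (s/2) \<delta>" using s B unfolding z_def norm_axis by simp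
    have "norm (gradient f z $ j) \<le> B * norm z" for j
      using B(3)[of z 0 j] nz B F_at_0[of j] by (simp add: F_def)
    from norm_le_card_nth[OF this] have "norm (gradient f z) \<le> ?n * B * norm z" by (simp add: mult.assoc)
    moreover have "norm z > 0" "norm z < s" using nz s B by auto
    ultimately show "\<exists>z. z \<noteq> 0 \<and> norm z < s \<and> norm (gradient f z) \<le> ?n * B * norm z powr (1/m - 1)"
      unfolding True by (intro exI[of _ z]) auto
  qed
next
  case False
  then have m2: "m < 1/2" using m_le(1) by simp
  obtain k where k: "k \<notin> p ` V" "l $ k = m" using m_cases False by blast
  obtain R t0 where R: "0 < R" "0 < t0" "t0 \<le> 1" "\<And>t. 0 < t \<Longrightarrow> t \<le> t0 \<Longrightarrow>
     \<exists>z. z $ k = 1 \<and> (\<forall>i. norm (z $ i) \<le> R) \<and> (\<forall>j. j \<noteq> k \<longrightarrow> F j (dil l t z) = 0)"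
    using polar_point[OF k m2] by blast
  obtain t1 where t1: "0 < t1" "t1 \<le> 1" "\<And>t z j. 0 < t \<Longrightarrow> t \<le> t1 \<Longrightarrow> (\<And>i. norm (z $ i) \<le> R) \<Longrightarrow>
     norm (of_real (t powr (l $ j - 1)) * F j (dil l t z) - F0 j z) \<le> 1"
    using F_limit[of 1 R] R by auto
  have "compact {z :: complex ^ 'n. \<forall>i. norm (z $ i) \<le> R}"
  proof -
    have "{z :: complex ^ 'n. \<forall>i. norm (z $ i) \<le> R} = (\<Inter>i\<in>UNIV. {z. norm (z $ i) \<le> R})" by auto
    moreover have "closed (\<Inter>i\<in>UNIV. {z :: complex ^ 'n. norm (z $ i) \<le> R})"
      by (intro closed_INT ballI closed_Collect_le continuous_intros)
    moreover have "bounded {z :: complex ^ 'n. \<forall>i. norm (z $ i) \<le> R}"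
      unfolding bounded_iff by (intro exI[of _ "of_nat CARD('n) * R"] ballI norm_le_card_nth) auto
    ultimately show ?thesis by (simp add: compact_eq_bounded_closed)
  qed
  then have "bounded (F0 k ` {z. \<forall>i. norm (z $ i) \<le> R})"
    by (intro compact_imp_bounded compact_continuous_image continuous_F0)
  then obtain B where "B > 0" and B': "\<forall>x\<in>F0 k ` {z. \<forall>i. norm (z $ i) \<le> R}. norm x \<le> B"
    unfolding bounded_pos by auto
  have B: "B > 0" "\<And>z. (\<And>i. norm (z $ i) \<le> R) \<Longrightarrow> norm (F0 k z) \<le> B"
    using \<open>B > 0\<close> B' by auto
  define q where "q = 1/m - 1"
  have mq: "m * q = 1 - m" using m_pos by (simp add: q_def field_simps)
  have q0: "q > 0" using m2 m_pos by (simp add: q_def field_simps)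
  show thesis
  proof (rule that[of "B + 1"])
    show "0 < B + 1" using B by simp
    fix s :: real assume s: "0 < s"
    let ?n = "real CARD('n)"
    obtain t2 where t2: "0 < t2" "t2 \<le> 1" "\<And>x i. 0 < x \<Longrightarrow> x \<le> t2 \<Longrightarrow> x powr (l $ i) \<le> s / (2 * ?n * R)"
      using powr_small_all[OF lpos, of "s / (2 * ?n * R)"] s R by auto
    define t where "t = min t0 (min t1 t2)"
    have t: "0 < t" "t \<le> t0" "t \<le> t1" "t \<le> t2" using R t1 t2 by (auto simp: t_def)
    obtain z where z: "z $ k = 1" "\<And>i. norm (z $ i) \<le> R" "\<And>j. j \<noteq> k \<Longrightarrow> F j (dil l t z) = 0"
      using R(4)[OF t(1,2)] by blast
    define y where "y = dil l t z"
    have yk: "norm (y $ k) = t powr m" by (simp add: y_def dil_def z k)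
    have tm: "t powr m > 0" using t by simp
    have y0: "y \<noteq> 0"
    proof
      assume "y = 0" then have "norm (y $ k) = 0" by simp
      with yk tm show False by simp
    qed
    have "norm (y $ i) \<le> s / (2 * ?n * R) * R" for i
      unfolding y_def dil_def using t2(3)[OF t(1,4), of i] z(2)[of i] R s
      by (simp add: norm_mult del: times_divide_eq_left) (intro mult_mono, auto)
    from norm_le_card_nth[OF this] have "norm y \<le> s / 2" using R by simp
    then have ys: "norm y < s" using s by linarith
    have Fk: "norm (F k y) \<le> t powr (1 - m) * (B + 1)"
    proof -
      have "norm (of_real (t powr (m - 1)) * F k y - F0 k z) \<le> 1"
        using t1(3)[OF t(1,3) z(2), of k] by (simp add: y_def k)
      then have "norm (of_real (t powr (m - 1)) * F k y) \<le> B + 1"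
        using B(2)[OF z(2)] norm_triangle_sub[of "of_real (t powr (m - 1)) * F k y" "F0 k z"] by linarith
      then have "t powr (m - 1) * norm (F k y) \<le> B + 1" by (simp add: norm_mult)
      then have "t powr (1 - m) * (t powr (m - 1) * norm (F k y)) \<le> t powr (1 - m) * (B + 1)"
        by (intro mult_left_mono) auto
      moreover have "t powr (1 - m) * (t powr (m - 1) * norm (F k y)) = norm (F k y)"
        using t by (simp add: mult.assoc[symmetric] flip: powr_add)
      ultimately show ?thesis by simp
    qed
    have gk: "gradient f y = axis k (F k y)"
      using z(3) by (auto simp: vec_eq_iff axis_def F_def y_def)
    have "norm (gradient f y) = norm (F k y)" unfolding gk by (rule norm_axis)
    also have "\<dots> \<le> t powr (1 - m) * (B + 1)" by (rule Fk)
    also have "t powr (1 - m) = norm (y $ k) powr q" unfolding yk by (simp add: powr_powr mq)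
    also have "norm (y $ k) powr q * (B + 1) \<le> norm y powr q * (B + 1)"
      using q0 B by (intro mult_right_mono powr_mono2 norm_nth_le_norm) auto
    finally show "\<exists>z. z \<noteq> 0 \<and> norm z < s \<and> norm (gradient f z) \<le> (B + 1) * norm z powr (1/m - 1)"
      using y0 ys by (intro exI[of _ y]) (auto simp: q_def mult.commute)
  qed
qed

end

section \<open>From two-sided estimates to the exponent\<close>

text \<open>The infimum runs over rationals while q may be irrational. The upper estimate admits
  every rational above q, and the points in \<open>low\<close> refute every exponent q' < q, since
  |z|^(q-q') tends to 0.\<close>

lemma lojasiewicz_eqI:
  fixes G :: "complex ^ 'n::finite \<Rightarrow> complex ^ 'm::finite"
  assumes q: "0 < q"
    and up: "0 < C" "0 < d" "\<And>z. norm z < d \<Longrightarrow> C * norm z powr q \<le> norm (G z)"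
    and low: "0 < B" "\<And>s. 0 < s \<Longrightarrow> \<exists>z. z \<noteq> 0 \<and> norm z < s \<and> norm (G z) \<le> B * norm z powr q"
  shows "lojasiewicz_exponent G = ereal q"
proof -
  let ?S = "{ereal q | q. q \<in> \<rat> \<and> 0 < q \<and> (\<exists>C>0. \<forall>\<^sub>F z in nhds 0. C * norm z powr q \<le> norm (G z))}"
  have mem: "ereal q' \<in> ?S" if "q' \<in> \<rat>" "q < q'" for q'
  proof -
    have "C * norm z powr q' \<le> norm (G z)" if z: "norm z < min d 1" for z
    proof -
      have "norm z powr q' \<le> norm z powr q" using z \<open>q < q'\<close> by (intro powr_mono') auto
      then have "C * norm z powr q' \<le> C * norm z powr q" using up by simp
      with up(3)[of z] z show ?thesis by simp
    qed
    then have "\<forall>\<^sub>F z in nhds 0. C * norm z powr q' \<le> norm (G z)"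
      unfolding eventually_nhds_metric using up by (intro exI[of _ "min d 1"]) auto
    then show ?thesis using that q up(1) by auto
  qed
  have ge: "q \<le> q'" if q': "0 < q'" "0 < C'" "\<forall>\<^sub>F z in nhds 0. C' * norm z powr q' \<le> norm (G z)" for q' C'
  proof (rule ccontr)
    assume "\<not> q \<le> q'"
    then have lt: "q - q' > 0" by simp
    obtain e where e: "e > 0" "\<And>z. dist z 0 < e \<Longrightarrow> C' * norm z powr q' \<le> norm (G z)"
      using q'(3) unfolding eventually_nhds_metric by blast
    obtain x where x: "0 < x" "x \<le> 1" "\<And>y. 0 < y \<Longrightarrow> y \<le> x \<Longrightarrow> y powr (q - q') \<le> C' / (2 * B)"
      using powr_small[OF lt, of "C' / (2 * B)"] q' low by auto
    obtain z where z: "z \<noteq> 0" "norm z < min e x" "norm (G z) \<le> B * norm z powr q"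
      using low(2)[of "min e x"] e x by auto
    have "C' * norm z powr q' \<le> B * norm z powr q" using e(2)[of z] z by simp
    also have "\<dots> = B * norm z powr (q - q') * norm z powr q'" by (simp add: mult.assoc flip: powr_add)
    also have "\<dots> \<le> B * (C' / (2 * B)) * norm z powr q'"
      using x(3)[of "norm z"] z low by (intro mult_right_mono mult_left_mono) auto
    also have "\<dots> = C' / 2 * norm z powr q'" using low by simp
    finally show False using q' z by simp
  qed
  show ?thesis
    unfolding lojasiewicz_exponent_def
  proof (rule antisym)
    show "Inf ?S \<le> ereal q"
    proof (rule ereal_le_epsilon2)
      fix \<epsilon> :: real assume "0 < \<epsilon>"
      then obtain q' where q': "q' \<in> \<rat>" "q < q'" "q' < q + \<epsilon>" using Rats_dense_in_real[of q "q + \<epsilon>"] by auto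
      have "Inf ?S \<le> ereal q'" by (rule Inf_lower[OF mem[OF q'(1,2)]])
      also have "\<dots> \<le> ereal q + ereal \<epsilon>" using q' by simp
      finally show "Inf ?S \<le> ereal q + ereal \<epsilon>" .
    qed
    show "ereal q \<le> Inf ?S" by (rule Inf_greatest) (use ge in auto)
  qed
qed

theorem (in positive_weights) lojasiewicz_positive:
  "gradient_lojasiewicz_exponent f = ereal (1 / l_min l - 1)"
proof -
  obtain p where "matched_weights l c f r p" using matched by blast
  then interpret matched_weights l c f r p .
  obtain C d where up: "0 < C" "0 < d" "\<And>z. norm z < d \<Longrightarrow> C * norm z powr (1/m - 1) \<le> norm (gradient f z)"
    using upper_bound by blast
  obtain B where low: "0 < B" "\<And>s. 0 < s \<Longrightarrow> \<exists>z. z \<noteq> 0 \<and> norm z < s \<and> norm (gradient f z) \<le> B * norm z powr (1/m - 1)"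
    using lower_bound_points by blast
  have "0 < 1/m - 1" using m_le(1) m_pos by (simp add: field_simps)
  from lojasiewicz_eqI[OF this up low] show ?thesis
    unfolding gradient_lojasiewicz_exponent_def m_def .
qed

section \<open>Weights outside the unit interval\<close>

lemma monomial_nz: "monomial a z \<noteq> 0 \<Longrightarrow> a i \<noteq> 0 \<Longrightarrow> z $ i \<noteq> 0"
  unfolding monomial_def by (auto simp: prod_zero_iff zero_power)

lemma monomial_cong:
  assumes "\<And>i. a i \<noteq> 0 \<Longrightarrow> z $ i = w $ i"
  shows "monomial a z = monomial a w"
  unfolding monomial_def
proof (rule prod.cong)
  show "z $ i ^ a i = w $ i ^ a i" for i using assms[of i] by (cases "a i = 0") auto
qed simp

lemma weighted_degree_ge_nth:
  assumes "\<And>i. a i \<noteq> 0 \<Longrightarrow> 0 \<le> l $ i" "a i \<noteq> 0"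
  shows "l $ i \<le> weighted_degree l a"
proof -
  have "l $ i \<le> real (a i) * l $ i" using assms mult_right_mono[of 1 "real (a i)" "l $ i"] by simp
  also have "\<dots> \<le> weighted_degree l a" unfolding weighted_degree_def
  proof (rule member_le_sum)
    show "0 \<le> real (a j) * l $ j" for j using assms(1)[of j] by (cases "a j = 0") auto
  qed auto
  finally show ?thesis .
qed

lemma weighted_degree_le_nth:
  assumes "\<And>i. a i \<noteq> 0 \<Longrightarrow> l $ i \<le> 0" "a i \<noteq> 0"
  shows "weighted_degree l a \<le> l $ i"
proof -
  have "(- l) $ i \<le> weighted_degree (- l) a" by (rule weighted_degree_ge_nth) (use assms in auto)
  then show ?thesis by (simp add: weighted_degree_def sum_negf)
qed

lemma subspace_coordinates: "vec.subspace {z :: complex ^ 'n::finite. \<forall>i. i \<notin> S \<longrightarrow> z $ i = 0}"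
  by (auto simp: vec.subspace_def)

text \<open>Here the weights are arbitrary reals and \<open>f0\<close> may be a genuinely infinite series.\<close>

locale weak_principal =
  fixes l :: "real ^ 'n::finite" and c0 :: "('n \<Rightarrow> nat) \<Rightarrow> complex"
    and f0 :: "complex ^ 'n \<Rightarrow> complex" and r d :: real
  assumes ex: "expands r f0 c0" and deg: "\<And>a. c0 a \<noteq> 0 \<Longrightarrow> weighted_degree l a = 1"
    and g0: "gradient f0 0 = 0" and d: "0 < d"
    and iso: "\<And>z. z \<noteq> 0 \<Longrightarrow> norm z < d \<Longrightarrow> gradient f0 z \<noteq> 0"
begin

lemma r_pos: "r > 0" using ex by (rule expands_pos)

lemma exF: "expands (r/3) (\<lambda>z. gradient f0 z $ j) (diff_coeff j c0)" by (rule expands_gradient[OF ex])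

lemma c0_unit: "c0 (unit_idx i) = 0"
  using gradient_at_0[OF ex, of i] g0 by simp

lemma diff_coeff_deg: "diff_coeff j c0 a \<noteq> 0 \<Longrightarrow> weighted_degree l a = 1 - l $ j"
  using deg[of "a(j := Suc (a j))"] by (auto simp: diff_coeff_def weighted_degree_upd_Suc)

text \<open>A constant term of the j-th partial derivative would be the linear coefficient at j,
  which is 0 at a critical point.\<close>

lemma diff_coeff_nz: assumes "diff_coeff j c0 a \<noteq> 0" obtains i where "a i \<noteq> 0"
proof -
  have "a \<noteq> (\<lambda>_. 0)"
  proof
    assume a: "a = (\<lambda>_. 0)"
    have "a(j := Suc (a j)) = unit_idx j" unfolding a by (auto simp: unit_idx_def fun_eq_iff)
    then show False using assms c0_unit by (simp add: diff_coeff_def)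
  qed
  then show thesis using that by auto
qed

lemma gradient_has_sum:
  "(\<And>i. norm (z $ i) \<le> r/3) \<Longrightarrow> ((\<lambda>a. diff_coeff j c0 a * monomial a z) has_sum gradient f0 z $ j) UNIV"
  by (rule expandsD[OF exF])

lemma gradient_zero:
  assumes "\<And>i. norm (z $ i) \<le> r/3" "\<And>a. diff_coeff j c0 a \<noteq> 0 \<Longrightarrow> monomial a z \<noteq> 0 \<Longrightarrow> False"
  shows "gradient f0 z $ j = 0"
proof -
  have "gradient f0 z $ j = (\<Sum>a\<in>{}. diff_coeff j c0 a * monomial a z)"
    by (rule has_sum_finite_support[OF gradient_has_sum]) (use assms in auto)
  then show ?thesis by simp
qed

text \<open>If fewer than dim X partial derivatives survive on X, they have a common nonzero zero in
  X within the isolating ball.\<close>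

lemma dim_le_card:
  assumes X: "vec.subspace X"
    and van: "\<And>z j. z \<in> X \<Longrightarrow> (\<And>i. norm (z $ i) \<le> r/3) \<Longrightarrow> j \<notin> N \<Longrightarrow> gradient f0 z $ j = 0"
  shows "vec.dim X \<le> card N"
proof (rule ccontr)
  assume "\<not> ?thesis"
  then have N: "card N < vec.dim X" by simp
  have g00: "gradient f0 0 $ j = 0" for j using g0 by simp
  have "\<exists>z\<in>X. z \<noteq> 0 \<and> norm z < d \<and> (\<forall>j. gradient f0 z $ j = 0)"
    by (rule common_zero_of_dim[OF exF g00 X N d van])
  then obtain z where z: "z \<noteq> 0" "norm z < d" "\<And>j. gradient f0 z $ j = 0" by blast
  then have "gradient f0 z = 0" by (simp add: vec_eq_iff)
  with iso z show False by blast
qed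

text \<open>On a coordinate subspace a partial derivative vanishes as soon as each of its monomials
  contains a variable outside S.\<close>

lemma card_le_card:
  assumes "\<And>j a. j \<notin> N \<Longrightarrow> diff_coeff j c0 a \<noteq> 0 \<Longrightarrow> (\<And>i. a i \<noteq> 0 \<Longrightarrow> i \<in> S) \<Longrightarrow> False"
  shows "card S \<le> card N"
proof -
  have "vec.dim {z :: complex ^ 'n. \<forall>i. i \<notin> S \<longrightarrow> z $ i = 0} \<le> card N"
  proof (rule dim_le_card[OF subspace_coordinates])
    fix z :: "complex ^ 'n" and j
    assume z: "z \<in> {z. \<forall>i. i \<notin> S \<longrightarrow> z $ i = 0}" "\<And>i. norm (z $ i) \<le> r/3" and j: "j \<notin> N"
    show "gradient f0 z $ j = 0"
    proof (rule gradient_zero[OF z(2)])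
      fix a assume a: "diff_coeff j c0 a \<noteq> 0" "monomial a z \<noteq> 0"
      show False by (rule assms[OF j a(1)]) (use monomial_nz[OF a(2)] z(1) in blast)
    qed
  qed
  then show ?thesis by (simp add: dim_substandard_cart)
qed

text \<open>A monomial of the j-th partial derivative has degree 1 - l_j. In variables of weight at
  least b its degree is at least b, so l_j <= 1-b; in variables of weight at most 1-b <= 0 its
  degree is at most 1-b, so l_j >= b. Each inequality between cardinalities is one such coordinate
  subspace; the strict versions are alike.\<close>

lemma counts:
  assumes b: "1 \<le> b"
  shows "card {i. l $ i \<ge> b} = card {i. l $ i \<le> 1 - b}" "card {i. l $ i > b} = card {i. l $ i < 1 - b}"
proof -
  have lo: "l $ i \<le> 1 - l $ j"
    if "diff_coeff j c0 a \<noteq> 0" "\<And>i. a i \<noteq> 0 \<Longrightarrow> 0 \<le> l $ i" "a i \<noteq> 0" for a i j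
    using weighted_degree_ge_nth[of a l, OF that(2,3)] diff_coeff_deg[OF that(1)] by simp
  have hi: "1 - l $ j \<le> l $ i"
    if "diff_coeff j c0 a \<noteq> 0" "\<And>i. a i \<noteq> 0 \<Longrightarrow> l $ i \<le> 0" "a i \<noteq> 0" for a i j
    using weighted_degree_le_nth[of a l, OF that(2,3)] diff_coeff_deg[OF that(1)] by simp
  have "card {i. l $ i \<ge> b} \<le> card {i. l $ i \<le> 1 - b}"
  proof (rule card_le_card)
    fix j a assume a: "j \<notin> {i. l $ i \<le> 1 - b}" "diff_coeff j c0 a \<noteq> 0" "\<And>i. a i \<noteq> 0 \<Longrightarrow> i \<in> {i. l $ i \<ge> b}"
    obtain i where "a i \<noteq> 0" using diff_coeff_nz[OF a(2)] .
    moreover have "0 \<le> l $ i" if "a i \<noteq> 0" for i using a(3)[OF that] b by simp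
    ultimately have "l $ i \<le> 1 - l $ j" using lo[OF a(2)] by blast
    then show False using a(1) a(3)[OF \<open>a i \<noteq> 0\<close>] by simp
  qed
  moreover have "card {i. l $ i \<le> 1 - b} \<le> card {i. l $ i \<ge> b}"
  proof (rule card_le_card)
    fix j a assume a: "j \<notin> {i. l $ i \<ge> b}" "diff_coeff j c0 a \<noteq> 0" "\<And>i. a i \<noteq> 0 \<Longrightarrow> i \<in> {i. l $ i \<le> 1 - b}"
    obtain i where "a i \<noteq> 0" using diff_coeff_nz[OF a(2)] .
    moreover have "l $ i \<le> 0" if "a i \<noteq> 0" for i using a(3)[OF that] b by simp
    ultimately have "1 - l $ j \<le> l $ i" using hi[OF a(2)] by blast
    then show False using a(1) a(3)[OF \<open>a i \<noteq> 0\<close>] by simp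
  qed
  ultimately show "card {i. l $ i \<ge> b} = card {i. l $ i \<le> 1 - b}" by simp
  have "card {i. l $ i > b} \<le> card {i. l $ i < 1 - b}"
  proof (rule card_le_card)
    fix j a assume a: "j \<notin> {i. l $ i < 1 - b}" "diff_coeff j c0 a \<noteq> 0" "\<And>i. a i \<noteq> 0 \<Longrightarrow> i \<in> {i. l $ i > b}"
    obtain i where "a i \<noteq> 0" using diff_coeff_nz[OF a(2)] .
    moreover have "0 \<le> l $ i" if "a i \<noteq> 0" for i using a(3)[OF that] b by simp
    ultimately have "l $ i \<le> 1 - l $ j" using lo[OF a(2)] by blast
    then show False using a(1) a(3)[OF \<open>a i \<noteq> 0\<close>] by simp
  qed
  moreover have "card {i. l $ i < 1 - b} \<le> card {i. l $ i > b}"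
  proof (rule card_le_card)
    fix j a assume a: "j \<notin> {i. l $ i > b}" "diff_coeff j c0 a \<noteq> 0" "\<And>i. a i \<noteq> 0 \<Longrightarrow> i \<in> {i. l $ i < 1 - b}"
    obtain i where "a i \<noteq> 0" using diff_coeff_nz[OF a(2)] .
    moreover have "l $ i \<le> 0" if "a i \<noteq> 0" for i using a(3)[OF that] b by simp
    ultimately have "1 - l $ j \<le> l $ i" using hi[OF a(2)] by blast
    then show False using a(1) a(3)[OF \<open>a i \<noteq> 0\<close>] by simp
  qed
  ultimately show "card {i. l $ i > b} = card {i. l $ i < 1 - b}" by simp
qed

lemma count_eq:
  assumes b: "1 \<le> b" shows "card {i. l $ i = b} = card {i. l $ i = 1 - b}"
proof -
  have "{i. l $ i = b} = {i. l $ i \<ge> b} - {i. l $ i > b}" "{i. l $ i = 1 - b} = {i. l $ i \<le> 1 - b} - {i. l $ i < 1 - b}" by auto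
  moreover have "card ({i. l $ i \<ge> b} - {i. l $ i > b}) = card {i. l $ i \<ge> b} - card {i. l $ i > b}"
    by (rule card_Diff_subset) auto
  moreover have "card ({i. l $ i \<le> 1 - b} - {i. l $ i < 1 - b}) = card {i. l $ i \<le> 1 - b} - card {i. l $ i < 1 - b}"
    by (rule card_Diff_subset) auto
  ultimately show ?thesis using counts[OF b] by simp
qed

lemma hess_nz: "hess c0 j i \<noteq> 0 \<Longrightarrow> l $ i + l $ j = 1"
  using diff_coeff_deg[of j "unit_idx i"] by (simp add: hess_def weighted_degree_unit_idx)

text \<open>A nonzero kernel vector x would enlarge the coordinate subspace of weights above b by a
  line, while still only the partial derivatives with l_j < 1-b survive there. The dimension would
  exceed their number by one, against \<open>counts\<close>.\<close>

lemma hess_kernel: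
  fixes x :: "complex ^ 'n"
  assumes b: "1 \<le> b" and x: "\<And>i. x $ i \<noteq> 0 \<Longrightarrow> l $ i = b"
    and ker: "\<And>j. l $ j = 1 - b \<Longrightarrow> (\<Sum>i\<in>UNIV. hess c0 j i * x $ i) = 0"
  shows "x = 0"
proof (rule ccontr)
  assume "x \<noteq> 0"
  then obtain i0 where i0: "x $ i0 \<noteq> 0" by (auto simp: vec_eq_iff)
  then have li0: "l $ i0 = b" by (rule x)
  \<comment> \<open>A parametrises the enlarged subspace by the coordinate subspace Y; coordinate i0
    serves as the multiplier of x.\<close>
  define A :: "complex ^ 'n ^ 'n" where
    "A = (\<chi> i j. if l $ i > b then (if i = j then 1 else 0) else (if j = i0 then x $ i else 0))"
  have A: "(A *v z) $ i = (if l $ i > b then z $ i else x $ i * z $ i0)" for z i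
    by (simp add: A_def matrix_vector_mult_def if_distrib[of "\<lambda>x. x * _"] cong: if_cong)
  define Y where "Y = {z :: complex ^ 'n. \<forall>i. i \<notin> insert i0 {i. l $ i > b} \<longrightarrow> z $ i = 0}"
  have dY: "vec.dim Y = card {i. l $ i > b} + 1"
    unfolding Y_def dim_substandard_cart using li0 by simp
  have sY: "vec.subspace Y" unfolding Y_def by (rule subspace_coordinates)
  have "inj_on ((*v) A) Y"
  proof (rule inj_onI)
    fix y z assume yz: "y \<in> Y" "z \<in> Y" "A *v y = A *v z"
    have *: "(A *v y) $ i = (A *v z) $ i" for i using yz by simp
    have "y $ i = z $ i" for i
    proof (cases "l $ i > b")
      case True then show ?thesis using *[of i] unfolding A by simp
    next
      case False
      then show ?thesis using *[of i0] i0 li0 yz(1,2) unfolding A Y_def by (cases "i = i0") auto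
    qed
    then show "y = z" by (simp add: vec_eq_iff)
  qed
  then have "vec.dim ((*v) A ` Y) = vec.dim Y"
    by (intro vec.dim_image_eq[OF matrix_vector_mul_linear_gen]) (simp add: vec.span_eq_iff[THEN iffD2, OF sY])
  moreover have "vec.dim ((*v) A ` Y) \<le> card {j. l $ j < 1 - b}"
  proof (rule dim_le_card)
    show "vec.subspace ((*v) A ` Y)" by (rule vec.subspace_image[OF sY])
    fix z j assume z: "z \<in> (*v) A ` Y" and zr: "\<And>i. norm (z $ i) \<le> r/3" and j: "j \<notin> {j. l $ j < 1 - b}"
    obtain y where y: "y \<in> Y" "z = A *v y" using z by blast
    have lz: "b \<le> l $ i" if "z $ i \<noteq> 0" for i
      using that x[of i] unfolding y A by (auto split: if_splits)
    \<comment> \<open>Only linear terms remain, because all variables present have weight at least b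
      >= 1 and the degree is at most b.\<close>
    have key: "\<exists>i. a = unit_idx i" if a: "diff_coeff j c0 a \<noteq> 0" "monomial a z \<noteq> 0" for a
    proof -
      have la: "b \<le> l $ i" if "a i \<noteq> 0" for i using lz monomial_nz[OF a(2) that] by blast
      have w: "weighted_degree l a \<le> b" using diff_coeff_deg[OF a(1)] j by simp
      have "l $ i = b" if "a i \<noteq> 0" for i
      proof -
        have "0 \<le> l $ i" if "a i \<noteq> 0" for i using la[OF that] b by linarith
        then have "l $ i \<le> weighted_degree l a" using that by (rule weighted_degree_ge_nth)
        then show ?thesis using la[OF that] w by linarith
      qed
      then have wd: "weighted_degree l a = real (\<Sum>i\<in>UNIV. a i) * b" by (rule weighted_degree_const)
      obtain i where i: "a i \<noteq> 0" using diff_coeff_nz[OF a(1)] .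
      have "a i \<le> (\<Sum>i\<in>UNIV. a i)" by (rule member_le_sum) auto
      then have s1: "(\<Sum>i\<in>UNIV. a i) \<ge> 1" using i by linarith
      have "real (\<Sum>i\<in>UNIV. a i) * b \<le> 1 * b" using w wd by linarith
      then have "real (\<Sum>i\<in>UNIV. a i) \<le> 1" using b by (simp only: mult_le_cancel_right)
      with s1 have "(\<Sum>i\<in>UNIV. a i) = 1" by linarith
      then show ?thesis using sum_eq_1_unit_idx by blast
    qed
    have "gradient f0 z $ j = (\<Sum>a\<in>range unit_idx. diff_coeff j c0 a * monomial a z)"
      by (rule has_sum_finite_support[OF gradient_has_sum[OF zr]]) (use key in auto)
    also have "\<dots> = (\<Sum>i\<in>UNIV. hess c0 j i * z $ i)"
      by (simp add: sum.reindex[OF inj_unit_idx] hess_def monomial_unit_idx)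
    also have "\<dots> = (\<Sum>i\<in>UNIV. y $ i0 * (if l $ j = 1 - b then hess c0 j i * x $ i else 0))"
    proof (rule sum.cong)
      fix i
      show "hess c0 j i * z $ i = y $ i0 * (if l $ j = 1 - b then hess c0 j i * x $ i else 0)"
      proof (cases "hess c0 j i = 0 \<or> z $ i = 0")
        case True
        then show ?thesis using x[of i] unfolding y A by (auto split: if_splits)
      next
        case False
        then have "l $ i + l $ j = 1" "b \<le> l $ i" using hess_nz lz by auto
        then show ?thesis using j unfolding y A by auto
      qed
    qed simp
    also have "\<dots> = 0"
      using ker by (cases "l $ j = 1 - b") (simp_all flip: sum_distrib_left)
    finally show "gradient f0 z $ j = 0" .
  qed
  ultimately show False using dY counts(2)[OF b] by simp
qed

section \<open>Weights at least 1 against weights at most 0\<close>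

definition P :: "'n set" where "P = {i. l $ i \<ge> 1}"
definition N :: "'n set" where "N = {i. l $ i \<le> 0}"
definition E :: "'n set" where "E = {i. 0 < l $ i \<and> l $ i < 1}"

lemma card_PN: "card P = card N"
  using counts(1)[of 1] by (simp add: P_def N_def)

text \<open>The largest weight b in the support of y meets the rows of weight 1-b alone, and there h
  is the Hessian of f0. The general h covers both f0 and the perturbed function.\<close>

lemma block_injective:
  fixes y :: "complex ^ 'n"
  assumes h: "\<And>j i. h j i \<noteq> 0 \<Longrightarrow> 1 \<le> l $ i + l $ j" "\<And>j i. l $ i + l $ j = 1 \<Longrightarrow> h j i = hess c0 j i"
    and y: "\<And>i. i \<notin> P \<Longrightarrow> y $ i = 0" and z: "\<And>q. q \<in> N \<Longrightarrow> (\<Sum>i\<in>UNIV. h q i * y $ i) = 0"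
  shows "y = 0"
proof (rule ccontr)
  assume "y \<noteq> 0"
  then have ne: "{i. y $ i \<noteq> 0} \<noteq> {}" by (auto simp: vec_eq_iff)
  define b where "b = Max ((\<lambda>i. l $ i) ` {i. y $ i \<noteq> 0})"
  have "b \<in> (\<lambda>i. l $ i) ` {i. y $ i \<noteq> 0}" unfolding b_def using ne by (intro Max_in) auto
  then obtain i0 where i0: "y $ i0 \<noteq> 0" "l $ i0 = b" by auto
  have bmax: "l $ i \<le> b" if "y $ i \<noteq> 0" for i unfolding b_def using that by (intro Max_ge) auto
  have b1: "1 \<le> b" using y[of i0] i0 by (auto simp: P_def)
  define x :: "complex ^ 'n" where "x = (\<chi> i. if l $ i = b then y $ i else 0)"
  have "x = 0"
  proof (rule hess_kernel[OF b1])
    show "l $ i = b" if "x $ i \<noteq> 0" for i using that by (auto simp: x_def split: if_splits)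
    fix j assume j: "l $ j = 1 - b"
    have "(\<Sum>i\<in>UNIV. hess c0 j i * x $ i) = (\<Sum>i\<in>UNIV. h j i * y $ i)"
    proof (rule sum.cong)
      fix i show "hess c0 j i * x $ i = h j i * y $ i"
      proof (cases "l $ i = b")
        case True
        then show ?thesis using h(2)[of i j] j by (simp add: x_def)
      next
        case False
        then have "h j i * y $ i = 0" using h(1)[of j i] bmax[of i] j by force
        then show ?thesis using False by (simp add: x_def)
      qed
    qed simp
    then show "(\<Sum>i\<in>UNIV. hess c0 j i * x $ i) = 0" using z[of j] j b1 by (simp add: N_def)
  qed
  then have "x $ i0 = 0" by simp
  then show False using i0 by (simp add: x_def)
qed

text \<open>P and N are equinumerous, so the block is square and injectivity passes to its
  transpose.\<close>

lemma block_injective':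
  fixes y :: "complex ^ 'n"
  assumes h: "\<And>j i. h j i \<noteq> 0 \<Longrightarrow> 1 \<le> l $ i + l $ j" "\<And>j i. l $ i + l $ j = 1 \<Longrightarrow> h j i = hess c0 j i"
    and y: "\<And>i. i \<notin> N \<Longrightarrow> y $ i = 0" and z: "\<And>p. p \<in> P \<Longrightarrow> (\<Sum>i\<in>UNIV. h i p * y $ i) = 0"
  shows "y = 0"
proof -
  obtain \<sigma> where sig: "bij_betw \<sigma> P N" using finite_same_card_bij[of P N] card_PN by auto
  define A :: "complex ^ 'n ^ 'n" where "A = (\<chi> i j. if i \<in> P \<and> j \<in> P then h (\<sigma> i) j else if i = j then 1 else 0)"
  have "x = 0" if "A *v x = 0" for x
  proof -
    have Ax: "(\<Sum>j\<in>UNIV. A $ i $ j * x $ j) = 0" for i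
      using that by (simp add: vec_eq_iff matrix_vector_mult_def)
    have x0: "x $ i = 0" if "i \<notin> P" for i
      using Ax[of i] that by (simp add: A_def if_distrib[of "\<lambda>x. x * _"] cong: if_cong)
    show ?thesis
    proof (rule block_injective[where h=h, OF h x0])
      fix q assume "q \<in> N"
      then obtain i where i: "i \<in> P" "q = \<sigma> i" using sig by (auto simp: bij_betw_def)
      have "(\<Sum>j\<in>UNIV. h q j * x $ j) = (\<Sum>j\<in>UNIV. A $ i $ j * x $ j)"
        by (intro sum.cong) (use i x0 in \<open>auto simp: A_def\<close>)
      then show "(\<Sum>j\<in>UNIV. h q j * x $ j) = 0" using Ax by simp
    qed
  qed
  then obtain A' where "A' ** A = mat 1" using matrix_left_invertible_ker by blast
  then have "A ** A' = mat 1" by (simp add: matrix_left_right_inverse)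
  then have "transpose A' ** transpose A = mat 1"
    by (simp add: matrix_transpose_mul[symmetric] transpose_mat)
  moreover define w :: "complex ^ 'n" where "w = (\<chi> i. if i \<in> P then y $ \<sigma> i else 0)"
  have "(transpose A *v w) $ j = 0" for j
  proof (cases "j \<in> P")
    case False
    have "(transpose A *v w) $ j = (\<Sum>i\<in>UNIV. A $ i $ j * w $ i)"
      by (simp add: matrix_vector_mult_def transpose_def)
    also have "\<dots> = 0" by (intro sum.neutral) (use False in \<open>auto simp: A_def w_def\<close>)
    finally show ?thesis .
  next
    case True
    have "(transpose A *v w) $ j = (\<Sum>i\<in>UNIV. A $ i $ j * w $ i)"
      by (simp add: matrix_vector_mult_def transpose_def)
    also have "\<dots> = (\<Sum>i\<in>P. (\<lambda>q. h q j * y $ q) (\<sigma> i))"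
      by (rule sum.mono_neutral_cong_right) (use True in \<open>auto simp: A_def w_def\<close>)
    also have "\<dots> = (\<Sum>q\<in>N. h q j * y $ q)" by (rule sum.reindex_bij_betw[OF sig])
    also have "\<dots> = (\<Sum>q\<in>UNIV. h q j * y $ q)" by (rule sum.mono_neutral_left) (use y in auto)
    finally show ?thesis using z[OF True] by simp
  qed
  then have "transpose A *v w = 0" by (simp add: vec_eq_iff)
  ultimately have "w = 0" by (metis matrix_vector_mul_assoc matrix_vector_mul_lid matrix_vector_mult_0_right)
  have "y $ q = 0" for q
  proof (cases "q \<in> N")
    case True
    then obtain i where i: "i \<in> P" "q = \<sigma> i" using sig by (auto simp: bij_betw_def)
    have "w $ i = 0" using \<open>w = 0\<close> by simp
    then show ?thesis using i by (simp add: w_def)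
  qed (rule y)
  then show ?thesis by (simp add: vec_eq_iff)
qed

text \<open>The block of rows N and columns P is invertible, so a small change of the P-coordinates
  annihilates the N-components of the gradient. Unlike the P-components, these are not excluded by
  degree when only variables of positive weight occur.\<close>

lemma solve_N:
  assumes s: "0 < s"
  obtains \<delta> where "0 < \<delta>" "\<And>z. norm z < \<delta> \<Longrightarrow> \<exists>v. (\<forall>i. i \<notin> P \<longrightarrow> v $ i = 0) \<and> norm v < s \<and> (\<forall>q\<in>N. gradient f0 (z + v) $ q = 0)"
proof -
  let ?n = "real CARD('n)"
  obtain \<sigma> where sig: "bij_betw \<sigma> P N" using finite_same_card_bij[of P N] card_PN by auto
  define A :: "complex ^ 'n ^ 'n" where "A = (\<chi> i. if i \<in> P then (\<chi> j. hess c0 (\<sigma> i) j) else axis i 1)"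
  have Ax: "(A *v x) $ i = (if i \<in> P then \<Sum>j\<in>UNIV. hess c0 (\<sigma> i) j * x $ j else x $ i)" for x i
    by (simp add: A_def matrix_vector_mult_def axis_def if_distrib[of "\<lambda>x. x * _"] cong: if_cong)
  have ker: "x = 0" if Ax0: "A *v x = 0" for x
  proof (rule block_injective[where h="hess c0"])
    show "x $ i = 0" if "i \<notin> P" for i using Ax[of x i] that Ax0 by simp
    fix q assume "q \<in> N"
    then obtain i where i: "i \<in> P" "q = \<sigma> i" using sig by (auto simp: bij_betw_def)
    then show "(\<Sum>i\<in>UNIV. hess c0 q i * x $ i) = 0" using Ax[of x i] Ax0 by simp
  qed (use hess_nz in fastforce)+
  obtain \<mu> where mu: "0 < \<mu>" "\<And>x. \<mu> * norm x \<le> norm (A *v x)" using invertible_bounded_below[OF ker] by blast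
  obtain \<delta>1 where d1: "0 < \<delta>1" "\<And>j x y. norm x \<le> \<delta>1 \<Longrightarrow> norm y \<le> \<delta>1 \<Longrightarrow>
     norm (gradient f0 x $ j - gradient f0 y $ j - (\<Sum>i\<in>UNIV. hess c0 j i * (x - y) $ i)) \<le> (\<mu> / (2 * ?n)) * norm (x - y)"
    using gradient_strict_derivative[OF ex, of "\<mu> / (2 * ?n)"] mu by auto
  obtain B \<delta>2 where B: "0 < B" "0 < \<delta>2" "\<And>j x y. norm x \<le> \<delta>2 \<Longrightarrow> norm y \<le> \<delta>2 \<Longrightarrow> norm (gradient f0 x $ j - gradient f0 y $ j) \<le> B * norm (x - y)"
    using gradient_lipschitz[OF ex] by metis
  define \<rho> where "\<rho> = min (\<delta>1 / 2) (s / 2)"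
  have rho: "\<rho> > 0" "\<rho> \<le> \<delta>1 / 2" "\<rho> < s" using d1 s by (auto simp: \<rho>_def)
  define \<delta> where "\<delta> = min (min \<delta>2 (\<delta>1 / 2)) (\<mu> / 2 * \<rho> / (?n * B))"
  have nB: "?n * B > 0" using B by simp
  have del: "\<delta> > 0" using B d1 mu rho by (simp add: \<delta>_def)
  show thesis
  proof (rule that[OF del])
    fix z :: "complex ^ 'n" assume z: "norm z < \<delta>"
    have zd: "norm z \<le> \<delta>2" "norm z \<le> \<delta>1 / 2" "norm z \<le> \<mu> / 2 * \<rho> / (?n * B)" using z by (auto simp: \<delta>_def)
    define g where "g x = (\<chi> i. if i \<in> P then gradient f0 (z + x) $ \<sigma> i else x $ i)" for x
    have "norm (g 0 $ i) \<le> B * norm z" for i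
      using B(3)[of z 0 "\<sigma> i"] zd B(1,2) g0 by (simp add: g_def)
    from norm_le_card_nth[OF this] have "norm (g 0) \<le> ?n * B * norm z" by (simp add: mult.assoc)
    also have "\<dots> \<le> ?n * B * (\<mu> / 2 * \<rho> / (?n * B))" using zd nB by (intro mult_left_mono) auto
    also have "\<dots> = \<mu> / 2 * \<rho>" using B(1) by simp
    finally have g0: "norm (g 0) \<le> \<mu> / 2 * \<rho>" .
    obtain x where x: "norm x \<le> 2 / \<mu> * norm (g 0)" "g x = 0"
    proof (rule newton_zero[OF mu, of \<rho> g])
      fix x y :: "complex ^ 'n" assume xy: "norm x \<le> \<rho>" "norm y \<le> \<rho>"
      have n: "norm (z + x) \<le> \<delta>1" "norm (z + y) \<le> \<delta>1"
        using norm_triangle_ineq[of z x] norm_triangle_ineq[of z y] xy zd(2) rho by linarith+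
      have "norm ((g x - g y - A *v (x - y)) $ i) \<le> (\<mu> / (2 * ?n)) * norm (x - y)" for i
      proof (cases "i \<in> P")
        case True
        then show ?thesis using d1(2)[OF n, of "\<sigma> i"] unfolding vector_minus_component Ax by (simp add: g_def)
      next
        case False
        then show ?thesis using mu unfolding vector_minus_component Ax by (simp add: g_def)
      qed
      from norm_le_card_nth[OF this] show "norm (g x - g y - A *v (x - y)) \<le> \<mu> / 2 * norm (x - y)" by simp
    qed (rule g0)
    have gx: "g x $ i = 0" for i using x(2) by simp
    have "norm x \<le> 2 / \<mu> * (\<mu> / 2 * \<rho>)" using x(1) g0 mu mult_left_mono[of "norm (g 0)" "\<mu> / 2 * \<rho>" "2 / \<mu>"] by simp
    then have "norm x < s" using mu rho by simp
    moreover have "x $ i = 0" if "i \<notin> P" for i using gx[of i] that by (simp add: g_def)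
    moreover have "gradient f0 (z + x) $ q = 0" if qN: "q \<in> N" for q
    proof -
      obtain i where i: "i \<in> P" "q = \<sigma> i" using sig qN by (auto simp: bij_betw_def)
      then show ?thesis using gx[of i] by (simp add: g_def)
    qed
    ultimately show "\<exists>v. (\<forall>i. i \<notin> P \<longrightarrow> v $ i = 0) \<and> norm v < s \<and> (\<forall>q\<in>N. gradient f0 (z + v) $ q = 0)" by blast
  qed
qed

end

section \<open>Reduction to positive weights\<close>

lemma sum_eq_1_unit_idx_on:
  fixes a :: "'n::finite \<Rightarrow> nat"
  assumes "(\<Sum>i\<in>S. a i) = 1"
  shows "\<exists>p\<in>S. \<forall>i\<in>S. a i = unit_idx p i"
proof -
  have "(\<Sum>i\<in>UNIV. if i \<in> S then a i else 0) = 1" using assms by (simp add: sum.If_cases)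
  then obtain p where p: "(\<lambda>i. if i \<in> S then a i else 0) = unit_idx p" by (rule sum_eq_1_unit_idx)
  have "(if p \<in> S then a p else 0) = 1" using fun_cong[OF p, of p] by (simp add: unit_idx_def)
  then have "p \<in> S" by (auto split: if_splits)
  moreover have "a i = unit_idx p i" if "i \<in> S" for i using fun_cong[OF p, of i] that by simp
  ultimately show ?thesis by blast
qed

lemma count_image_mset_set:
  assumes "finite A" shows "count {# g i. i \<in># mset_set A #} x = card {i \<in> A. g i = x}"
proof -
  have "count {# g i. i \<in># mset_set A #} x = (\<Sum>i | i \<in> A \<and> x = g i. count (mset_set A) i)"
    using assms by (simp add: count_image_mset')
  also have "\<dots> = (\<Sum>i\<in>{i \<in> A. g i = x}. 1)"
    using assms by (intro sum.cong) auto
  finally show ?thesis by simp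
qed

lemma count_weights: "count (weights l) x = card {i. l $ i = x}"
  unfolding weights_def by (simp add: count_image_mset_set)

lemma count_reflected_weights: "count (reflected_weights (weights l)) x = card {i. l $ i > 1/2 \<and> l $ i = 1 - x}"
proof -
  have "reflected_weights (weights l) = {# 1 - l $ i. i \<in># mset_set {i. l $ i > 1/2} #}"
    unfolding reflected_weights_def weights_def
    by (simp add: filter_mset_image_mset image_mset.compositionality comp_def filter_mset_mset_set)
  then have "count (reflected_weights (weights l)) x = card {i \<in> {i. l $ i > 1/2}. 1 - l $ i = x}"
    by (simp only: count_image_mset_set finite)
  also have "{i \<in> {i. l $ i > 1/2}. 1 - l $ i = x} = {i. l $ i > 1/2 \<and> l $ i = 1 - x}" by auto
  finally show ?thesis .
qed

lemma reduced_weights_iff: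
  "x \<in> reduced_weights l \<longleftrightarrow> card {i. l $ i > 1/2 \<and> l $ i = 1 - x} < card {i. l $ i = x} \<or> x = 1/2"
  unfolding reduced_weights_def by (auto simp: in_diff_count count_weights count_reflected_weights)

text \<open>As 1/2 is always a reduced weight, only those up to 1/2 compete for the minimum.\<close>

lemma l_min_cong:
  fixes l l' :: "real ^ 'n::finite"
  assumes "\<And>x. x \<le> 1/2 \<Longrightarrow> x \<in> reduced_weights l \<longleftrightarrow> x \<in> reduced_weights l'"
  shows "l_min l = l_min l'"
proof -
  have fin: "finite (reduced_weights k)" for k :: "real ^ 'n" by (simp add: reduced_weights_def)
  have half: "1/2 \<in> reduced_weights k" for k :: "real ^ 'n" by (simp add: reduced_weights_def)
  have in1: "l_min k \<in> reduced_weights k" for k :: "real ^ 'n"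
    unfolding l_min_def by (rule Min_in) (use fin half in auto)
  have le: "l_min k \<le> x" if "x \<in> reduced_weights k" for x and k :: "real ^ 'n"
    unfolding l_min_def by (rule Min_le[OF fin that])
  show ?thesis
    using assms in1[of l] in1[of l'] le half by (meson antisym)
qed

locale weak_sum = weak_principal l c0 f0 r d
  for l :: "real ^ 'n::finite" and c0 f0 r d +
  fixes c' :: "('n \<Rightarrow> nat) \<Rightarrow> complex"
  assumes ord': "\<And>a. c' a \<noteq> 0 \<Longrightarrow> 2 \<le> (\<Sum>i\<in>UNIV. a i)"
    and deg': "\<And>a. c' a \<noteq> 0 \<Longrightarrow> 1 < weighted_degree l a"
begin

definition "c a = c0 a + c' a"

lemma ord0: assumes "c0 a \<noteq> 0" shows "2 \<le> (\<Sum>i\<in>UNIV. a i)"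
proof (rule ccontr)
  assume "\<not> ?thesis"
  then have "(\<Sum>i\<in>UNIV. a i) = 0 \<or> (\<Sum>i\<in>UNIV. a i) = 1" by linarith
  then show False
  proof
    assume "(\<Sum>i\<in>UNIV. a i) = 0"
    then have "weighted_degree l a = 0" by (simp add: weighted_degree_def)
    then show False using deg[OF assms] by simp
  next
    assume "(\<Sum>i\<in>UNIV. a i) = 1"
    then obtain i where "a = unit_idx i" by (rule sum_eq_1_unit_idx)
    then show False using assms c0_unit by simp
  qed
qed

lemma c_ord: "c a \<noteq> 0 \<Longrightarrow> 2 \<le> (\<Sum>i\<in>UNIV. a i)"
  using ord0[of a] ord'[of a] by (cases "c0 a = 0") (auto simp: c_def)

lemma c_deg: "c a \<noteq> 0 \<Longrightarrow> 1 \<le> weighted_degree l a"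
  using deg[of a] deg'[of a] by (cases "c0 a = 0") (auto simp: c_def)

lemma c_eq: "weighted_degree l a \<le> 1 \<Longrightarrow> c a = c0 a"
  using deg'[of a] by (cases "c' a = 0") (auto simp: c_def)

text \<open>Halving the minimum puts \<epsilon> strictly below 1/2 and strictly below every l_i and
  1 - l_i with i in E, so the new weights \<epsilon> and 1-\<epsilon> meet no weight of E.\<close>

definition "\<epsilon> = Min (insert (1/2) ((\<lambda>i. min (l $ i) (1 - l $ i)) ` E)) / 2"

lemma eps: "0 < \<epsilon>" "\<epsilon> < 1/2" "i \<in> E \<Longrightarrow> \<epsilon> < l $ i" "i \<in> E \<Longrightarrow> \<epsilon> < 1 - l $ i"
proof -
  let ?M = "Min (insert (1/2) ((\<lambda>i. min (l $ i) (1 - l $ i)) ` E))"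
  have M: "?M > 0" by (subst Min_gr_iff) (auto simp: E_def)
  have "?M \<le> 1/2" by (rule Min_le) auto
  then show "0 < \<epsilon>" "\<epsilon> < 1/2" using M by (auto simp: \<epsilon>_def)
  assume i: "i \<in> E"
  have "?M \<le> min (l $ i) (1 - l $ i)" by (rule Min_le) (use i in auto)
  then show "\<epsilon> < l $ i" "\<epsilon> < 1 - l $ i" using M unfolding \<epsilon>_def by linarith+
qed

definition l' :: "real ^ 'n" where "l' = (\<chi> i. if i \<in> P then 1 - \<epsilon> else if i \<in> N then \<epsilon> else l $ i)"

lemma PNE: "P \<inter> N = {}" "P \<inter> E = {}" "N \<inter> E = {}" "P \<union> N \<union> E = UNIV"
  by (auto simp: P_def N_def E_def)

lemma l'_simps: "i \<in> P \<Longrightarrow> l' $ i = 1 - \<epsilon>" "i \<in> N \<Longrightarrow> l' $ i = \<epsilon>" "i \<in> E \<Longrightarrow> l' $ i = l $ i"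
  using PNE by (auto simp: l'_def)

lemma l'_bounds: "0 < l' $ i" "l' $ i < 1"
  using eps(1,2) by (auto simp: l'_def P_def N_def)

lemma sum_PNE: "(\<Sum>i\<in>UNIV. g i) = (\<Sum>i\<in>P. g i) + (\<Sum>i\<in>N. g i) + (\<Sum>i\<in>E. g i)" for g :: "'n \<Rightarrow> 'b::comm_monoid_add"
proof -
  have "(\<Sum>i\<in>UNIV. g i) = (\<Sum>i\<in>P \<union> N. g i) + (\<Sum>i\<in>E. g i)"
    unfolding PNE(4)[symmetric] by (rule sum.union_disjoint) (use PNE in auto)
  also have "(\<Sum>i\<in>P \<union> N. g i) = (\<Sum>i\<in>P. g i) + (\<Sum>i\<in>N. g i)"
    by (rule sum.union_disjoint) (use PNE in auto)
  finally show ?thesis .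
qed

text \<open>The cases follow the order sP in the variables of P. For sP = 0 the variables of E alone
  have degree at least 1, as those of N contribute nothing positive to the old degree. For sP = 1 a
  further variable occurs because the order is at least 2, and it adds at least \<epsilon>. For sP
  >= 2 already 2 (1-\<epsilon>) > 1. Equality leaves the old principal terms in E and products of
  one variable of P with one of N.\<close>

lemma c_deg':
  assumes ca: "c a \<noteq> 0"
  shows "1 \<le> weighted_degree l' a"
    and "weighted_degree l' a = 1 \<Longrightarrow> ((\<forall>i. a i \<noteq> 0 \<longrightarrow> i \<in> E) \<and> weighted_degree l a = 1) \<or>
       (\<exists>p\<in>P. \<exists>q\<in>N. \<forall>i. a i = unit_idx p i + unit_idx q i)"
proof -
  define sP where "sP = (\<Sum>i\<in>P. a i)"
  define sN where "sN = (\<Sum>i\<in>N. a i)"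
  define w where "w = (\<Sum>i\<in>E. real (a i) * l $ i)"
  have w0: "w \<ge> 0" unfolding w_def by (intro sum_nonneg) (auto simp: E_def)
  have d': "weighted_degree l' a = (1 - \<epsilon>) * real sP + \<epsilon> * real sN + w"
    unfolding weighted_degree_def sum_PNE sP_def sN_def w_def
    by (simp add: l'_simps sum_distrib_left mult.commute)
  have dl: "weighted_degree l a = (\<Sum>i\<in>P. real (a i) * l $ i) + (\<Sum>i\<in>N. real (a i) * l $ i) + w"
    unfolding weighted_degree_def sum_PNE w_def by simp
  have N0: "(\<Sum>i\<in>N. real (a i) * l $ i) \<le> 0"
    by (intro sum_nonpos) (auto simp: N_def mult_nonneg_nonpos)
  consider "sP = 0" | "sP = 1" "sN = 0" | "sP = 1" "sN \<ge> 1" | "sP \<ge> 2" by linarith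
  then have "1 \<le> weighted_degree l' a \<and> (weighted_degree l' a = 1 \<longrightarrow> ((\<forall>i. a i \<noteq> 0 \<longrightarrow> i \<in> E) \<and> weighted_degree l a = 1) \<or>
       (\<exists>p\<in>P. \<exists>q\<in>N. \<forall>i. a i = unit_idx p i + unit_idx q i))"
  proof cases
    case 1
    then have P0: "a i = 0" if "i \<in> P" for i using that by (simp add: sP_def)
    then have "(\<Sum>i\<in>P. real (a i) * l $ i) = 0" by simp
    then have w1: "w \<ge> weighted_degree l a" "w \<ge> 1" using dl N0 c_deg[OF ca] by linarith+
    have "\<epsilon> * real sN \<ge> 0" using eps(1) by simp
    then have ge: "1 \<le> weighted_degree l' a" using d' 1 w1 by simp
    have "(\<forall>i. a i \<noteq> 0 \<longrightarrow> i \<in> E) \<and> weighted_degree l a = 1" if "weighted_degree l' a = 1"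
    proof
      have "\<epsilon> * real sN + w = 1" using that d' 1 by simp
      then have "\<epsilon> * real sN = 0" "w = 1" using w1 \<open>\<epsilon> * real sN \<ge> 0\<close> by linarith+
      then have "sN = 0" using eps(1) by simp
      then have "a i = 0" if "i \<in> N" for i using that by (simp add: sN_def)
      then have aE: "a i = 0" if "i \<notin> E" for i using P0[of i] that PNE(4) by auto
      show "\<forall>i. a i \<noteq> 0 \<longrightarrow> i \<in> E"
      proof (intro allI impI, rule ccontr)
        fix i assume "a i \<noteq> 0" "i \<notin> E"
        then show False using aE[of i] by simp
      qed
      show "weighted_degree l a = 1" using w1 \<open>w = 1\<close> c_deg[OF ca] by linarith
    qed
    with ge show ?thesis by blast
  next
    case 2
    have "(\<Sum>i\<in>UNIV. a i) = sP + sN + (\<Sum>i\<in>E. a i)" unfolding sum_PNE sP_def sN_def by simp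
    then have "(\<Sum>i\<in>E. a i) \<noteq> 0" using c_ord[OF ca] 2 by linarith
    then obtain e where e: "e \<in> E" "a e \<noteq> 0" by (meson sum.neutral)
    have "l $ e \<le> real (a e) * l $ e" using e by (simp add: E_def mult_le_cancel_right1)
    also have "\<dots> \<le> w" unfolding w_def by (rule member_le_sum) (use e in \<open>auto simp: E_def\<close>)
    finally have "weighted_degree l' a > 1" using d' 2 eps(3)[OF e(1)] by simp
    then show ?thesis by simp
  next
    case 3
    have ee: "\<epsilon> * real sN \<ge> \<epsilon>" using eps(1) 3 by simp
    then have ge: "1 \<le> weighted_degree l' a" using d' 3 w0 by simp
    have "\<exists>p\<in>P. \<exists>q\<in>N. \<forall>i. a i = unit_idx p i + unit_idx q i" if "weighted_degree l' a = 1"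
    proof -
      have "\<epsilon> * real sN + w = \<epsilon>" using that d' 3 by simp
      then have "\<epsilon> * real sN = \<epsilon>" "w = 0" using w0 ee by linarith+
      then have "sN = 1" using eps(1) by simp
      then obtain q where q: "q \<in> N" "\<And>i. i \<in> N \<Longrightarrow> a i = unit_idx q i"
        unfolding sN_def using sum_eq_1_unit_idx_on[of a N] by auto
      have "sP = 1" by (rule 3)
      then obtain p where p: "p \<in> P" "\<And>i. i \<in> P \<Longrightarrow> a i = unit_idx p i"
        unfolding sP_def using sum_eq_1_unit_idx_on[of a P] by auto
      have aE: "a i = 0" if "i \<in> E" for i
      proof -
        have "\<forall>i\<in>E. real (a i) * l $ i = 0"
          using \<open>w = 0\<close> unfolding w_def by (subst (asm) sum_nonneg_eq_0_iff) (auto simp: E_def)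
        then show ?thesis using that by (auto simp: E_def)
      qed
      have "a i = unit_idx p i + unit_idx q i" for i
      proof -
        consider "i \<in> P" | "i \<in> N" | "i \<in> E" using PNE by blast
        then show ?thesis
        proof cases
          case 1 then have "i \<noteq> q" using q PNE by blast
          then show ?thesis using p(2)[OF 1] by (simp add: unit_idx_def)
        next
          case 2 then have "i \<noteq> p" using p PNE by blast
          then show ?thesis using q(2)[OF 2] by (simp add: unit_idx_def)
        next
          case 3 then have "i \<noteq> p" "i \<noteq> q" using p q PNE by blast+
          then show ?thesis using aE[OF 3] by (simp add: unit_idx_def)
        qed
      qed
      then show ?thesis using p q by blast
    qed
    with ge show ?thesis by blast
  next
    case 4
    have "(1 - \<epsilon>) * real sP \<ge> (1 - \<epsilon>) * 2" using 4 eps by (intro mult_left_mono) auto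
    moreover have "\<epsilon> * real sN \<ge> 0" using eps(1) by simp
    ultimately have "weighted_degree l' a > 1" using d' w0 eps(2) by argo
    then show ?thesis by simp
  qed
  then show "1 \<le> weighted_degree l' a" and "weighted_degree l' a = 1 \<Longrightarrow> ((\<forall>i. a i \<noteq> 0 \<longrightarrow> i \<in> E) \<and> weighted_degree l a = 1) \<or>
       (\<exists>p\<in>P. \<exists>q\<in>N. \<forall>i. a i = unit_idx p i + unit_idx q i)" by blast+
qed

lemma hess_c: "hess c j i \<noteq> 0 \<Longrightarrow> 1 \<le> l $ i + l $ j" "l $ i + l $ j = 1 \<Longrightarrow> hess c j i = hess c0 j i"
proof -
  show "hess c j i \<noteq> 0 \<Longrightarrow> 1 \<le> l $ i + l $ j"
    using diff_coeff_degree[of c l j "unit_idx i", OF c_deg] by (simp add: hess_def weighted_degree_unit_idx)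
  assume "l $ i + l $ j = 1"
  then have "weighted_degree l ((unit_idx i)(j := Suc (unit_idx i j))) \<le> 1"
    by (simp add: weighted_degree_upd_Suc weighted_degree_unit_idx)
  then show "hess c j i = hess c0 j i" by (simp add: hess_def diff_coeff_def c_eq)
qed

text \<open>The only terms of new degree 1 that contain a variable of P or N are quadratic, so the
  leading part of this derivative is linear in the variables of the opposite block.\<close>

lemma principal_pair:
  assumes j: "j \<in> P \<union> N"
  shows "(\<Sum>a\<in>{a. diff_coeff j c a \<noteq> 0 \<and> weighted_degree l' a = 1 - l' $ j}. diff_coeff j c a * monomial a z)
     = (\<Sum>i\<in>(if j \<in> P then N else P). hess c j i * z $ i)"
proof -
  let ?A = "{a. diff_coeff j c a \<noteq> 0 \<and> weighted_degree l' a = 1 - l' $ j}"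
  define Q where "Q = (if j \<in> P then N else P)"
  have sub: "?A \<subseteq> unit_idx ` Q"
  proof
    fix a assume a: "a \<in> ?A"
    let ?b = "a(j := Suc (a j))"
    have "c ?b \<noteq> 0" "weighted_degree l' ?b = 1" using a by (auto simp: diff_coeff_def weighted_degree_upd_Suc)
    moreover have "?b j \<noteq> 0" "j \<notin> E" using j PNE by auto
    ultimately obtain p q where pq: "p \<in> P" "q \<in> N" "\<And>i. ?b i = unit_idx p i + unit_idx q i"
      using c_deg'(2)[of ?b] by blast
    have ne: "p \<noteq> q" using pq PNE by blast
    have "j = p \<or> j = q" using pq(3)[of j] by (auto simp: unit_idx_def split: if_splits)
    then show "a \<in> unit_idx ` Q"
    proof
      assume jp: "j = p"
      have "a i = unit_idx q i" for i using pq(3)[of i] ne jp by (auto simp: unit_idx_def split: if_splits)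
      then show ?thesis using pq jp by (auto simp: Q_def)
    next
      assume jq: "j = q"
      have "a i = unit_idx p i" for i using pq(3)[of i] ne jq by (auto simp: unit_idx_def split: if_splits)
      moreover have "j \<notin> P" using jq pq PNE by blast
      ultimately show ?thesis using pq by (auto simp: Q_def)
    qed
  qed
  have "(\<Sum>a\<in>?A. diff_coeff j c a * monomial a z) = (\<Sum>a\<in>unit_idx ` Q. diff_coeff j c a * monomial a z)"
  proof (rule sum.mono_neutral_left[OF _ sub])
    have "l' $ i = 1 - l' $ j" if "i \<in> Q" for i
      using that j PNE by (auto simp: Q_def l'_simps split: if_splits)
    then show "\<forall>a\<in>unit_idx ` Q - ?A. diff_coeff j c a * monomial a z = 0"
      by (auto simp: weighted_degree_unit_idx)
  qed simp
  also have "\<dots> = (\<Sum>i\<in>Q. hess c j i * z $ i)"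
    by (subst sum.reindex) (auto simp: hess_def monomial_unit_idx intro: inj_on_subset[OF inj_unit_idx])
  finally show ?thesis by (simp add: Q_def)
qed

text \<open>By the two block lemmas a common zero z lives on E. It is dilated close to 0 and
  corrected in the P-coordinates to a point u with \<open>solve_N\<close>. There f0 is critical: the
  N-components vanish by construction; the P-components because degree 1 - l_j <= 0 cannot be
  reached with positive weights; the E-components because degree 1 - l_j < 1 excludes variables of
  P, so they are multiples of the sums assumed to vanish at z.\<close>

lemma principal_isolated:
  assumes z: "\<And>j. (\<Sum>a\<in>{a. diff_coeff j c a \<noteq> 0 \<and> weighted_degree l' a = 1 - l' $ j}. diff_coeff j c a * monomial a z) = 0"
  shows "z = 0"
proof (rule ccontr)
  assume z0: "z \<noteq> 0"
  have zP: "z $ i = 0" if "i \<in> P" for i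
  proof -
    define y :: "complex ^ 'n" where "y = (\<chi> i. if i \<in> P then z $ i else 0)"
    have "y = 0"
    proof (rule block_injective[where h="hess c", OF hess_c])
      show "y $ i = 0" if "i \<notin> P" for i using that by (simp add: y_def)
      fix q assume q: "q \<in> N"
      then have "q \<notin> P" using PNE by blast
      then have "(\<Sum>i\<in>P. hess c q i * z $ i) = 0" using principal_pair[of q z] z[of q] q by simp
      moreover have "(\<Sum>i\<in>UNIV. hess c q i * y $ i) = (\<Sum>i\<in>P. hess c q i * z $ i)"
        by (rule sum.mono_neutral_cong_right) (auto simp: y_def)
      ultimately show "(\<Sum>i\<in>UNIV. hess c q i * y $ i) = 0" by simp
    qed
    then have "y $ i = 0" by simp
    then show ?thesis using that by (simp add: y_def)
  qed
  have zN: "z $ i = 0" if "i \<in> N" for i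
  proof -
    define y :: "complex ^ 'n" where "y = (\<chi> i. if i \<in> N then z $ i else 0)"
    have "y = 0"
    proof (rule block_injective'[where h="hess c", OF hess_c])
      show "y $ i = 0" if "i \<notin> N" for i using that by (simp add: y_def)
      fix p assume p: "p \<in> P"
      then have "(\<Sum>i\<in>N. hess c p i * z $ i) = 0" using principal_pair[of p z] z[of p] by simp
      moreover have "(\<Sum>i\<in>UNIV. hess c i p * y $ i) = (\<Sum>i\<in>N. hess c p i * z $ i)"
        by (rule sum.mono_neutral_cong_right) (auto simp: y_def hess_sym[of c p])
      ultimately show "(\<Sum>i\<in>UNIV. hess c i p * y $ i) = 0" by simp
    qed
    then have "y $ i = 0" by simp
    then show ?thesis using that by (simp add: y_def)
  qed
  have zE: "i \<in> E" if "z $ i \<noteq> 0" for i using that zP zN PNE by blast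
  \<comment> \<open>Both y and v will be shorter than s, so u stays in the isolating ball and in the
    polydisc of radius r/3.\<close>
  define s where "s = min (d/2) (r/6)"
  have s: "s > 0" using d r_pos by (simp add: s_def)
  obtain \<delta> where del: "0 < \<delta>" "\<And>z. norm z < \<delta> \<Longrightarrow> \<exists>v. (\<forall>i. i \<notin> P \<longrightarrow> v $ i = 0) \<and> norm v < s \<and> (\<forall>q\<in>N. gradient f0 (z + v) $ q = 0)"
    using solve_N[OF s] by metis
  define b where "b = min \<delta> s / (2 * CARD('n) * norm z)"
  have nz: "norm z > 0" using z0 by simp
  have b: "b > 0" using nz del s by (simp add: b_def)
  obtain t where t: "0 < t" "\<And>x i. 0 < x \<Longrightarrow> x \<le> t \<Longrightarrow> x powr (l' $ i) \<le> b"
    using powr_small_all[of l' b, OF l'_bounds(1) b] by metis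
  define y where "y = dil l' t z"
  have yi: "y $ i = of_real (t powr (l' $ i)) * z $ i" for i by (simp add: y_def dil_def)
  have "norm (y $ i) \<le> b * norm z" for i
    unfolding yi norm_mult using t(2)[OF t(1) order_refl, of i] b by (intro mult_mono norm_nth_le_norm) auto
  from norm_le_card_nth[OF this] have "norm y \<le> min \<delta> s / 2" using nz by (simp add: b_def)
  then have ny: "norm y < \<delta>" "norm y < s" using del(1) s by auto
  have y0: "y $ i = 0 \<longleftrightarrow> z $ i = 0" for i using t(1) by (simp add: yi)
  obtain v where v: "\<And>i. i \<notin> P \<Longrightarrow> v $ i = 0" "norm v < s" "\<And>q. q \<in> N \<Longrightarrow> gradient f0 (y + v) $ q = 0"
    using del(2)[OF ny(1)] by blast
  define u where "u = y + v"
  have nu: "norm u < d" "norm u < r/3"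
    using norm_triangle_ineq[of y v] ny v(2) by (auto simp: u_def s_def)
  have ur: "norm (u $ i) \<le> r/3" for i using norm_nth_le_norm[of u i] nu by linarith
  have uN: "u $ i = 0" if "i \<in> N" for i
    using v(1)[of i] y0[of i] zN[OF that] that PNE by (auto simp: u_def)
  have uE: "u $ i = y $ i" if "i \<in> E" for i using v(1)[of i] that PNE by (auto simp: u_def)
  obtain i0 where i0: "z $ i0 \<noteq> 0" using z0 by (auto simp: vec_eq_iff)
  have "u $ i0 \<noteq> 0" using uE[OF zE[OF i0]] y0[of i0] i0 by simp
  then have u0: "u \<noteq> 0" by auto
  have pos: "0 < l $ i" if "a i \<noteq> 0" "monomial a u \<noteq> 0" for a i
  proof -
    have "i \<notin> N" using monomial_nz[OF that(2,1)] uN[of i] by blast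
    then show ?thesis by (simp add: N_def)
  qed
  have suppE: "i \<in> E" if a: "diff_coeff j c0 a \<noteq> 0" "monomial a u \<noteq> 0" "0 < l $ j" "a i \<noteq> 0" for a i j
  proof -
    have "l $ i \<le> weighted_degree l a"
      by (rule weighted_degree_ge_nth) (use pos a in \<open>auto intro: less_imp_le\<close>)
    then have "l $ i < 1" using diff_coeff_deg[OF a(1)] a(3) by simp
    then show ?thesis using pos[OF a(4,2)] by (simp add: E_def)
  qed
  have "gradient f0 u $ j = 0" for j
  proof -
    consider "j \<in> N" | "j \<in> P" | "j \<in> E" using PNE by blast
    then show ?thesis
    proof cases
      case 1 then show ?thesis using v(3) by (simp add: u_def)
    next
      case 2
      show ?thesis
      proof (rule gradient_zero[OF ur])
        fix a assume a: "diff_coeff j c0 a \<noteq> 0" "monomial a u \<noteq> 0"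
        obtain i where i: "a i \<noteq> 0" using diff_coeff_nz[OF a(1)] .
        have "l $ i \<le> weighted_degree l a"
          by (rule weighted_degree_ge_nth) (use pos a i in \<open>auto intro: less_imp_le\<close>)
        then show False using diff_coeff_deg[OF a(1)] pos[OF i a(2)] 2 by (simp add: P_def)
      qed
    next
      case 3
      let ?A = "{a. diff_coeff j c a \<noteq> 0 \<and> weighted_degree l' a = 1 - l' $ j}"
      have lj: "0 < l $ j" using 3 by (simp add: E_def)
      have inA: "a \<in> ?A" if a: "diff_coeff j c0 a \<noteq> 0" "monomial a u \<noteq> 0" for a
      proof -
        have "diff_coeff j c a = diff_coeff j c0 a"
          using diff_coeff_deg[OF a(1)] by (simp add: diff_coeff_def c_eq weighted_degree_upd_Suc)
        moreover have "weighted_degree l' a = weighted_degree l a"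
          unfolding weighted_degree_def
        proof (rule sum.cong)
          show "real (a i) * l' $ i = real (a i) * l $ i" for i
            using suppE[OF a lj, of i] by (cases "a i = 0") (auto simp: l'_simps)
        qed simp
        ultimately show ?thesis using a(1) diff_coeff_deg[OF a(1)] 3 by (simp add: l'_simps)
      qed
      have eqA: "diff_coeff j c0 a * monomial a u = of_real (t powr (1 - l' $ j)) * (diff_coeff j c a * monomial a z)" if a: "a \<in> ?A" for a
      proof -
        let ?b = "a(j := Suc (a j))"
        have "c ?b \<noteq> 0" "weighted_degree l' ?b = 1" using a by (auto simp: diff_coeff_def weighted_degree_upd_Suc)
        then have "((\<forall>i. ?b i \<noteq> 0 \<longrightarrow> i \<in> E) \<and> weighted_degree l ?b = 1) \<or>
           (\<exists>p\<in>P. \<exists>q\<in>N. \<forall>i. ?b i = unit_idx p i + unit_idx q i)" by (rule c_deg'(2))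
        moreover have "\<not> (\<exists>p\<in>P. \<exists>q\<in>N. \<forall>i. ?b i = unit_idx p i + unit_idx q i)"
        proof safe
          fix p q assume pq: "p \<in> P" "q \<in> N" "\<forall>i. ?b i = unit_idx p i + unit_idx q i"
          have "j \<noteq> p" "j \<noteq> q" using pq(1,2) 3 PNE by blast+
          then show False using pq(3)[rule_format, of j] by (simp add: unit_idx_def)
        qed
        ultimately have bE: "\<And>i. ?b i \<noteq> 0 \<Longrightarrow> i \<in> E" and wb: "weighted_degree l ?b = 1" by blast+
        have aE: "i \<in> E" if "a i \<noteq> 0" for i using bE[of i] that by (auto split: if_splits)
        have "monomial a u = monomial a y" by (rule monomial_cong) (use uE aE in blast)
        also have "\<dots> = of_real (t powr (1 - l' $ j)) * monomial a z"
          using a t(1) by (simp add: y_def monomial_dil)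
        finally have "monomial a u = of_real (t powr (1 - l' $ j)) * monomial a z" .
        moreover have "diff_coeff j c a = diff_coeff j c0 a" using wb by (simp add: diff_coeff_def c_eq)
        ultimately show ?thesis by simp
      qed
      have fA: "finite ?A" by (rule finite_subset[OF _ finite_weighted_degree_le[OF l'_bounds(1), of "1 - l' $ j"]]) auto
      have "gradient f0 u $ j = (\<Sum>a\<in>?A. diff_coeff j c0 a * monomial a u)"
        by (rule has_sum_finite_support[OF gradient_has_sum[OF ur] fA]) (use inA in fastforce)
      also have "\<dots> = of_real (t powr (1 - l' $ j)) * (\<Sum>a\<in>?A. diff_coeff j c a * monomial a z)"
        unfolding sum_distrib_left by (rule sum.cong[OF refl eqA])
      also have "\<dots> = 0" using z[of j] by simp
      finally show ?thesis .
    qed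
  qed
  then have "gradient f0 u = 0" by (simp add: vec_eq_iff)
  with iso[OF u0 nu(1)] show False by simp
qed

text \<open>For x <= 0 the old multiplicities of x and 1-x cancel by \<open>count_eq\<close>; at x =
  \<epsilon> the new ones cancel because P and N are equinumerous; at every other x up to 1/2 the
  multiplicities involved are unchanged.\<close>

lemma l_min_l': "l_min l = l_min l'"
proof (rule l_min_cong)
  fix x :: real assume x: "x \<le> 1/2"
  consider "x \<le> 0" | "x = \<epsilon>" | "0 < x" "x \<noteq> \<epsilon>" by linarith
  then show "x \<in> reduced_weights l \<longleftrightarrow> x \<in> reduced_weights l'"
  proof cases
    case 1
    have "{i. l $ i > 1/2 \<and> l $ i = 1 - x} = {i. l $ i = 1 - x}" using 1 by auto
    then have "x \<notin> reduced_weights l" using count_eq[of "1 - x"] 1 by (simp add: reduced_weights_iff)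
    moreover have "l' $ i \<noteq> x" for i using 1 l'_bounds(1)[of i] by linarith
    then have "x \<notin> reduced_weights l'" using 1 by (simp add: reduced_weights_iff)
    ultimately show ?thesis by blast
  next
    case 2
    have "{i. l $ i = x} = {}"
    proof -
      have "l $ i \<noteq> \<epsilon>" for i
      proof
        assume "l $ i = \<epsilon>"
        then have "i \<in> E" using eps(1,2) by (simp add: E_def)
        then show False using eps(3)[of i] \<open>l $ i = \<epsilon>\<close> by simp
      qed
      then show ?thesis using 2 by simp
    qed
    moreover have "{i. l' $ i = x} = N"
    proof -
      have "l' $ i = \<epsilon> \<longleftrightarrow> i \<in> N" for i
      proof -
        consider "i \<in> P" | "i \<in> N" | "i \<in> E" using PNE by blast
        then show ?thesis
          by cases (use PNE eps(2) eps(3)[of i] in \<open>auto simp: l'_simps\<close>)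
      qed
      then show ?thesis using 2 by auto
    qed
    moreover have "{i. l' $ i > 1/2 \<and> l' $ i = 1 - x} = P"
    proof -
      have "l' $ i > 1/2 \<and> l' $ i = 1 - \<epsilon> \<longleftrightarrow> i \<in> P" for i
      proof -
        consider "i \<in> P" | "i \<in> N" | "i \<in> E" using PNE by blast
        then show ?thesis
          by cases (use PNE eps(2) eps(4)[of i] in \<open>auto simp: l'_simps\<close>)
      qed
      then show ?thesis using 2 by auto
    qed
    ultimately show ?thesis using 2 eps(2) by (simp add: reduced_weights_iff card_PN)
  next
    case 3
    have "l $ i = x \<longleftrightarrow> l' $ i = x" for i
    proof -
      consider "i \<in> P" | "i \<in> N" | "i \<in> E" using PNE by blast
      then show ?thesis
        by cases (use 3 x eps(2) in \<open>auto simp: l'_simps P_def N_def\<close>)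
    qed
    moreover have "(l $ i > 1/2 \<and> l $ i = 1 - x) \<longleftrightarrow> (l' $ i > 1/2 \<and> l' $ i = 1 - x)" for i
    proof -
      consider "i \<in> P" | "i \<in> N" | "i \<in> E" using PNE by blast
      then show ?thesis
        by cases (use 3 x eps(2) in \<open>auto simp: l'_simps P_def N_def\<close>)
    qed
    ultimately show ?thesis by (simp add: reduced_weights_iff)
  qed
qed

lemma lojasiewicz_weak:
  assumes "expands s f c"
  shows "gradient_lojasiewicz_exponent f = ereal (1 / l_min l - 1)"
proof -
  interpret pw: positive_weights l' c f s
    by unfold_locales (use assms l'_bounds c_deg'(1) principal_isolated in auto)
  show ?thesis using pw.lojasiewicz_positive by (simp add: l_min_l')
qed

end

theorem theorem4:
  fixes f :: "complex ^ 'n::finite \<Rightarrow> complex" and l :: "real ^ 'n"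
  assumes "weakly_semiquasihomogeneous f 1 l"
  shows "gradient_lojasiewicz_exponent f = ereal (1 / l_min l - 1)"
proof -
  obtain f0 f' c' where f: "\<forall>\<^sub>F z in nhds 0. f z = f0 z + f' z"
    and qh: "weakly_quasihomogeneous f0 1 l" and sing: "isolated_singularity f0"
    and c': "has_expansion f' c'" "series_order c' > 1" "\<And>a. c' a \<noteq> 0 \<Longrightarrow> weighted_degree l a > 1"
    using assms unfolding weakly_semiquasihomogeneous_def by blast
  obtain c0 where c0: "has_expansion f0 c0" "\<And>a. c0 a \<noteq> 0 \<Longrightarrow> weighted_degree l a = 1"
    using qh unfolding weakly_quasihomogeneous_def by blast
  obtain r where r: "expands r f0 c0" using has_expansion_expands[OF c0(1)] .
  obtain d where d: "d > 0" "\<And>z. z \<noteq> 0 \<Longrightarrow> norm z < d \<Longrightarrow> gradient f0 z \<noteq> 0"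
    using sing unfolding isolated_singularity_def eventually_at by (auto simp: dist_norm)
  have g0: "gradient f0 0 = 0" using sing by (simp add: isolated_singularity_def)
  have ord': "2 \<le> (\<Sum>i\<in>UNIV. a i)" if "c' a \<noteq> 0" for a
  proof -
    have "series_order c' \<le> enat (\<Sum>i\<in>UNIV. a i)"
      unfolding series_order_def by (rule INF_lower) (use that in simp)
    then have "1 < enat (\<Sum>i\<in>UNIV. a i)" by (rule less_le_trans[OF c'(2)])
    then show ?thesis by (simp add: one_enat_def)
  qed
  interpret weak_sum l c0 f0 r d c'
    by unfold_locales (use r c0 g0 d ord' c' in auto)
  have "has_expansion f c"
    using f c0(1) c'(1) unfolding has_expansion_def
    by eventually_elim (auto simp: c_def[abs_def] distrib_right intro: has_sum_add)
  then obtain s where "expands s f c" by (rule has_expansion_expands)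
  then show ?thesis by (rule lojasiewicz_weak)
qed

end
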